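(* Let $r, z_0 \in \mathbb{R}$ with $0 < r < z_0$, and let $E = D_r(z_0) \cup D_r(-z_0)$, where $D_r(a) = \{ z \in \mathbb{C} : |z - a| \leq r \}$. Let $T$ be the Möbius transformation $$T(z) = \frac{\alpha + z}{\alpha - z}, \qquad \alpha = \sqrt{z_0^2 - r^2} > 0,$$ let $$0 < \rho = \frac{\sqrt{z_0 + r} - \sqrt{z_0 - r}}{\sqrt{z_0 + r} + \sqrt{z_0 - r}} < 1,$$ and define $$L = 2 \rho \prod_{n=1}^\infty \Big( \frac{1 + \rho^{8n}}{1 + \rho^{8n-4}} \Big)^2, \qquad k = L^2, \qquad K = \int_0^1 \frac{dt}{\sqrt{(1 - t^2)(1 - k^2 t^2)}},$$ $$f(z) = L \, \mathrm{sn}\Big( \frac{2K}{\pi} i \log\Big( \frac{z}{\rho} \Big) + K; k \Big) \qquad (\rho < |z| < \rho^{-1}).$$ Set $$C = \frac{2 K \alpha}{\pi} (1 - L)^2, \qquad D = \frac{2 K \alpha}{\pi} (1 + L)^2,$$ and let $$\Phi_1(z) = z \Big( \frac{1}{2} + \frac{DC}{2 z^2} \pm \frac{1}{2 z^2} \sqrt{(z^2 - C^2)(z^2 - D^2)} \Big)^{\frac{1}{2}}$$ be the lemniscatic map of $[-D,-C] \cup [C,D]$. Then $$\Phi(z) = \Phi_1\big( f'(-1) \cdot (T^{-1} \circ f \circ T)(z) \big)$$ is the lemniscatic map of $E$, with corresponding lemniscatic domain $$\mathcal{L} = \left\{ w \in \widehat{\mathbb{C}} : \Big| w^2 - \Big(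 \frac{2 K \alpha}{\pi} (1 + L^2) \Big)^2 \Big|^{\frac{1}{2}} > \sqrt{2 L (1 + L^2)} \, \frac{2 K \alpha}{\pi} \right\},$$ and hence, in particular, the logarithmic capacity of $E$ is $c(E) = \sqrt{2 L (1 + L^2)} \, \frac{2 K \alpha}{\pi}$.
   Context: $\widehat{\mathbb{C}} = \mathbb{C} \cup \{\infty\}$ is the extended complex plane. $\mathrm{sn}(\cdot\,; k)$ is the Jacobi elliptic sine with modulus $k$. The function $f$ does not depend on the choice of the branch of the logarithm; it is a bijective conformal map from the annulus $\rho < |z| < \rho^{-1}$ onto the plane minus the slits $(-\infty, -1/L]$, $[-L, L]$, $[1/L, \infty)$ (Nehari). $T$ and $T^{-1}(w) = \alpha \frac{w-1}{w+1}$ are regarded as maps of $\widehat{\mathbb{C}}$. In the formula for $\Phi_1$ the principal branch of the outer square root is taken, and the branch $\pm\sqrt{(z^2-C^2)(z^2-D^2)}$ is chosen such that $\big| \frac{2}{D^2 - C^2} \big( z^2 - \frac{D^2 + C^2}{2} \pm \sqrt{(z^2 - C^2)(z^2 - D^2)} \big) \big| > 1$ for $z \in \mathbb{C} \setminus ([-D,-C]\cup[C,D])$; the formula is understood at $z=0$ and $z=\infty$ by analytic (respectively meromorphic) extension, so $\Phi_1(0)=0$, $\Phi_1(\infty)=\infty$. A lemniscatic domain is a domain of the form $\mathcal{L} = \{ w \in \widehat{\mathbb{C}} : |U(w)| > \mu \}$ (containing $\infty$) with $U(w) = \prod_{j=1}^N (w - a_j)^{m_j}$, where $a_1, \dots,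 a_N \in \mathbb{C}$ are pairwise distinct, $m_1, \dots, m_N > 0$ are real with $\sum_{j=1}^N m_j = 1$, and $\mu > 0$. The function $U$ is in general multiple-valued, but $|U(w)| = \prod_j |w-a_j|^{m_j}$ is single-valued. A compact set in $\mathbb{C}$ is called simply connected if it is connected and its complement in $\widehat{\mathbb{C}}$ is connected. If $E = \bigcup_{j=1}^N E_j$ with $E_1, \dots, E_N \subseteq \mathbb{C}$ mutually exterior simply connected compact sets (none a single point), and $\mathcal{K} = \widehat{\mathbb{C}} \setminus E$, then by a theorem of Walsh there exist a unique lemniscatic domain $\mathcal{L}$ (with $N$ points $a_j$) and a unique bijective conformal map $\Phi : \mathcal{K} \to \mathcal{L}$ with $\Phi(z) = z + \mathcal{O}(1/z)$ for $z$ near infinity (in particular $\Phi(\infty)=\infty$). This $\Phi$ is called the lemniscatic map of $\mathcal{K}$ (or of $E$), and $\mathcal{L}$ its corresponding lemniscatic domain. The logarithmic capacity is $c(E) = \lim_{z \to \infty} \exp(\log|z| - g_{\mathcal{K}}(z))$, where $g_{\mathcal{K}}$ is the Green's function of $\mathcal{K}$ with pole at infinity. *)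

theory Defs
  imports "HOL-Complex_Analysis.Complex_Analysis" "HOL-Library.Landau_Symbols"
begin

section \<open>The extended complex plane\<close>

text \<open>The point at infinity is \<open>None\<close>; the topology is that of the one-point compactification.
  A map \<open>f\<close> of the plane acts on the sphere as \<open>map_option f\<close>, fixing the point at infinity.\<close>

type_synonym sphere = "complex option"

abbreviation sphere_top :: "sphere topology" where
  "sphere_top \<equiv> Alexandroff_compactification euclidean"

definition sphere_inverse :: "sphere \<Rightarrow> sphere" where
  "sphere_inverse p =
     (case p of None \<Rightarrow> Some 0 | Some z \<Rightarrow> if z = 0 then None else Some (1 / z))"

text \<open>The local coordinate at a finite point is \<open>z\<close>, at infinity it is \<open>1/z\<close>. As both coordinate
  changes are involutions of the sphere, the same function serves as coordinate and as its inverse.\<close>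

definition sphere_chart :: "sphere \<Rightarrow> sphere \<Rightarrow> sphere" where
  "sphere_chart p = (if p = None then sphere_inverse else id)"

definition local_coord :: "sphere \<Rightarrow> complex" where
  "local_coord p = the (sphere_chart p p)"

text \<open>The expression of \<open>F\<close> in the local coordinates at \<open>p\<close> and \<open>F p\<close>. If \<open>F\<close> is continuous
  at \<open>p\<close>, the argument of \<open>the\<close> is finite near \<open>local_coord p\<close>.\<close>

definition local_expr :: "(sphere \<Rightarrow> sphere) \<Rightarrow> sphere \<Rightarrow> complex \<Rightarrow> complex" where
  "local_expr F p = (\<lambda>z. the (sphere_chart (F p) (F (sphere_chart p (Some z)))))"

definition sphere_conformal_on :: "(sphere \<Rightarrow> sphere) \<Rightarrow> sphere set \<Rightarrow> bool" where
  "sphere_conformal_on F S \<longleftrightarrow>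
     openin sphere_top S \<and>
     continuous_map (subtopology sphere_top S) sphere_top F \<and>
     (\<forall>p\<in>S. local_expr F p analytic_on {local_coord p} \<and>
            deriv (local_expr F p) (local_coord p) \<noteq> 0)"

text \<open>\<open>z \<mapsto> (a z + b) / (c z + d)\<close> on the sphere, meant for \<open>a d - b c \<noteq> 0\<close>.\<close>

definition sphere_moebius :: "complex \<Rightarrow> complex \<Rightarrow> complex \<Rightarrow> complex \<Rightarrow> sphere \<Rightarrow> sphere" where
  "sphere_moebius a b c d p =
     (case p of
        None \<Rightarrow> if c = 0 then None else Some (a / c)
      | Some z \<Rightarrow> if c * z + d = 0 then None else Some ((a * z + b) / (c * z + d)))"


section \<open>Lemniscatic domains and lemniscatic maps\<close>

definition is_lemniscatic_domain :: "nat \<Rightarrow> sphere set \<Rightarrow> bool" where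
  "is_lemniscatic_domain N \<L> \<longleftrightarrow>
     (\<exists>(a :: nat \<Rightarrow> complex) (m :: nat \<Rightarrow> real) (\<mu> :: real).
        inj_on a {..<N} \<and> (\<forall>j<N. m j > 0) \<and> (\<Sum>j<N. m j) = 1 \<and> \<mu> > 0 \<and>
        \<L> = insert None (Some ` {w. (\<Prod>j<N. norm (w - a j) powr m j) > \<mu>}))"

definition simply_connected_compact :: "complex set \<Rightarrow> bool" where
  "simply_connected_compact S \<longleftrightarrow>
     compact S \<and> S \<noteq> {} \<and> connected S \<and> connectedin sphere_top (UNIV - Some ` S)"

text \<open>The complement of each \<open>S j\<close> is connected, hence it is the exterior of \<open>S j\<close>, and being
  mutually exterior amounts to being disjoint.\<close>

definition walsh_union :: "nat \<Rightarrow> complex set \<Rightarrow> bool" where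
  "walsh_union N E \<longleftrightarrow>
     (\<exists>S :: nat \<Rightarrow> complex set.
        E = (\<Union>j<N. S j) \<and>
        (\<forall>j<N. simply_connected_compact (S j) \<and> (\<forall>z. S j \<noteq> {z})) \<and>
        (\<forall>i<N. \<forall>j<N. i \<noteq> j \<longrightarrow> S i \<inter> S j = {}))"

text \<open>\<open>\<Phi>\<close> is the lemniscatic map of \<open>E\<close>, and \<open>\<L>\<close> is the corresponding lemniscatic domain. Only the
  values of \<open>\<Phi>\<close> on the complement of \<open>E\<close> matter; there \<open>\<Phi>\<close>, as well as \<open>\<L>\<close>, is determined by
  these conditions (Walsh). The number \<open>N\<close> is the number of components of \<open>E\<close>.\<close>

definition is_lemniscatic_map :: "complex set \<Rightarrow> (sphere \<Rightarrow> sphere) \<Rightarrow> sphere set \<Rightarrow> bool" where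
  "is_lemniscatic_map E \<Phi> \<L> \<longleftrightarrow>
     (\<exists>N. walsh_union N E \<and> is_lemniscatic_domain N \<L>) \<and>
     bij_betw \<Phi> (UNIV - Some ` E) \<L> \<and>
     sphere_conformal_on \<Phi> (UNIV - Some ` E) \<and>
     \<Phi> None = None \<and>
     (\<lambda>z. the (\<Phi> (Some z)) - z) \<in> O[at_infinity](\<lambda>z. 1 / z)"


section \<open>Green's function and logarithmic capacity\<close>

text \<open>Real-valued \<open>C\<^sup>2\<close> functions of \<open>z = x + iy\<close> with vanishing Laplacian.\<close>

definition harmonic_on :: "(complex \<Rightarrow> real) \<Rightarrow> complex set \<Rightarrow> bool" where
  "harmonic_on g U \<longleftrightarrow>
     open U \<and>
     (\<exists>gx gy gxx gxy gyx gyy :: complex \<Rightarrow> real.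
        (\<forall>z\<in>U. (g has_derivative (\<lambda>h. gx z * Re h + gy z * Im h)) (at z) \<and>
               (gx has_derivative (\<lambda>h. gxx z * Re h + gxy z * Im h)) (at z) \<and>
               (gy has_derivative (\<lambda>h. gyx z * Re h + gyy z * Im h)) (at z) \<and>
               gxx z + gyy z = 0) \<and>
        continuous_on U gxx \<and> continuous_on U gxy \<and> continuous_on U gyx \<and> continuous_on U gyy)"

text \<open>Green's function with pole at infinity of the complement of a compact set \<open>E\<close>, for \<open>E\<close> whose
  complement is connected and regular for the Dirichlet problem (every boundary point is required
  to have boundary value 0). It is extended by 0 to \<open>E\<close> so that it is a unique total function.\<close>

definition is_green_function :: "complex set \<Rightarrow> (complex \<Rightarrow> real) \<Rightarrow> bool" where
  "is_green_function E g \<longleftrightarrow>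
     harmonic_on g (- E) \<and>
     (\<lambda>z. g z - ln (norm z)) \<in> O[at_infinity](\<lambda>_. 1) \<and>
     (\<forall>\<zeta>\<in>frontier E. (g \<longlongrightarrow> 0) (at \<zeta> within - E)) \<and>
     (\<forall>z\<in>E. g z = 0)"

definition green_function :: "complex set \<Rightarrow> complex \<Rightarrow> real" where
  "green_function E = (THE g. is_green_function E g)"

definition log_capacity :: "complex set \<Rightarrow> real" where
  "log_capacity E = Lim at_infinity (\<lambda>z. exp (ln (norm z) - green_function E z))"


section \<open>The Jacobi elliptic sine\<close>

definition elliptic_F :: "real \<Rightarrow> real \<Rightarrow> real" where
  "elliptic_F k x = integral {0..x} (\<lambda>t. 1 / sqrt ((1 - t\<^sup>2) * (1 - k\<^sup>2 * t\<^sup>2)))"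

text \<open>The elliptic sine with modulus \<open>k\<close>, meant for \<open>0 < k < 1\<close>, is the meromorphic continuation to
  the plane of the inverse function of the elliptic integral of the first kind
  \<open>x \<mapsto> elliptic_F k x\<close> on \<open>[0, 1]\<close>. A function that is nicely meromorphic has no removable
  singularities and takes the value 0 at its poles, which makes the continuation unique as a
  total function.\<close>

definition jacobi_sn :: "real \<Rightarrow> complex \<Rightarrow> complex" where
  "jacobi_sn k = (THE s. s nicely_meromorphic_on UNIV \<and>
     (\<forall>x\<in>{0..1}. s (of_real (elliptic_F k x)) = of_real x))"


section \<open>The square root in the lemniscatic map of two intervals\<close>

text \<open>The value of \<open>\<plusminus>sqrt ((z\<^sup>2 - C\<^sup>2) (z\<^sup>2 - D\<^sup>2))\<close> for \<open>0 < C < D\<close> and \<open>z\<close> outside the intervals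
  \<open>[-D, -C]\<close> and \<open>[C, D]\<close>: with \<open>x = (2 z\<^sup>2 - D\<^sup>2 - C\<^sup>2) / (D\<^sup>2 - C\<^sup>2)\<close>, the two numbers
  \<open>x \<plusminus> sqrt (x\<^sup>2 - 1)\<close> are reciprocal, and exactly one has modulus greater than 1.\<close>

definition exterior_root :: "real \<Rightarrow> real \<Rightarrow> complex \<Rightarrow> complex" where
  "exterior_root C D z = (THE s. s\<^sup>2 = (z\<^sup>2 - (of_real C)\<^sup>2) * (z\<^sup>2 - (of_real D)\<^sup>2) \<and>
     norm (2 / ((of_real D)\<^sup>2 - (of_real C)\<^sup>2) *
           (z\<^sup>2 - ((of_real D)\<^sup>2 + (of_real C)\<^sup>2) / 2 + s)) > 1)"

text \<open>At \<open>z = 0\<close> the formula below evaluates to 0 by the convention \<open>x / 0 = 0\<close>, and \<open>map_option\<close>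
  sends infinity to infinity; both are the values of the analytic (meromorphic) extension.\<close>

definition two_interval_map :: "real \<Rightarrow> real \<Rightarrow> sphere \<Rightarrow> sphere" where
  "two_interval_map C D = map_option (\<lambda>z.
     z * csqrt (1 / 2 + of_real (D * C) / (2 * z\<^sup>2) + 1 / (2 * z\<^sup>2) * exterior_root C D z))"

end

theory Submission
  imports Defs
begin

text \<open>
  On the annulus \<open>\<rho> < |z| < 1/\<rho>\<close> the map \<open>f\<close> equals the quotient of theta products
  \<open>F(z) = z \<theta>(-\<rho>\<^sup>2/z\<^sup>2) / \<theta>(-\<rho>\<^sup>2z\<^sup>2)\<close> with base \<open>\<rho>\<^sup>8\<close>, which is invariant under \<open>z \<mapsto> \<rho>\<^sup>4z\<close> and
  \<open>z \<mapsto> \<rho>\<^sup>2/z\<close>. Liouville's theorem, applied in the variable \<open>log z\<close>, factorises \<open>F(z) - F(w)\<close> into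
  theta functions. This factorisation gives all that is needed: \<open>F(z) = F(w)\<close> only for the obvious
  pairs, hence \<open>F\<close> maps the annulus bijectively onto the slit plane; and letting \<open>w \<rightarrow> z\<close> gives the
  differential equation of the elliptic sine, which on the circle \<open>|z| = \<rho>\<close> inverts the elliptic
  integral, identifies \<open>F\<close> with \<open>f\<close> and determines \<open>f'(-1)\<close>.

  The map \<open>f'(-1) T\<^sup>-\<^sup>1 \<circ> f \<circ> T\<close> then takes the exterior of the discs onto the exterior of
  two intervals, whose lemniscatic map comes from the Joukowski map: if \<open>\<zeta>\<close> is the exterior
  coordinate of the interval \<open>[C\<^sup>2, D\<^sup>2]\<close> at \<open>z\<^sup>2\<close>, then \<open>\<Phi>\<^sub>1(z)\<^sup>2\<close> is an affine function of \<open>\<zeta>\<close>. All maps are odd,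
  which accounts for the expansion \<open>z + O(1/z)\<close>. The capacity is read off the Green's function
  \<open>log (|U(\<Phi>(z))| / \<mu>)\<close>, whose uniqueness is a maximum principle.
\<close>

section \<open>Infinite products and theta functions\<close>

text \<open>The shape of F is forced by symmetry. A map onto the slit plane is real on both boundary
  circles, and reflecting in them in turn gives z -> rho^4 z, so in log z there are the periods 2 pi
  i and 4 ln rho. On this torus F has the two zeros \<pm>i rho and the two poles \<pm>i/rho; both
  pairs are stable under z -> -z, so the products run over z^2, whence the base rho^8. Being of
  order two, F takes each value at one pair z, rho^2/z only. The pair coincides at \<pm>rho and
  \<pm>1/rho, and the values there, \<pm>L and \<pm>1/L, are the roots in the equation of sn with
  modulus L^2. The equation fixes derivatives only up to sign; the signs come from monotonicity on
  the circle |z| = rho and on the segment [rho, 1]. As \<open>jacobi_sn\<close> is a definite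
  description, uniqueness of the continuation is proved along with existence. C and D arise from the
  slit ends: w -> \<beta> (w - 1)/(w + 1) with \<beta> = f'(-1) \<alpha> takes L, -L, 1/L, -1/L to
  -C, -D, C, D, and with this \<beta> the composite is asymptotic to z at infinity.\<close>

definition qpoch :: "real \<Rightarrow> complex \<Rightarrow> complex" where
  "qpoch p x = (\<Prod>n. 1 - x * of_real p ^ n)"

lemma has_prod_qpoch:
  assumes "0 < p" "p < 1"
  shows "(\<lambda>n. 1 - x * of_real p ^ n) has_prod qpoch p x"
proof -
  have "summable (\<lambda>n. norm x * p ^ n)"
    using assms by (intro summable_mult summable_geometric) auto
  moreover have "norm ((1 - x * of_real p ^ n) - 1) = norm x * p ^ n" for n
    using assms by (simp add: norm_mult norm_power)
  ultimately have "summable (\<lambda>n. norm ((1 - x * of_real p ^ n) - 1))"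
    by presburger
  then have "abs_convergent_prod (\<lambda>n. 1 - x * of_real p ^ n)"
    unfolding abs_convergent_prod_conv_summable .
  then have "convergent_prod (\<lambda>n. 1 - x * of_real p ^ n)"
    by (rule abs_convergent_prod_imp_convergent_prod)
  then show ?thesis
    unfolding qpoch_def by (rule convergent_prod_has_prod)
qed

lemma convergent_qpoch:
  assumes "0 < p" "p < 1"
  shows "convergent_prod (\<lambda>n. 1 - x * complex_of_real p ^ n)"
  using has_prod_qpoch[OF assms] has_prod_iff by blast

lemma qpoch_tendsto:
  assumes "0 < p" "p < 1"
  shows "(\<lambda>N. \<Prod>n<N. 1 - x * of_real p ^ n) \<longlonglongrightarrow> qpoch p x"
proof -
  have "(\<lambda>N. \<Prod>n\<le>N. 1 - x * of_real p ^ n) \<longlonglongrightarrow> qpoch p x"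
    using convergent_prod_LIMSEQ[OF convergent_qpoch[OF assms]] unfolding qpoch_def .
  then show ?thesis
    by (subst (asm) lessThan_Suc_atMost[symmetric]) (rule LIMSEQ_imp_Suc)
qed

lemma qpoch_eq_0_iff:
  assumes "0 < p" "p < 1"
  shows "qpoch p x = 0 \<longleftrightarrow> (\<exists>n. x * of_real p ^ n = 1)"
  unfolding has_prod_eq_0_iff[OF has_prod_qpoch[OF assms]] by (auto simp: image_iff)

lemma qpoch_rec:
  assumes "0 < p" "p < 1"
  shows "qpoch p x = (1 - x) * qpoch p (of_real p * x)"
proof -
  have "(\<lambda>N. \<Prod>n<Suc N. 1 - x * of_real p ^ n) \<longlonglongrightarrow> qpoch p x"
    by (rule LIMSEQ_Suc[OF qpoch_tendsto[OF assms]])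
  moreover have "(\<Prod>n<Suc N. 1 - x * of_real p ^ n) = (1 - x) * (\<Prod>n<N. 1 - (of_real p * x) * of_real p ^ n)" for N
    by (subst prod.lessThan_Suc_shift) (simp add: mult_ac)
  ultimately have "(\<lambda>N. (1 - x) * (\<Prod>n<N. 1 - (of_real p * x) * of_real p ^ n)) \<longlonglongrightarrow> qpoch p x"
    by simp
  moreover have "(\<lambda>N. (1 - x) * (\<Prod>n<N. 1 - (of_real p * x) * of_real p ^ n)) \<longlonglongrightarrow> (1 - x) * qpoch p (of_real p * x)"
    by (intro tendsto_intros qpoch_tendsto assms)
  ultimately show ?thesis
    by (rule LIMSEQ_unique)
qed

text \<open>The partial products converge locally uniformly: on the unit ball around
  \<open>x0\<close> the n-th factor differs from 1 by at most (|x0| + 1) p^n.\<close>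

lemma qpoch_holomorphic:
  assumes "0 < p" "p < 1"
  shows "qpoch p holomorphic_on UNIV"
proof (rule holomorphic_uniform_sequence[of UNIV "\<lambda>N x. \<Prod>n<N. 1 - x * of_real p ^ n"])
  fix x0 :: complex
  have "uniform_limit (cball x0 1) (\<lambda>N x. \<Prod>n<N. 1 - x * of_real p ^ n) (qpoch p) sequentially"
  proof -
    have "uniformly_convergent_on (cball x0 1) (\<lambda>N x. \<Prod>n<N. 1 - x * of_real p ^ n)"
    proof (rule uniformly_convergent_on_prod')
      show "uniformly_convergent_on (cball x0 1) (\<lambda>N x. \<Sum>n<N. norm (1 - x * complex_of_real p ^ n - 1))"
      proof (rule Weierstrass_m_test'_ev)
        show "\<forall>\<^sub>F n in sequentially. \<forall>x\<in>cball x0 1. norm (norm (1 - x * complex_of_real p ^ n - 1)) \<le> (norm x0 + 1) * p ^ n"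
        proof (intro always_eventually allI ballI)
          fix n x assume "x \<in> cball x0 1"
          then have "norm x \<le> norm x0 + 1"
            by (simp add: dist_norm) (smt (verit) norm_minus_commute norm_triangle_sub)
          then show "norm (norm (1 - x * complex_of_real p ^ n - 1)) \<le> (norm x0 + 1) * p ^ n"
            using assms by (simp add: norm_mult norm_power mult_right_mono)
        qed
        show "summable (\<lambda>n. (norm x0 + 1) * p ^ n)"
          using assms by (intro summable_mult summable_geometric) auto
      qed
    qed (auto intro!: continuous_intros)
    then obtain l where l: "uniform_limit (cball x0 1) (\<lambda>N x. \<Prod>n<N. 1 - x * of_real p ^ n) l sequentially"
      by (auto simp: uniformly_convergent_on_def)
    have "l x = qpoch p x" if "x \<in> cball x0 1" for x
      using tendsto_uniform_limitI[OF l that] qpoch_tendsto[OF assms] LIMSEQ_unique by blast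
    then show ?thesis
      using l by (metis (no_types, lifting) uniform_limit_cong')
  qed
  then show "\<exists>d>0. cball x0 d \<subseteq> UNIV \<and> uniform_limit (cball x0 d) (\<lambda>N x. \<Prod>n<N. 1 - x * of_real p ^ n) (qpoch p) sequentially"
    by (intro exI[of _ 1]) auto
qed (auto intro!: holomorphic_intros)

text \<open>Factorwise, (1 - x p^n) (1 + x p^n) = 1 - x^2 p^(2n).\<close>

lemma qpoch_square:
  assumes "0 < p" "p < 1"
  shows "qpoch (p\<^sup>2) (x\<^sup>2) = qpoch p x * qpoch p (- x)"
proof -
  have "qpoch p x * qpoch p (- x) = (\<Prod>n. (1 - x * of_real p ^ n) * (1 - (- x) * of_real p ^ n))"
    unfolding qpoch_def by (rule prodinf_mult[OF convergent_qpoch[OF assms] convergent_qpoch[OF assms]])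
  also have "\<dots> = qpoch (p\<^sup>2) (x\<^sup>2)"
    unfolding qpoch_def by (rule arg_cong[where f = prodinf])
      (auto simp: algebra_simps power2_eq_square power_mult_distrib)
  finally show ?thesis ..
qed

text \<open>Separates the factors of even index from those of odd index; partial products of even
  length make this an exact identity before the limit.\<close>

lemma qpoch_split:
  assumes "0 < p" "p < 1"
  shows "qpoch p x = qpoch (p\<^sup>2) x * qpoch (p\<^sup>2) (of_real p * x)"
proof -
  have p2: "0 < p\<^sup>2" "p\<^sup>2 < 1"
    using assms by (auto simp: power_less_one_iff)
  have "(\<Prod>n<2*N. 1 - x * of_real p ^ n) = (\<Prod>n<N. 1 - x * of_real (p\<^sup>2) ^ n) *
      (\<Prod>n<N. 1 - of_real p * x * of_real (p\<^sup>2) ^ n)" for N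
    by (induction N) (auto simp: algebra_simps power_mult power_mult_distrib power2_eq_square)
  moreover have "(\<lambda>N. \<Prod>n<2*N. 1 - x * of_real p ^ n) \<longlonglongrightarrow> qpoch p x"
    using LIMSEQ_subseq_LIMSEQ[OF qpoch_tendsto[OF assms], of "\<lambda>N. 2 * N"]
    by (auto simp: strict_mono_def o_def)
  ultimately have "(\<lambda>N. (\<Prod>n<N. 1 - x * of_real (p\<^sup>2) ^ n) *
      (\<Prod>n<N. 1 - of_real p * x * of_real (p\<^sup>2) ^ n)) \<longlonglongrightarrow> qpoch p x"
    by simp
  moreover have "(\<lambda>N. (\<Prod>n<N. 1 - x * of_real (p\<^sup>2) ^ n) *
      (\<Prod>n<N. 1 - of_real p * x * of_real (p\<^sup>2) ^ n)) \<longlonglongrightarrow> qpoch (p\<^sup>2) x * qpoch (p\<^sup>2) (of_real p * x)"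
    by (intro tendsto_intros qpoch_tendsto p2)
  ultimately show ?thesis
    by (rule LIMSEQ_unique)
qed

lemma cnj_qpoch:
  assumes "0 < p" "p < 1"
  shows "cnj (qpoch p x) = qpoch p (cnj x)"
proof -
  have "(\<lambda>N. cnj (\<Prod>n<N. 1 - x * of_real p ^ n)) \<longlonglongrightarrow> cnj (qpoch p x)"
    by (intro tendsto_intros qpoch_tendsto assms)
  then show ?thesis
    using qpoch_tendsto[OF assms, of "cnj x"] by (auto dest: LIMSEQ_unique)
qed

text \<open>The theta function of the triple product without its constant factor, in multiplicative
  form; \<open>qpoch\<close> is the q-Pochhammer symbol with infinitely many factors. On the
  punctured plane the zeros are the integral powers of p, all simple.\<close>

definition theta :: "real \<Rightarrow> complex \<Rightarrow> complex" where
  "theta p x = qpoch p x * qpoch p (of_real p / x)"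

context
  fixes p :: real
  assumes p: "0 < p" "p < 1"
begin

lemma theta_base_div: "theta p (of_real p / x) = theta p x" if "x \<noteq> 0"
  using p that by (simp add: theta_def)

text \<open>Peeling the first factor off \<open>qpoch p (1 / x)\<close> and off
  \<open>qpoch p x\<close> leaves the same two products; the removed factors have the ratio (1 -
  1/x) / (1 - x) = - 1/x.\<close>

lemma theta_inverse:
  assumes "x \<noteq> 0"
  shows "theta p (1 / x) = - theta p x / x"
proof -
  have "theta p (1 / x) = qpoch p (1 / x) * qpoch p (of_real p * x)"
    by (simp add: theta_def)
  also have "qpoch p (1 / x) = (1 - 1 / x) * qpoch p (of_real p / x)"
    by (subst qpoch_rec[OF p]) simp
  finally show ?thesis
    using assms unfolding theta_def by (subst (2) qpoch_rec[OF p]) (simp add: field_simps)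
qed

text \<open>Quasi-periodicity, obtained by composing the reflections x -> 1/x and x -> p/x.\<close>

lemma theta_base_mult:
  assumes "x \<noteq> 0"
  shows "theta p (of_real p * x) = - theta p x / x"
  using theta_base_div[of "1 / x"] theta_inverse[OF assms] assms by simp

lemma theta_holomorphic [holomorphic_intros]:
  assumes "g holomorphic_on S" "\<And>z. z \<in> S \<Longrightarrow> g z \<noteq> 0"
  shows "(\<lambda>z. theta p (g z)) holomorphic_on S"
proof -
  have "(qpoch p \<circ> g) holomorphic_on S" "(qpoch p \<circ> (\<lambda>z. of_real p / g z)) holomorphic_on S"
    using assms
    by (auto intro!: holomorphic_on_compose holomorphic_intros holomorphic_on_subset[OF qpoch_holomorphic[OF p]])
  then show ?thesis
    unfolding theta_def o_def by (rule holomorphic_on_mult)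
qed

lemma theta_eq_0_iff:
  assumes "x \<noteq> 0"
  shows "theta p x = 0 \<longleftrightarrow> (\<exists>m::int. x = of_real p powi m)"
proof
  assume "theta p x = 0"
  then consider n where "x * of_real p ^ n = 1" | n where "of_real p / x * of_real p ^ n = 1"
    by (auto simp: theta_def qpoch_eq_0_iff[OF p])
  then show "\<exists>m::int. x = of_real p powi m"
  proof cases
    case 1
    then have "x = of_real p powi (- int n)"
      using p by (simp add: power_int_minus field_simps)
    then show ?thesis ..
  next
    case 2
    then have "x = of_real p powi (int (Suc n))"
      using p assms by (simp add: field_simps del: of_nat_Suc)
    then show ?thesis ..
  qed
next
  assume "\<exists>m::int. x = of_real p powi m"
  then obtain m :: int where m: "x = of_real p powi m" ..
  show "theta p x = 0"
  proof (cases "m \<le> 0")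
    case True
    then have "x * of_real p ^ nat (- m) = 1"
      using m p by (auto simp: power_int_def field_simps)
    then show ?thesis
      by (auto simp: theta_def qpoch_eq_0_iff[OF p])
  next
    case False
    then have "x = of_real p ^ (Suc (nat (m - 1)))"
      using m p by (auto simp: power_int_def Suc_nat_eq_nat_zadd1)
    then have "of_real p / x * of_real p ^ nat (m - 1) = 1"
      using p by (simp add: field_simps)
    then show ?thesis
      by (auto simp: theta_def qpoch_eq_0_iff[OF p])
  qed
qed

text \<open>Together with \<open>theta_square\<close>, this change of base splits theta(rho^2 z^2)
  in base rho^4 into four factors when the differential equation is derived.\<close>

lemma theta_split:
  assumes "x \<noteq> 0"
  shows "theta p x = theta (p\<^sup>2) x * theta (p\<^sup>2) (of_real p * x)"
proof -
  have "qpoch p (of_real p / x) = qpoch (p\<^sup>2) (of_real p / x) * qpoch (p\<^sup>2) (of_real (p\<^sup>2) / x)"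
    by (subst qpoch_split[OF p]) (simp add: power2_eq_square)
  moreover have "of_real (p\<^sup>2) / (of_real p * x) = of_real p / x"
    using p by (simp add: power2_eq_square)
  ultimately show ?thesis
    unfolding theta_def by (subst qpoch_split[OF p]) simp
qed

lemma theta_square: "theta (p\<^sup>2) (x\<^sup>2) = theta p x * theta p (- x)"
  using qpoch_square[OF p, of x] qpoch_square[OF p, of "of_real p / x"]
  by (simp add: theta_def power_divide)

lemma cnj_theta: "cnj (theta p x) = theta p (cnj x)"
  by (simp add: theta_def cnj_qpoch[OF p])

lemma theta_field_differentiable:
  "x \<noteq> 0 \<Longrightarrow> theta p field_differentiable (at x)"
  by (rule holomorphic_on_imp_differentiable_at[of _ "- {0}"])
    (use theta_holomorphic[of "\<lambda>z. z" "- {0}"] in auto)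

lemma theta_factor: "theta p x = (1 - x) * (qpoch p (of_real p * x) * qpoch p (of_real p / x))"
  unfolding theta_def by (subst qpoch_rec[OF p]) simp

text \<open>Apart from the explicit factor 1 - x the product does not vanish at 1, so the zero there
  is simple.\<close>

lemma deriv_theta_1: "deriv (theta p) 1 \<noteq> 0"
proof -
  define G where "G = (\<lambda>x. qpoch p (of_real p * x) * qpoch p (of_real p / x))"
  have "(qpoch p \<circ> (\<lambda>x. of_real p * x)) holomorphic_on - {0}" "(qpoch p \<circ> (\<lambda>x. of_real p / x)) holomorphic_on - {0}"
    by (auto intro!: holomorphic_on_compose holomorphic_intros holomorphic_on_subset[OF qpoch_holomorphic[OF p]])
  then have "G holomorphic_on - {0}"
    unfolding G_def o_def by (intro holomorphic_intros)
  then have "(G has_field_derivative deriv G 1) (at 1)"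
    by (intro holomorphic_derivI[of _ "- {0}"]) auto
  then have "((\<lambda>x. (1 - x) * G x) has_field_derivative - G 1) (at 1)"
    by (auto intro!: derivative_eq_intros)
  moreover have "theta p = (\<lambda>x. (1 - x) * G x)"
    by (rule ext) (simp add: theta_factor G_def)
  ultimately have "deriv (theta p) 1 = - G 1"
    by (simp add: DERIV_imp_deriv)
  moreover have "G 1 \<noteq> 0"
  proof -
    have "p * p ^ n < 1" for n
      using p power_Suc_less_one[of p n] by simp
    then have "complex_of_real (p * p ^ n) \<noteq> 1" for n
      by (metis less_irrefl of_real_eq_1_iff)
    then have "qpoch p (of_real p) \<noteq> 0"
      by (auto simp: qpoch_eq_0_iff[OF p])
    then show ?thesis by (simp add: G_def)
  qed
  ultimately show ?thesis by simp
qed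

text \<open>Differentiating the quasi-periodicity at a zero kills the term with the value of
  \<open>theta\<close>; thus simplicity passes between the zeros x and p x.\<close>

lemma deriv_theta_base_mult:
  assumes "x \<noteq> 0" "theta p x = 0"
  shows "of_real p * deriv (theta p) (of_real p * x) = - deriv (theta p) x / x"
proof -
  have nz: "of_real p * x \<noteq> 0"
    using p assms by auto
  have "((\<lambda>x. theta p (of_real p * x)) has_field_derivative deriv (theta p) (of_real p * x) * of_real p) (at x)"
    by (rule DERIV_chain2[where f = "theta p"])
      (use theta_field_differentiable[OF nz] DERIV_deriv_iff_field_differentiable in \<open>auto intro!: derivative_eq_intros\<close>)
  moreover have "((\<lambda>x. theta p (of_real p * x)) has_field_derivative - deriv (theta p) x / x) (at x)"
  proof (rule has_field_derivative_transform_within_open[of "\<lambda>x. - theta p x / x" _ _ "- {0}"])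
    have "(theta p has_field_derivative deriv (theta p) x) (at x)"
      using theta_field_differentiable[OF assms(1)] DERIV_deriv_iff_field_differentiable by blast
    then show "((\<lambda>x. - theta p x / x) has_field_derivative - deriv (theta p) x / x) (at x)"
      using assms by (auto intro!: derivative_eq_intros simp: field_simps)
  qed (use assms theta_base_mult in auto)
  ultimately show ?thesis
    by (metis DERIV_unique mult.commute)
qed

lemma deriv_theta_nonzero:
  assumes "x \<noteq> 0" "theta p x = 0"
  shows "deriv (theta p) x \<noteq> 0"
proof -
  have p0: "complex_of_real p \<noteq> 0"
    using p by simp
  have z: "theta p (of_real p powi m) = 0" for m
    using p0 by (subst theta_eq_0_iff) auto
  have step: "deriv (theta p) (of_real p powi (m + 1)) \<noteq> 0 \<longleftrightarrow> deriv (theta p) (of_real p powi m) \<noteq> 0" for m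
    using deriv_theta_base_mult[of "of_real p powi m"] z[of m] p0
    by (auto simp: power_int_add mult.commute)
  have "deriv (theta p) (of_real p powi m) \<noteq> 0" for m
  proof (induction m rule: int_induct[of _ 0])
    case base
    then show ?case using deriv_theta_1 by simp
  next
    case (step1 i)
    then show ?case using step by simp
  next
    case (step2 i)
    then show ?case using step[of "i - 1"] by simp
  qed
  then show ?thesis
    using theta_eq_0_iff assms by blast
qed

end

section \<open>The conformal map of an annulus onto a slit plane\<close>

lemma simple_zero_eventually_nonzero:
  fixes d :: "complex \<Rightarrow> complex"
  assumes "d field_differentiable (at t)" "d t = 0 \<Longrightarrow> deriv d t \<noteq> 0"
  shows "eventually (\<lambda>s. d s \<noteq> 0) (at t)"
proof (cases "d t = 0")
  case True
  have "((\<lambda>s. (d s - d t) / (s - t)) \<longlongrightarrow> deriv d t) (at t)"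
    using assms(1) DERIV_deriv_iff_field_differentiable has_field_derivative_iff by blast
  from tendsto_imp_eventually_ne[OF this assms(2)[OF True]] show ?thesis
    by eventually_elim (use True in auto)
next
  case False
  have "isCont d t"
    using assms(1) field_differentiable_imp_continuous_at by blast
  then show ?thesis
    using False tendsto_imp_eventually_ne isContD by blast
qed

text \<open>Every value is already taken on a closed period rectangle, which is compact, so the
  function is bounded.\<close>

lemma doubly_periodic_entire_constant:
  fixes g :: "complex \<Rightarrow> complex" and \<tau> :: real
  assumes "g holomorphic_on UNIV" "\<tau> > 0"
    and p1: "\<And>t. g (t + 2 * of_real pi * \<i>) = g t" and p2: "\<And>t. g (t + of_real \<tau>) = g t"
  shows "g constant_on UNIV"
proof (rule Liouville_theorem[OF assms(1)])
  have i1: "g (t + of_int m * (2 * of_real pi * \<i>)) = g t" for t m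
  proof (induction m arbitrary: t rule: int_induct[of _ 0])
    case (step1 i)
    have "g (t + of_int (i + 1) * (2 * of_real pi * \<i>)) = g ((t + of_int i * (2 * of_real pi * \<i>)) + 2 * of_real pi * \<i>)"
      by (simp add: algebra_simps)
    then show ?case using p1 step1 by metis
  next
    case (step2 i)
    have "g (t + of_int i * (2 * of_real pi * \<i>)) = g ((t + of_int (i - 1) * (2 * of_real pi * \<i>)) + 2 * of_real pi * \<i>)"
      by (simp add: algebra_simps)
    then show ?case using p1 step2 by metis
  qed auto
  have i2: "g (t + of_int m * of_real \<tau>) = g t" for t m
  proof (induction m arbitrary: t rule: int_induct[of _ 0])
    case (step1 i)
    have "g (t + of_int (i + 1) * of_real \<tau>) = g ((t + of_int i * of_real \<tau>) + of_real \<tau>)"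
      by (simp add: algebra_simps)
    then show ?case using p2 step1 by metis
  next
    case (step2 i)
    have "g (t + of_int i * of_real \<tau>) = g ((t + of_int (i - 1) * of_real \<tau>) + of_real \<tau>)"
      by (simp add: algebra_simps)
    then show ?case using p2 step2 by metis
  qed auto
  have "compact (g ` cbox 0 (Complex \<tau> (2 * pi)))"
    using assms(1) by (intro compact_continuous_image compact_cbox) (auto intro: holomorphic_on_imp_continuous_on holomorphic_on_subset)
  then have "bounded (g ` cbox 0 (Complex \<tau> (2 * pi)))"
    by (rule compact_imp_bounded)
  moreover have "range g \<subseteq> g ` cbox 0 (Complex \<tau> (2 * pi))"
  proof
    fix y assume "y \<in> range g"
    then obtain t where t: "y = g t" by auto
    define m n where "m = \<lfloor>Re t / \<tau>\<rfloor>" and "n = \<lfloor>Im t / (2 * pi)\<rfloor>"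
    define t' where "t' = t + of_int (- m) * of_real \<tau> + of_int (- n) * (2 * of_real pi * \<i>)"
    have "g t' = g t"
      unfolding t'_def i1 i2 ..
    moreover have "0 \<le> Re t - m * \<tau>" "Re t - m * \<tau> \<le> \<tau>"
      using floor_divide_lower[OF \<open>\<tau> > 0\<close>, of "Re t"] floor_divide_upper[OF \<open>\<tau> > 0\<close>, of "Re t"]
      by (auto simp: m_def algebra_simps)
    moreover have "0 \<le> Im t - n * (2 * pi)" "Im t - n * (2 * pi) \<le> 2 * pi"
      using floor_divide_lower[of "2 * pi" "Im t"] floor_divide_upper[of "2 * pi" "Im t"]
      by (auto simp: n_def algebra_simps)
    ultimately have "t' \<in> cbox 0 (Complex \<tau> (2 * pi))"
      by (auto simp: t'_def in_cbox_complex_iff)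
    then show "y \<in> g ` cbox 0 (Complex \<tau> (2 * pi))"
      using t \<open>g t' = g t\<close> by (metis image_eqI)
  qed
  ultimately show "bounded (range g)"
    by (rule bounded_subset)
qed

text \<open>As the zeros of d are simple, the quotient extends continuously over them by the ratio
  of the derivatives, and isolated singularities of a continuous function are removable.\<close>

lemma entire_quotient:
  fixes n d :: "complex \<Rightarrow> complex"
  assumes n: "n holomorphic_on UNIV" and d: "d holomorphic_on UNIV"
    and z: "\<And>t. d t = 0 \<Longrightarrow> n t = 0" "\<And>t. d t = 0 \<Longrightarrow> deriv d t \<noteq> 0"
  obtains g where "g holomorphic_on UNIV" "\<And>t. n t = g t * d t"
proof -
  define g where "g = (\<lambda>t. if d t = 0 then deriv n t / deriv d t else n t / d t)"
  have dn: "n field_differentiable (at t)" "d field_differentiable (at t)" for t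
    using n d by (auto simp: holomorphic_on_def)
  have ev: "eventually (\<lambda>s. d s \<noteq> 0) (at t)" for t
    by (rule simple_zero_eventually_nonzero[OF dn(2) z(2)])
  have cont: "isCont g t" for t
  proof (cases "d t = 0")
    case True
    have "((\<lambda>s. ((n s - n t) / (s - t)) / ((d s - d t) / (s - t))) \<longlongrightarrow> deriv n t / deriv d t) (at t)"
      by (intro tendsto_divide) (use dn DERIV_deriv_iff_field_differentiable has_field_derivative_iff z True in blast)+
    then have "(g \<longlongrightarrow> deriv n t / deriv d t) (at t)"
      by (rule Lim_transform_eventually)
        (use ev[of t] in \<open>eventually_elim, auto simp: g_def True z divide_simps\<close>)
    then show ?thesis
      by (simp add: isCont_def g_def True)
  next
    case False
    have "isCont (\<lambda>s. n s / d s) t"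
      using False dn by (intro continuous_intros field_differentiable_imp_continuous_at) auto
    moreover have "eventually (\<lambda>s. n s / d s = g s) (nhds t)"
      using ev[of t] False
      by (auto simp: eventually_at_filter g_def elim!: eventually_mono)
    ultimately show ?thesis
      using isCont_cong[of "\<lambda>s. n s / d s" g t] by simp
  qed
  have "g field_differentiable (at t)" for t
  proof -
    obtain e where e: "e > 0" "\<And>s. s \<in> ball t e - {t} \<Longrightarrow> d s \<noteq> 0"
      using ev[of t] by (auto simp: eventually_at dist_commute)
    have "g holomorphic_on ball t e"
    proof (rule no_isolated_singularity)
      show "continuous_on (ball t e) g"
        using cont by (simp add: continuous_at_imp_continuous_on)
      have "(\<lambda>s. n s / d s) holomorphic_on ball t e - {t}"
        using e by (intro holomorphic_intros) (auto intro: holomorphic_on_subset n d)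
      then show "g holomorphic_on ball t e - {t}"
        by (rule holomorphic_transform) (use e in \<open>auto simp: g_def\<close>)
    qed auto
    then show ?thesis
      using e by (auto intro: holomorphic_on_imp_differentiable_at)
  qed
  then have "g holomorphic_on UNIV"
    by (simp add: holomorphic_on_def field_differentiable_at_within)
  moreover have "n t = g t * d t" for t
    by (auto simp: g_def z)
  ultimately show ?thesis ..
qed

text \<open>The automorphy factor is not named: the cross-multiplied hypotheses only say that n and
  d acquire the same one. Then n / d is periodic away from the zeros of d, hence everywhere by
  continuity, hence constant.\<close>

lemma doubly_quasiperiodic_proportional:
  fixes n d :: "complex \<Rightarrow> complex" and \<tau> :: real
  assumes n: "n holomorphic_on UNIV" and d: "d holomorphic_on UNIV" and "\<tau> > 0"
    and z: "\<And>t. d t = 0 \<Longrightarrow> n t = 0" "\<And>t. d t = 0 \<Longrightarrow> deriv d t \<noteq> 0"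
    and p1: "\<And>t. n (t + 2 * of_real pi * \<i>) * d t = n t * d (t + 2 * of_real pi * \<i>)"
    and p2: "\<And>t. n (t + of_real \<tau>) * d t = n t * d (t + of_real \<tau>)"
  obtains \<kappa> where "\<And>t. n t = \<kappa> * d t"
proof -
  obtain g where g: "g holomorphic_on UNIV" "\<And>t. n t = g t * d t"
    using entire_quotient[OF n d z] by metis
  have cont: "isCont g t" for t
    using g(1) holomorphic_on_imp_continuous_on continuous_on_eq_continuous_at open_UNIV by blast
  have per: "g (t + \<omega>) = g t" if "\<And>t. n (t + \<omega>) * d t = n t * d (t + \<omega>)" for t \<omega>
  proof -
    have ev: "eventually (\<lambda>s. d s \<noteq> 0) (at t)" for t
      by (rule simple_zero_eventually_nonzero[OF _ z(2)])
        (use d in \<open>auto simp: holomorphic_on_def\<close>)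
    have "eventually (\<lambda>s. d (s + \<omega>) \<noteq> 0) (at t)"
      using ev[of "t + \<omega>"] unfolding eventually_at dist_norm
      by (metis UNIV_I add_diff_cancel_right add_right_cancel)
    with ev[of t] have "eventually (\<lambda>s. g (s + \<omega>) - g s = 0) (at t)"
    proof eventually_elim
      case (elim s)
      have "g (s + \<omega>) * d (s + \<omega>) * d s = g s * d s * d (s + \<omega>)"
        using that[of s] unfolding g(2) .
      then show ?case
        using elim by simp
    qed
    then have "((\<lambda>s. g (s + \<omega>) - g s) \<longlongrightarrow> 0) (at t)"
      by (rule tendsto_eventually)
    moreover have "isCont (\<lambda>s. g (s + \<omega>) - g s) t"
      by (intro isCont_diff isCont_o2[of _ "\<lambda>s. s + \<omega>" g] cont isCont_add continuous_ident continuous_const)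
    then have "((\<lambda>s. g (s + \<omega>) - g s) \<longlongrightarrow> g (t + \<omega>) - g t) (at t)"
      by (rule isContD)
    ultimately have "0 = g (t + \<omega>) - g t"
      by (rule LIM_unique)
    then show ?thesis by simp
  qed
  have "g constant_on UNIV"
    by (rule doubly_periodic_entire_constant[OF g(1) \<open>\<tau> > 0\<close>]) (rule per, fact)+
  then show ?thesis
    using that g(2) by (auto simp: constant_on_def)
qed

section \<open>The theta quotient and its symmetries\<close>

definition slit_num :: "real \<Rightarrow> complex \<Rightarrow> complex" where
  "slit_num \<rho> z = z * theta (\<rho> ^ 8) (- (of_real \<rho>)\<^sup>2 / z\<^sup>2)"

definition slit_den :: "real \<Rightarrow> complex \<Rightarrow> complex" where
  "slit_den \<rho> z = theta (\<rho> ^ 8) (- (of_real \<rho>)\<^sup>2 * z\<^sup>2)"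

text \<open>At the zeros of the denominator the convention \<open>x / 0 = 0\<close> gives the value that a nicely
  meromorphic function has at a pole.\<close>

definition slit_map :: "real \<Rightarrow> complex \<Rightarrow> complex" where
  "slit_map \<rho> z = slit_num \<rho> z / slit_den \<rho> z"

locale slit_annulus =
  fixes \<rho> :: real
  assumes rho: "0 < \<rho>" "\<rho> < 1"
begin

lemma rho4: "0 < \<rho> ^ 4" "\<rho> ^ 4 < 1" and rho8: "0 < \<rho> ^ 8" "\<rho> ^ 8 < 1"
  using rho by (auto simp: power_less_one_iff)

lemma rho_nz [simp]: "complex_of_real \<rho> \<noteq> 0" "\<rho> \<noteq> 0"
  using rho by auto

abbreviation "A \<equiv> slit_num \<rho>"
abbreviation "B \<equiv> slit_den \<rho>"
abbreviation "F \<equiv> slit_map \<rho>"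
abbreviation "r\<^sub>c \<equiv> complex_of_real \<rho>"

lemma slit_num_inverse: "z \<noteq> 0 \<Longrightarrow> A (1 / z) = B z / z"
  by (simp add: slit_num_def slit_den_def power_divide)

lemma slit_den_inverse: "z \<noteq> 0 \<Longrightarrow> B (1 / z) = A z / z"
  by (simp add: slit_num_def slit_den_def power_divide)

lemma slit_map_inverse: "z \<noteq> 0 \<Longrightarrow> F (1 / z) = 1 / F z"
  by (simp add: slit_map_def slit_num_inverse slit_den_inverse)

lemma slit_num_minus: "A (- z) = - A z" and slit_den_minus: "B (- z) = B z"
  by (simp_all add: slit_num_def slit_den_def)

lemma slit_map_minus: "F (- z) = - F z"
  by (simp add: slit_map_def slit_num_minus slit_den_minus)

text \<open>Replacing z by rho^4 z multiplies z^2 by the base rho^8. Denominator and numerator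
  acquire the same factor, which cancels in \<open>slit_map\<close>.\<close>

lemma slit_den_mult:
  assumes "z \<noteq> 0"
  shows "B (r\<^sub>c ^ 4 * z) = B z / (r\<^sub>c\<^sup>2 * z\<^sup>2)"
proof -
  have "B (r\<^sub>c ^ 4 * z) = theta (\<rho> ^ 8) (of_real (\<rho> ^ 8) * (- r\<^sub>c\<^sup>2 * z\<^sup>2))"
    by (simp add: slit_den_def power_mult_distrib mult_ac flip: power_add power_mult)
  also have "\<dots> = B z / (r\<^sub>c\<^sup>2 * z\<^sup>2)"
    using assms by (subst theta_base_mult[OF rho8]) (auto simp: slit_den_def)
  finally show ?thesis .
qed

lemma slit_num_mult:
  assumes "z \<noteq> 0"
  shows "A (r\<^sub>c ^ 4 * z) = A z / (r\<^sub>c\<^sup>2 * z\<^sup>2)"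
proof -
  define y where "y = - r\<^sub>c\<^sup>2 / (r\<^sub>c ^ 4 * z)\<^sup>2"
  have y: "y \<noteq> 0" "of_real (\<rho> ^ 8) * y = - r\<^sub>c\<^sup>2 / z\<^sup>2"
    using assms by (auto simp: y_def power_mult_distrib divide_simps simp flip: power_add power_mult)
  have "theta (\<rho> ^ 8) y = - y * theta (\<rho> ^ 8) (- r\<^sub>c\<^sup>2 / z\<^sup>2)"
    using theta_base_mult[OF rho8 y(1)] y by (simp add: field_simps)
  moreover have "- y = 1 / (r\<^sub>c ^ 6 * z\<^sup>2)"
    using assms by (simp add: y_def field_simps power_mult_distrib flip: power_add power_mult)
  ultimately show ?thesis
    using assms unfolding slit_num_def y_def[symmetric]
    by (simp add: field_simps flip: power_add)
qed

lemma slit_num_reflect: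
  assumes "z \<noteq> 0"
  shows "A (r\<^sub>c\<^sup>2 / z) = A z"
proof -
  have "theta (\<rho> ^ 8) (1 / (- r\<^sub>c\<^sup>2 / z\<^sup>2)) = - theta (\<rho> ^ 8) (- r\<^sub>c\<^sup>2 / z\<^sup>2) / (- r\<^sub>c\<^sup>2 / z\<^sup>2)"
    using assms by (intro theta_inverse[OF rho8]) auto
  moreover have "- r\<^sub>c\<^sup>2 / (r\<^sub>c\<^sup>2 / z)\<^sup>2 = 1 / (- r\<^sub>c\<^sup>2 / z\<^sup>2)"
    using assms by (simp add: field_simps power2_eq_square)
  ultimately show ?thesis
    using assms unfolding slit_num_def by (simp add: field_simps power2_eq_square)
qed

lemma slit_den_reflect:
  assumes "z \<noteq> 0"
  shows "B (r\<^sub>c\<^sup>2 / z) = B z"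
proof -
  have "theta (\<rho> ^ 8) (of_real (\<rho> ^ 8) / (- r\<^sub>c\<^sup>2 * z\<^sup>2)) = theta (\<rho> ^ 8) (- r\<^sub>c\<^sup>2 * z\<^sup>2)"
    using assms by (intro theta_base_div[OF rho8]) auto
  moreover have "- r\<^sub>c\<^sup>2 * (r\<^sub>c\<^sup>2 / z)\<^sup>2 = of_real (\<rho> ^ 8) / (- r\<^sub>c\<^sup>2 * z\<^sup>2)"
    using assms by (simp add: power_divide divide_simps flip: power_add power_mult)
  ultimately show ?thesis
    unfolding slit_den_def by simp
qed

lemma slit_map_mult: "z \<noteq> 0 \<Longrightarrow> F (r\<^sub>c ^ 4 * z) = F z"
  by (simp add: slit_map_def slit_num_mult slit_den_mult)

lemma slit_map_reflect: "z \<noteq> 0 \<Longrightarrow> F (r\<^sub>c\<^sup>2 / z) = F z"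
  by (simp add: slit_map_def slit_num_reflect slit_den_reflect)

lemma slit_num_holomorphic: "A holomorphic_on - {0}"
  unfolding slit_num_def by (intro holomorphic_intros theta_holomorphic[OF rho8]) auto

lemma slit_den_holomorphic: "B holomorphic_on - {0}"
  unfolding slit_den_def by (intro holomorphic_intros theta_holomorphic[OF rho8]) auto

lemma slit_num_eq_0_iff:
  "z \<noteq> 0 \<Longrightarrow> A z = 0 \<longleftrightarrow> (\<exists>m::int. z\<^sup>2 = - (r\<^sub>c powi (8 * m + 2)))"
proof -
  assume z: "z \<noteq> 0"
  have "A z = 0 \<longleftrightarrow> (\<exists>m::int. - r\<^sub>c\<^sup>2 / z\<^sup>2 = of_real (\<rho> ^ 8) powi m)"
    using z by (simp add: slit_num_def theta_eq_0_iff[OF rho8])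
  also have "\<dots> \<longleftrightarrow> (\<exists>m::int. - r\<^sub>c\<^sup>2 / z\<^sup>2 = of_real (\<rho> ^ 8) powi (- m))"
    by (metis minus_minus)
  also have "\<dots> \<longleftrightarrow> (\<exists>m::int. z\<^sup>2 = - (r\<^sub>c powi (8 * m + 2)))"
  proof (rule ex_cong1)
    fix m :: int
    have "of_real (\<rho> ^ 8) powi (- m) = inverse (r\<^sub>c powi (8 * m))"
      by (simp add: power_int_mult power_int_minus)
    then have "- r\<^sub>c\<^sup>2 / z\<^sup>2 = of_real (\<rho> ^ 8) powi (- m) \<longleftrightarrow> - r\<^sub>c\<^sup>2 * r\<^sub>c powi (8 * m) = z\<^sup>2"
      using z by (simp only:) (simp add: field_simps)
    then show "- r\<^sub>c\<^sup>2 / z\<^sup>2 = of_real (\<rho> ^ 8) powi (- m) \<longleftrightarrow> z\<^sup>2 = - (r\<^sub>c powi (8 * m + 2))"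
      by (auto simp: power_int_add mult_ac)
  qed
  finally show ?thesis .
qed

lemma slit_den_eq_0_iff:
  "z \<noteq> 0 \<Longrightarrow> B z = 0 \<longleftrightarrow> (\<exists>m::int. z\<^sup>2 = - (r\<^sub>c powi (8 * m - 2)))"
proof -
  assume z: "z \<noteq> 0"
  have "B z = 0 \<longleftrightarrow> (\<exists>m::int. - r\<^sub>c\<^sup>2 * z\<^sup>2 = of_real (\<rho> ^ 8) powi m)"
    using z by (simp add: slit_den_def theta_eq_0_iff[OF rho8])
  also have "\<dots> \<longleftrightarrow> (\<exists>m::int. z\<^sup>2 = - (r\<^sub>c powi (8 * m - 2)))"
  proof (rule ex_cong1)
    fix m :: int
    have "of_real (\<rho> ^ 8) powi m = r\<^sub>c powi (8 * m)"
      by (simp add: power_int_mult)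
    moreover have "r\<^sub>c powi (8 * m) = r\<^sub>c\<^sup>2 * r\<^sub>c powi (8 * m - 2)"
      by (simp add: power_int_diff)
    ultimately have "- r\<^sub>c\<^sup>2 * z\<^sup>2 = of_real (\<rho> ^ 8) powi m \<longleftrightarrow> r\<^sub>c\<^sup>2 * (- z\<^sup>2) = r\<^sub>c\<^sup>2 * r\<^sub>c powi (8 * m - 2)"
      by (simp only:) simp
    also have "\<dots> \<longleftrightarrow> - z\<^sup>2 = r\<^sub>c powi (8 * m - 2)"
      by (subst mult_cancel_left) simp
    also have "\<dots> \<longleftrightarrow> z\<^sup>2 = - (r\<^sub>c powi (8 * m - 2))"
      by (metis minus_minus)
    finally show "- r\<^sub>c\<^sup>2 * z\<^sup>2 = of_real (\<rho> ^ 8) powi m \<longleftrightarrow> z\<^sup>2 = - (r\<^sub>c powi (8 * m - 2))" .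
  qed
  finally show ?thesis .
qed

lemma powi_rho_inject: "r\<^sub>c powi m = r\<^sub>c powi n \<longleftrightarrow> m = n"
proof -
  have "r\<^sub>c powi m = r\<^sub>c powi n \<longleftrightarrow> \<rho> powi m = \<rho> powi n"
    by (metis of_real_power_int of_real_eq_iff)
  also have "\<dots> \<longleftrightarrow> m = n"
    using rho by (smt (verit) power_int_strict_decreasing)
  finally show ?thesis .
qed

text \<open>The exponents of rho in the squares of the zeros are 2 modulo 8 for the numerator and 6
  modulo 8 for the denominator.\<close>

lemma slit_den_nonzero: "z \<noteq> 0 \<Longrightarrow> A z = 0 \<Longrightarrow> B z \<noteq> 0"
proof
  assume z: "z \<noteq> 0" and a: "A z = 0" and b: "B z = 0"
  then obtain m n :: int where "r\<^sub>c powi (8 * m + 2) = r\<^sub>c powi (8 * n - 2)"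
    using slit_num_eq_0_iff slit_den_eq_0_iff by auto (metis neg_equal_iff_equal)
  then have "8 * m + 2 = 8 * n - 2"
    by (simp add: powi_rho_inject)
  then show False by presburger
qed

lemma slit_num_irho: "A (\<i> * r\<^sub>c) = 0"
  by (subst slit_num_eq_0_iff) (auto simp: power_mult_distrib intro!: exI[of _ 0])

text \<open>Locates the poles: the pole circles nearest to the annulus are |z| = 1/rho, its outer
  boundary, and |z| = rho^3.\<close>

lemma slit_den_eq_0_norm:
  assumes "z \<noteq> 0" "B z = 0"
  shows "\<exists>m::int. norm z = \<rho> powi (4 * m - 1)"
proof -
  obtain m :: int where "z\<^sup>2 = - (r\<^sub>c powi (8 * m - 2))"
    using slit_den_eq_0_iff assms by auto
  then have "(norm z)\<^sup>2 = \<rho> powi (8 * m - 2)"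
    using rho by (metis norm_minus_cancel norm_power norm_power_int norm_of_real abs_of_pos)
  also have "\<dots> = (\<rho> powi (4 * m - 1))\<^sup>2"
    using power_int_mult[of \<rho> "4 * m - 1" 2] by (simp add: mult.commute right_diff_distrib)
  finally have eq: "(norm z)\<^sup>2 = (\<rho> powi (4 * m - 1))\<^sup>2" .
  have "norm z = \<rho> powi (4 * m - 1)"
    by (rule power2_eq_imp_eq[OF eq norm_ge_zero zero_le_power_int]) (use rho in simp)
  then show ?thesis ..
qed

lemma cnj_slit_map: "cnj (F z) = F (cnj z)"
  by (simp add: slit_map_def slit_num_def slit_den_def cnj_theta[OF rho8])

section \<open>Factorisation of differences of values\<close>

definition cross_num :: "complex \<Rightarrow> complex \<Rightarrow> complex" where
  "cross_num z w = A z * B w - A w * B z"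

text \<open>A theta product with the expected zeros: w = rho^(4m) z and z w = rho^(4m-2), the pairs
  on which the symmetries force F z = F w. The prefactor z matches its automorphy factor to that of
  \<open>cross_num\<close>.\<close>

definition cross_theta :: "complex \<Rightarrow> complex \<Rightarrow> complex" where
  "cross_theta z w = z * theta (\<rho> ^ 4) (w / z) * theta (\<rho> ^ 4) (r\<^sub>c\<^sup>2 * z * w)"

lemma cross_num_swap: "cross_num w z = - cross_num z w"
  by (simp add: cross_num_def)

lemma cross_theta_swap:
  assumes "z \<noteq> 0" "w \<noteq> 0"
  shows "cross_theta w z = - cross_theta z w"
  using theta_inverse[OF rho4, of "w / z"] assms by (simp add: cross_theta_def field_simps)

lemma cross_num_mult:
  assumes "z \<noteq> 0"
  shows "cross_num (r\<^sub>c ^ 4 * z) w = cross_num z w / (r\<^sub>c\<^sup>2 * z\<^sup>2)"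
  unfolding cross_num_def slit_num_mult[OF assms] slit_den_mult[OF assms] using assms by (simp add: field_simps)

lemma cross_theta_mult:
  assumes "z \<noteq> 0" "w \<noteq> 0"
  shows "cross_theta (r\<^sub>c ^ 4 * z) w = cross_theta z w / (r\<^sub>c\<^sup>2 * z\<^sup>2)"
proof -
  define y where "y = w / (r\<^sub>c ^ 4 * z)"
  have y: "y \<noteq> 0" "of_real (\<rho> ^ 4) * y = w / z"
    using assms by (auto simp: y_def)
  have 1: "theta (\<rho> ^ 4) y = - y * theta (\<rho> ^ 4) (w / z)"
    using theta_base_mult[OF rho4 y(1)] y by (simp add: field_simps)
  have 2: "theta (\<rho> ^ 4) (r\<^sub>c\<^sup>2 * (r\<^sub>c ^ 4 * z) * w) = - theta (\<rho> ^ 4) (r\<^sub>c\<^sup>2 * z * w) / (r\<^sub>c\<^sup>2 * z * w)"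
    using theta_base_mult[OF rho4, of "r\<^sub>c\<^sup>2 * z * w"] assms by (simp add: mult_ac)
  show ?thesis
    unfolding cross_theta_def y_def[symmetric] 1 2 using assms by (simp add: y_def field_simps power2_eq_square)
qed

lemma cross_num_zero_powi:
  assumes "z \<noteq> 0" "cross_num z w = 0"
  shows "cross_num (of_real (\<rho> ^ 4) powi m * z) w = 0"
proof (induction m rule: int_induct[of _ 0])
  case base
  then show ?case using assms by simp
next
  case (step1 i)
  have "of_real (\<rho> ^ 4) powi (i + 1) * z = r\<^sub>c ^ 4 * (of_real (\<rho> ^ 4) powi i * z)"
    by (simp add: power_int_add)
  then show ?case
    using cross_num_mult[of "of_real (\<rho> ^ 4) powi i * z" w] assms step1 by (simp only:) simp
next
  case (step2 i)
  have "of_real (\<rho> ^ 4) powi i * z = r\<^sub>c ^ 4 * (of_real (\<rho> ^ 4) powi (i - 1) * z)"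
    by (simp add: power_int_diff)
  then show ?case
    using cross_num_mult[of "of_real (\<rho> ^ 4) powi (i - 1) * z" w] assms step2
    by (simp only:) simp
qed

text \<open>Up to powers of rho^4 the zeros in z are w and rho^2/w, where \<open>cross_num\<close>
  vanishes trivially.\<close>

lemma cross_num_eq_0_of_cross_theta:
  assumes "z \<noteq> 0" "w \<noteq> 0" "cross_theta z w = 0"
  shows "cross_num z w = 0"
proof -
  from assms consider (1) "theta (\<rho> ^ 4) (w / z) = 0" | (2) "theta (\<rho> ^ 4) (r\<^sub>c\<^sup>2 * z * w) = 0"
    by (auto simp: cross_theta_def)
  then show ?thesis
  proof cases
    case 1
    then obtain m :: int where "w / z = of_real (\<rho> ^ 4) powi m"
      using theta_eq_0_iff[OF rho4] assms by auto
    then have "z = of_real (\<rho> ^ 4) powi (- m) * w"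
      using assms by (simp add: power_int_minus field_simps)
    moreover have "cross_num w w = 0"
      by (simp add: cross_num_def)
    ultimately show ?thesis
      using cross_num_zero_powi assms by metis
  next
    case 2
    then obtain m :: int where m: "r\<^sub>c\<^sup>2 * z * w = of_real (\<rho> ^ 4) powi m"
      using theta_eq_0_iff[OF rho4, of "r\<^sub>c\<^sup>2 * z * w"] assms by auto
    have "of_real (\<rho> ^ 4) powi (m - 1) * (r\<^sub>c\<^sup>2 / w) = r\<^sub>c\<^sup>2 * z * w / (r\<^sub>c ^ 4 * w) * r\<^sub>c\<^sup>2"
      unfolding m by (simp add: power_int_diff)
    also have "\<dots> = z"
      using assms by (simp add: field_simps flip: power_add)
    finally have "z = of_real (\<rho> ^ 4) powi (m - 1) * (r\<^sub>c\<^sup>2 / w)" ..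
    moreover have "cross_num (r\<^sub>c\<^sup>2 / w) w = 0"
      using assms by (simp add: cross_num_def slit_num_reflect slit_den_reflect)
    ultimately show ?thesis
      using cross_num_zero_powi assms by (metis divide_eq_0_iff power_not_zero rho_nz(1))
  qed
qed

text \<open>The substitution z = exp t turns multiplication by rho^4 into a translation, beside the
  period 2 pi i of exp. The positive period - ln (rho^4) is used, so the shift divides z by
  rho^4.\<close>

lemma quasiperiodic_proportional:
  assumes n: "n holomorphic_on - {0}" and d: "d holomorphic_on - {0}"
    and n_mult: "\<And>z. z \<noteq> 0 \<Longrightarrow> n (r\<^sub>c ^ 4 * z) = n z / (r\<^sub>c\<^sup>2 * z\<^sup>2)"
    and d_mult: "\<And>z. z \<noteq> 0 \<Longrightarrow> d (r\<^sub>c ^ 4 * z) = d z / (r\<^sub>c\<^sup>2 * z\<^sup>2)"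
    and zeros: "\<And>z. z \<noteq> 0 \<Longrightarrow> d z = 0 \<Longrightarrow> n z = 0 \<and> deriv d z \<noteq> 0"
  obtains \<kappa> where "\<And>z. z \<noteq> 0 \<Longrightarrow> n z = \<kappa> * d z"
proof -
  have comp: "(\<lambda>t. g (exp t)) holomorphic_on UNIV" if "g holomorphic_on - {0}" for g :: "complex \<Rightarrow> complex"
  proof -
    have "(g \<circ> exp) holomorphic_on UNIV"
      by (intro holomorphic_on_compose holomorphic_on_exp holomorphic_on_subset[OF that]) auto
    then show ?thesis by (simp add: o_def)
  qed
  have exp_tau: "exp (t + of_real (- ln (\<rho> ^ 4))) = exp t / of_real (\<rho> ^ 4)" for t :: complex
    using rho4 by (simp only: exp_add exp_of_real exp_minus exp_ln of_real_inverse) (simp add: field_simps)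
  have shift: "n (z / of_real (\<rho> ^ 4)) = n z * (r\<^sub>c\<^sup>2 * (z / of_real (\<rho> ^ 4))\<^sup>2)"
      "d (z / of_real (\<rho> ^ 4)) = d z * (r\<^sub>c\<^sup>2 * (z / of_real (\<rho> ^ 4))\<^sup>2)" if "z \<noteq> 0" for z
    using n_mult[of "z / of_real (\<rho> ^ 4)"] d_mult[of "z / of_real (\<rho> ^ 4)"] that by auto
  have "\<exists>\<kappa>. \<forall>t. n (exp t) = \<kappa> * d (exp t)"
  proof (rule doubly_quasiperiodic_proportional[OF comp[OF n] comp[OF d], of "- ln (\<rho> ^ 4)"])
    show "- ln (\<rho> ^ 4) > 0"
      using rho4 by simp
    show "n (exp t) = 0" if "d (exp t) = 0" for t
      using zeros[of "exp t"] that by simp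
    show "n (exp (t + 2 * of_real pi * \<i>)) * d (exp t) = n (exp t) * d (exp (t + 2 * of_real pi * \<i>))" for t
      by (simp add: exp_add)
    show "n (exp (t + of_real (- ln (\<rho> ^ 4)))) * d (exp t) = n (exp t) * d (exp (t + of_real (- ln (\<rho> ^ 4))))" for t
      unfolding exp_tau shift[OF exp_not_eq_zero] by (simp add: algebra_simps)
    show "deriv (\<lambda>t. d (exp t)) t \<noteq> 0" if "d (exp t) = 0" for t
    proof -
      have "(d has_field_derivative deriv d (exp t)) (at (exp t))"
        by (rule holomorphic_derivI[OF d]) auto
      then have "((\<lambda>t. d (exp t)) has_field_derivative deriv d (exp t) * exp t) (at t)"
        by (rule DERIV_chain2) (rule DERIV_exp)
      then show ?thesis
        using zeros[of "exp t"] that by (simp add: DERIV_imp_deriv)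
    qed
  qed blast
  then obtain \<kappa> where \<kappa>: "n (exp t) = \<kappa> * d (exp t)" for t
    by blast
  show ?thesis
  proof (rule that)
    show "n z = \<kappa> * d z" if "z \<noteq> 0" for z
      using \<kappa>[of "Ln z"] that by simp
  qed
qed

text \<open>The arguments a = w/z and b = rho^2 z w have the product rho^2 w^2. If this is not a
  power of rho^4, the two theta factors never vanish together, and every zero in z is
  simple.\<close>

lemma cross_num_proportional_generic:
  assumes w: "w \<noteq> 0" "theta (\<rho> ^ 4) (r\<^sub>c\<^sup>2 * w\<^sup>2) \<noteq> 0"
  obtains \<kappa> where "\<And>z. z \<noteq> 0 \<Longrightarrow> cross_num z w = \<kappa> * cross_theta z w"
proof (rule quasiperiodic_proportional[of "\<lambda>z. cross_num z w" "\<lambda>z. cross_theta z w"])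
  show "(\<lambda>z. cross_num z w) holomorphic_on - {0}"
    unfolding cross_num_def by (intro holomorphic_intros slit_num_holomorphic slit_den_holomorphic)
  show "(\<lambda>z. cross_theta z w) holomorphic_on - {0}"
    unfolding cross_theta_def using w by (auto intro!: holomorphic_intros theta_holomorphic[OF rho4])
  fix z :: complex assume z: "z \<noteq> 0" "cross_theta z w = 0"
  define a b where "a = w / z" and "b = r\<^sub>c\<^sup>2 * z * w"
  have nz: "a \<noteq> 0" "b \<noteq> 0"
    using w z by (auto simp: a_def b_def)
  have D: "(theta (\<rho> ^ 4) has_field_derivative deriv (theta (\<rho> ^ 4)) x) (at x)" if "x \<noteq> 0" for x
    using theta_field_differentiable[OF rho4 that] DERIV_deriv_iff_field_differentiable by blast
  have D1: "((\<lambda>z. theta (\<rho> ^ 4) (w / z)) has_field_derivative deriv (theta (\<rho> ^ 4)) a * (- a / z)) (at z)"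
    by (rule DERIV_chain2[where f = "theta (\<rho> ^ 4)"])
      (use D[OF nz(1)] z in \<open>auto intro!: derivative_eq_intros simp: a_def power2_eq_square\<close>)
  have D2: "((\<lambda>z. theta (\<rho> ^ 4) (r\<^sub>c\<^sup>2 * z * w)) has_field_derivative deriv (theta (\<rho> ^ 4)) b * (r\<^sub>c\<^sup>2 * w)) (at z)"
    by (rule DERIV_chain2[where f = "theta (\<rho> ^ 4)"])
      (use D[OF nz(2)] in \<open>auto intro!: derivative_eq_intros simp: b_def\<close>)
  have "((\<lambda>z. cross_theta z w) has_field_derivative
      (1 * theta (\<rho> ^ 4) a + deriv (theta (\<rho> ^ 4)) a * (- a / z) * z) * theta (\<rho> ^ 4) b
      + deriv (theta (\<rho> ^ 4)) b * (r\<^sub>c\<^sup>2 * w) * (z * theta (\<rho> ^ 4) a)) (at z)"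
    unfolding cross_theta_def a_def b_def
    by (rule DERIV_mult DERIV_ident D1[unfolded a_def] D2[unfolded b_def])+
  then have dd: "deriv (\<lambda>z. cross_theta z w) z = (theta (\<rho> ^ 4) a - deriv (theta (\<rho> ^ 4)) a * a) * theta (\<rho> ^ 4) b
      + deriv (theta (\<rho> ^ 4)) b * (r\<^sub>c\<^sup>2 * w) * (z * theta (\<rho> ^ 4) a)"
    using z by (simp add: DERIV_imp_deriv)
  have not_both: "\<not> (theta (\<rho> ^ 4) a = 0 \<and> theta (\<rho> ^ 4) b = 0)"
  proof
    assume "theta (\<rho> ^ 4) a = 0 \<and> theta (\<rho> ^ 4) b = 0"
    then obtain i j :: int where "a = of_real (\<rho> ^ 4) powi i" "b = of_real (\<rho> ^ 4) powi j"
      using theta_eq_0_iff[OF rho4] nz by blast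
    then have "a * b = of_real (\<rho> ^ 4) powi (i + j)"
      by (simp add: power_int_add)
    moreover have "a * b = r\<^sub>c\<^sup>2 * w\<^sup>2"
      using z by (simp add: a_def b_def power2_eq_square)
    ultimately show False
      using theta_eq_0_iff[OF rho4, of "r\<^sub>c\<^sup>2 * w\<^sup>2"] w by auto
  qed
  have "theta (\<rho> ^ 4) a = 0 \<or> theta (\<rho> ^ 4) b = 0"
    using z by (auto simp: cross_theta_def a_def b_def)
  then have "deriv (\<lambda>z. cross_theta z w) z \<noteq> 0"
  proof
    assume a: "theta (\<rho> ^ 4) a = 0"
    moreover from a have "theta (\<rho> ^ 4) b \<noteq> 0" using not_both by simp
    moreover from a have "deriv (theta (\<rho> ^ 4)) a \<noteq> 0" by (rule deriv_theta_nonzero[OF rho4 nz(1)])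
    ultimately show ?thesis using nz by (simp add: dd)
  next
    assume b: "theta (\<rho> ^ 4) b = 0"
    moreover from b have "theta (\<rho> ^ 4) a \<noteq> 0" using not_both by simp
    moreover from b have "deriv (theta (\<rho> ^ 4)) b \<noteq> 0" by (rule deriv_theta_nonzero[OF rho4 nz(2)])
    ultimately show ?thesis using z w by (simp add: dd)
  qed
  then show "cross_num z w = 0 \<and> deriv (\<lambda>z. cross_theta z w) z \<noteq> 0"
    using cross_num_eq_0_of_cross_theta z w by blast
qed (use cross_num_mult cross_theta_mult w in auto)

text \<open>The generic case needs simple zeros on the right-hand side; the other values of \<open>w\<close> follow by
  continuity. Antisymmetry in \<open>z\<close> and \<open>w\<close> makes the constant independent of \<open>w\<close>.\<close>

lemma cross_num_proportional:
  obtains \<kappa> where "\<And>z w. z \<noteq> 0 \<Longrightarrow> w \<noteq> 0 \<Longrightarrow> cross_num z w = \<kappa> * cross_theta z w"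
proof -
  \<comment> \<open>A square root of rho supplies points off the zero sets: as rho^4 = \<sigma>^8,
    theta vanishes at \<sigma>^j only if 8 divides j, and the arguments below have j = 6, 4, -1 and
    5.\<close>
  define \<sigma> where "\<sigma> = sqrt \<rho>"
  have \<sigma>: "0 < \<sigma>" "\<sigma> < 1" "\<rho> = \<sigma>\<^sup>2"
    using rho by (auto simp: \<sigma>_def)
  have inj: "complex_of_real \<sigma> powi m = of_real \<sigma> powi n \<longleftrightarrow> m = n" for m n
    by (rule slit_annulus.powi_rho_inject) (use \<sigma> in unfold_locales)
  have p: "complex_of_real (\<rho> ^ 4) powi m = of_real \<sigma> powi (8 * m)" for m
    by (simp add: \<sigma> power_int_mult flip: power_mult)
  have \<sigma>nz [simp]: "complex_of_real \<sigma> \<noteq> 0" "\<sigma> \<noteq> 0" using \<sigma> by auto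
  have no: "theta (\<rho> ^ 4) (of_real \<sigma> powi j) \<noteq> 0" if "\<not> 8 dvd j" for j
  proof
    assume "theta (\<rho> ^ 4) (of_real \<sigma> powi j) = 0"
    then obtain m where "complex_of_real \<sigma> powi j = of_real (\<rho> ^ 4) powi m"
      using theta_eq_0_iff[OF rho4, of "of_real \<sigma> powi j"] \<sigma>nz power_int_not_zero by blast
    then show False
      using that unfolding p inj by auto
  qed
  define z0 where "z0 = complex_of_real \<sigma>"
  have z0: "z0 \<noteq> 0" by (simp add: z0_def)
  have gen0: "theta (\<rho> ^ 4) (r\<^sub>c\<^sup>2 * z0\<^sup>2) \<noteq> 0"
    using no[of 6] by (simp add: z0_def \<sigma>(3) flip: power_add power_mult)
  have gen1: "theta (\<rho> ^ 4) (r\<^sub>c\<^sup>2 * 1\<^sup>2) \<noteq> 0"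
    using no[of 4] by (simp add: \<sigma>(3) flip: power_add power_mult)
  have "theta (\<rho> ^ 4) (1 / z0) \<noteq> 0"
    using no[of "-1"] by (simp add: z0_def field_simps power_int_minus)
  moreover have "theta (\<rho> ^ 4) (r\<^sub>c\<^sup>2 * z0) \<noteq> 0"
    using no[of 5] by (simp add: z0_def \<sigma>(3) mult.commute flip: power_mult power_Suc)
  ultimately have R1: "cross_theta z0 1 \<noteq> 0"
    using z0 by (simp add: cross_theta_def)
  obtain \<kappa> where \<kappa>: "\<And>z. z \<noteq> 0 \<Longrightarrow> cross_num z z0 = \<kappa> * cross_theta z z0"
    using cross_num_proportional_generic[OF z0 gen0] by blast
  have main: "cross_num z w = \<kappa> * cross_theta z w" if h: "z \<noteq> 0" "w \<noteq> 0" "theta (\<rho> ^ 4) (r\<^sub>c\<^sup>2 * w\<^sup>2) \<noteq> 0" "cross_theta z0 w \<noteq> 0" for z w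
  proof -
    obtain \<kappa>' where \<kappa>': "\<And>z. z \<noteq> 0 \<Longrightarrow> cross_num z w = \<kappa>' * cross_theta z w"
      using cross_num_proportional_generic[OF h(2,3)] by blast
    have "\<kappa>' * cross_theta z0 w = - cross_num w z0"
      using \<kappa>'[OF z0] cross_num_swap by metis
    also have "\<dots> = \<kappa> * cross_theta z0 w"
      using \<kappa>[OF h(2)] cross_theta_swap[OF z0 h(2)] by simp
    finally show ?thesis
      using h \<kappa>' by simp
  qed
  \<comment> \<open>\<open>e\<close> collects the two genericity conditions on w. It does not vanish
    at 1, so its zeros are isolated and can be reached as limits of generic points.\<close>
  define e where "e = (\<lambda>w. theta (\<rho> ^ 4) (r\<^sub>c\<^sup>2 * w\<^sup>2) * cross_theta z0 w)"
  have hol_e: "e holomorphic_on - {0}"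
    unfolding e_def cross_theta_def
    using z0 by (auto intro!: holomorphic_intros theta_holomorphic[OF rho4])
  have conn: "connected (- {0 :: complex})"
    by (rule connected_punctured_universe) simp
  show ?thesis
  proof (rule that[of \<kappa>])
    fix z w :: complex assume zw: "z \<noteq> 0" "w \<noteq> 0"
    have "eventually (\<lambda>x. e x \<noteq> 0 \<and> x \<in> - {0}) (at w)"
      by (rule non_zero_neighbour_alt[OF hol_e _ conn, of w 1])
        (use zw gen1 R1 in \<open>auto simp: e_def\<close>)
    then have "eventually (\<lambda>x. cross_num z x - \<kappa> * cross_theta z x = 0) (at w)"
      by eventually_elim (use main[of z] zw in \<open>auto simp: e_def\<close>)
    then have "((\<lambda>x. cross_num z x - \<kappa> * cross_theta z x) \<longlongrightarrow> 0) (at w)"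
      by (rule tendsto_eventually)
    moreover have "(\<lambda>x. cross_num z x - \<kappa> * cross_theta z x) holomorphic_on - {0}"
      unfolding cross_num_def cross_theta_def
      using zw by (auto intro!: holomorphic_intros theta_holomorphic[OF rho4] slit_num_holomorphic slit_den_holomorphic)
    then have "isCont (\<lambda>x. cross_num z x - \<kappa> * cross_theta z x) w"
      using zw by (intro field_differentiable_imp_continuous_at holomorphic_on_imp_differentiable_at[of _ "- {0}"]) auto
    then have "((\<lambda>x. cross_num z x - \<kappa> * cross_theta z x) \<longlongrightarrow> cross_num z w - \<kappa> * cross_theta z w) (at w)"
      by (rule isContD)
    ultimately have "0 = cross_num z w - \<kappa> * cross_theta z w"
      by (rule LIM_unique)
    then show "cross_num z w = \<kappa> * cross_theta z w" by simp
  qed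
qed

definition cross_const :: complex where
  "cross_const = (SOME \<kappa>. \<forall>z w. z \<noteq> 0 \<longrightarrow> w \<noteq> 0 \<longrightarrow> cross_num z w = \<kappa> * cross_theta z w)"

lemma cross_num_eq: "z \<noteq> 0 \<Longrightarrow> w \<noteq> 0 \<Longrightarrow> cross_num z w = cross_const * cross_theta z w"
proof -
  have "\<exists>\<kappa>. \<forall>z w. z \<noteq> 0 \<longrightarrow> w \<noteq> 0 \<longrightarrow> cross_num z w = \<kappa> * cross_theta z w"
    using cross_num_proportional by metis
  from someI_ex[OF this] show "z \<noteq> 0 \<Longrightarrow> w \<noteq> 0 \<Longrightarrow> cross_num z w = cross_const * cross_theta z w"
    by (auto simp: cross_const_def)
qed

lemma slit_num_1: "A 1 = B 1"
  using slit_num_inverse[of 1] by simp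

lemma slit_den_1: "B 1 \<noteq> 0"
  using slit_den_nonzero[of 1] slit_num_1 by auto

text \<open>Otherwise F would take the same value at i rho, where it vanishes, and at 1, where it
  does not.\<close>

lemma cross_const_nonzero: "cross_const \<noteq> 0"
proof
  assume "cross_const = 0"
  then have "cross_num (\<i> * r\<^sub>c) 1 = 0"
    by (simp add: cross_num_eq)
  then show False
    using slit_num_irho slit_den_nonzero[of "\<i> * r\<^sub>c"] slit_num_1 slit_den_1 by (simp add: cross_num_def)
qed

text \<open>Equality of two values is a zero of one of the two theta factors. In the variable log z
  this says that F has order two.\<close>

lemma slit_map_eq_imp:
  assumes "z \<noteq> 0" "w \<noteq> 0" "B z \<noteq> 0" "B w \<noteq> 0" "F z = F w"
  shows "\<exists>m::int. w = z * r\<^sub>c powi (4 * m) \<or> w * z = r\<^sub>c powi (4 * m + 2)"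
proof -
  have p: "of_real (\<rho> ^ 4) powi m = r\<^sub>c powi (4 * m)" for m
    by (simp add: power_int_mult)
  have "cross_num z w = 0"
    using assms by (simp add: cross_num_def slit_map_def field_simps)
  then have "cross_theta z w = 0"
    using assms by (simp add: cross_num_eq cross_const_nonzero)
  then consider (1) "theta (\<rho> ^ 4) (w / z) = 0" | (2) "theta (\<rho> ^ 4) (r\<^sub>c\<^sup>2 * z * w) = 0"
    using assms by (auto simp: cross_theta_def)
  then show ?thesis
  proof cases
    case 1
    then obtain m :: int where "w / z = r\<^sub>c powi (4 * m)"
      using theta_eq_0_iff[OF rho4, of "w / z"] assms unfolding p by auto
    then have "w = z * r\<^sub>c powi (4 * m)"
      using assms by (simp add: field_simps)
    then show ?thesis by blast
  next
    case 2
    then obtain m :: int where m: "r\<^sub>c\<^sup>2 * z * w = r\<^sub>c powi (4 * m)"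
      using theta_eq_0_iff[OF rho4, of "r\<^sub>c\<^sup>2 * z * w"] assms unfolding p by auto
    have "r\<^sub>c powi (4 * (m - 1) + 2) = r\<^sub>c powi (4 * m - 2)"
      by (simp add: algebra_simps)
    also have "\<dots> = w * z"
      using m[symmetric] by (simp add: power_int_diff)
    finally show ?thesis by metis
  qed
qed

lemma slit_map_eq_norm:
  assumes "z \<noteq> 0" "w \<noteq> 0" "B z \<noteq> 0" "B w \<noteq> 0" "F z = F w"
  shows "(\<exists>m::int. w = z * r\<^sub>c powi (4 * m) \<and> norm w = norm z * \<rho> powi (4 * m)) \<or>
    (\<exists>m::int. w * z = r\<^sub>c powi (4 * m + 2) \<and> norm w * norm z = \<rho> powi (4 * m + 2))"
proof -
  have "norm (r\<^sub>c powi m) = \<rho> powi m" for m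
    using rho by (simp add: norm_power_int)
  then show ?thesis
    using slit_map_eq_imp[OF assms] by (metis norm_mult)
qed

text \<open>If c were omitted, A - c B would have no zeros, so B = \<kappa> (A - c B) with a
  constant \<kappa>. At i rho, where A = 0, and at 1, where A = B, this gives \<kappa> c = -1 and
  \<kappa> (1 - c) = 1, whence \<kappa> = 0.\<close>

lemma slit_map_surj: "\<exists>z. z \<noteq> 0 \<and> B z \<noteq> 0 \<and> F z = c"
proof (rule ccontr)
  assume contra: "\<not> ?thesis"
  have ne: "A z - c * B z \<noteq> 0" if "z \<noteq> 0" for z
  proof
    assume eq: "A z - c * B z = 0"
    then have "B z \<noteq> 0"
      using slit_den_nonzero[OF that] by auto
    then show False
      using contra that eq by (auto simp: slit_map_def field_simps)
  qed
  obtain \<kappa> where eq: "B z = \<kappa> * (A z - c * B z)" if "z \<noteq> 0" for z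
  proof (rule quasiperiodic_proportional[of B "\<lambda>z. A z - c * B z"])
    show "A (r\<^sub>c ^ 4 * z) - c * B (r\<^sub>c ^ 4 * z) = (A z - c * B z) / (r\<^sub>c\<^sup>2 * z\<^sup>2)" if "z \<noteq> 0" for z
      using that by (simp add: slit_num_mult slit_den_mult diff_divide_distrib)
  qed (use ne slit_den_mult in \<open>auto intro!: holomorphic_intros slit_num_holomorphic slit_den_holomorphic\<close>)
  have ne0: "B (\<i> * r\<^sub>c) \<noteq> 0"
    by (rule slit_den_nonzero) (auto simp: slit_num_irho)
  have "B (\<i> * r\<^sub>c) = \<kappa> * (A (\<i> * r\<^sub>c) - c * B (\<i> * r\<^sub>c))"
    by (rule eq) simp
  then have "B (\<i> * r\<^sub>c) * 1 = B (\<i> * r\<^sub>c) * (- (\<kappa> * c))"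
    unfolding slit_num_irho by (simp add: mult_ac)
  then have "1 = - (\<kappa> * c)"
    using ne0 by (simp only: mult_cancel_left) simp
  moreover have "1 = \<kappa> * (1 - c)"
  proof -
    have "B 1 * 1 = B 1 * (\<kappa> * (1 - c))"
      using eq[of 1] by (simp add: slit_num_1 algebra_simps)
    then show ?thesis
      using slit_den_1 by (simp only: mult_cancel_left) simp
  qed
  ultimately have "\<kappa> - \<kappa> * c = - (\<kappa> * c)"
    by (simp only: right_diff_distrib mult_1_right)
  then have "\<kappa> = 0" by simp
  then show False
    using eq[of 1] slit_den_1 by simp
qed

section \<open>Derivative and differential equation\<close>

lemma slit_map_1: "F 1 = 1"
  using slit_num_1 slit_den_1 by (simp add: slit_map_def)

text \<open>The factor theta(z/w) of F w - F z contains 1 - z/w explicitly, and w (1 - z/w) = w - z.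
  Division by w - z therefore leaves a continuous function, whose value at z is the
  derivative.\<close>

lemma slit_map_has_deriv:
  assumes "z \<noteq> 0" "B z \<noteq> 0"
  shows "(F has_field_derivative cross_const * (qpoch (\<rho> ^ 4) (of_real (\<rho> ^ 4)))\<^sup>2 * theta (\<rho> ^ 4) (r\<^sub>c\<^sup>2 * z\<^sup>2) / (B z)\<^sup>2) (at z)"
proof -
  define G where "G = (\<lambda>x. qpoch (\<rho> ^ 4) (of_real (\<rho> ^ 4) * x) * qpoch (\<rho> ^ 4) (of_real (\<rho> ^ 4) / x))"
  have contq: "isCont (qpoch (\<rho> ^ 4)) x" for x
    using qpoch_holomorphic[OF rho4] holomorphic_on_imp_continuous_on continuous_on_eq_continuous_at open_UNIV by blast
  have contB: "isCont B z"
    using slit_den_holomorphic assms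
    by (intro field_differentiable_imp_continuous_at holomorphic_on_imp_differentiable_at[of _ "- {0}"]) auto
  have contT: "isCont (theta (\<rho> ^ 4)) (r\<^sub>c\<^sup>2 * z * z)"
    using theta_field_differentiable[OF rho4] assms by (intro field_differentiable_imp_continuous_at) auto
  define q where "q = (\<lambda>w. cross_const * G (z / w) * theta (\<rho> ^ 4) (r\<^sub>c\<^sup>2 * w * z) / (B z * B w))"
  have "isCont (\<lambda>w. of_real (\<rho> ^ 4) * (z / w)) z" "isCont (\<lambda>w. of_real (\<rho> ^ 4) / (z / w)) z"
    using assms by (intro continuous_intros; simp)+
  then have "isCont (\<lambda>w. G (z / w)) z"
    unfolding G_def by (intro isCont_mult; elim isCont_o2[OF _ contq])
  moreover have "isCont (\<lambda>w. theta (\<rho> ^ 4) (r\<^sub>c\<^sup>2 * w * z)) z"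
    by (rule isCont_o2[where f = "\<lambda>w. r\<^sub>c\<^sup>2 * w * z", OF _ contT]) (intro continuous_intros)
  ultimately have "isCont q z"
    unfolding q_def by (intro isCont_divide isCont_mult contB continuous_const) (use assms in auto)
  then have "(q \<longlongrightarrow> q z) (at z)"
    by (rule isContD)
  moreover have "eventually (\<lambda>w. q w = (F w - F z) / (w - z)) (at z)"
  proof -
    have "eventually (\<lambda>w. B w \<noteq> 0) (at z)"
      using contB assms(2) tendsto_imp_eventually_ne isContD by blast
    moreover have "eventually (\<lambda>w. w \<noteq> 0) (at z)"
      using assms(1) tendsto_imp_eventually_ne[OF tendsto_ident_at] by blast
    moreover have "eventually (\<lambda>w. w \<noteq> z) (at z)"
      by (simp add: eventually_at_filter)
    ultimately show ?thesis
    proof eventually_elim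
      case (elim w)
      have "F w - F z = cross_num w z / (B w * B z)"
        using elim assms by (simp add: slit_map_def cross_num_def field_simps)
      also have "cross_num w z = cross_const * ((w - z) * G (z / w) * theta (\<rho> ^ 4) (r\<^sub>c\<^sup>2 * w * z))"
      proof -
        have "theta (\<rho> ^ 4) (z / w) = (1 - z / w) * G (z / w)"
          by (simp only: theta_factor[OF rho4] G_def)
        moreover have "w * (1 - z / w) = w - z"
          using elim by (simp add: field_simps)
        ultimately show ?thesis
          using elim assms by (simp add: cross_num_eq cross_theta_def)
      qed
      finally show ?case
        using elim assms by (simp add: q_def mult_ac)
    qed
  qed
  ultimately have "((\<lambda>w. (F w - F z) / (w - z)) \<longlongrightarrow> q z) (at z)"
    by (rule Lim_transform_eventually)
  then have "(F has_field_derivative q z) (at z)"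
    by (simp add: has_field_derivative_iff)
  then show ?thesis
    using assms by (simp add: q_def G_def power2_eq_square mult_ac)
qed

lemma slit_den_rho: "B (1 / r\<^sub>c) \<noteq> 0" "B r\<^sub>c \<noteq> 0"
proof -
  have *: "(r\<^sub>c powi j)\<^sup>2 \<noteq> - (r\<^sub>c powi i)" for i j
  proof
    assume "(r\<^sub>c powi j)\<^sup>2 = - (r\<^sub>c powi i)"
    then have "of_real ((\<rho> powi j)\<^sup>2) = (of_real (- (\<rho> powi i)) :: complex)"
      by (simp add: of_real_power_int)
    then have "(\<rho> powi j)\<^sup>2 = - (\<rho> powi i)"
      by (metis of_real_eq_iff)
    moreover have "\<rho> powi i > 0" using rho by simp
    ultimately show False
      by (smt (verit) zero_le_power2)
  qed
  show "B (1 / r\<^sub>c) \<noteq> 0"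
    using slit_den_eq_0_iff[of "1 / r\<^sub>c"] *[of "-1"] by (simp add: power_int_minus inverse_eq_divide)
  show "B r\<^sub>c \<noteq> 0"
    using slit_den_eq_0_iff[of r\<^sub>c] *[of 1] by simp
qed

text \<open>Up to powers of rho^4 the points \<pm>rho and \<pm>1/rho are fixed by z -> rho^2/z, so
  for these w both theta factors of F z - F w agree up to a monomial. The product of the four
  differences is therefore built from squares, and the two changes of base identify it with a
  multiple of the square of z F'(z).\<close>

lemma slit_map_ode:
  obtains c where "c \<noteq> 0" "\<And>z. z \<noteq> 0 \<Longrightarrow> B z \<noteq> 0 \<Longrightarrow>
     (z * deriv F z)\<^sup>2 = c * ((F z)\<^sup>2 - (F r\<^sub>c)\<^sup>2) * ((F z)\<^sup>2 - 1 / (F r\<^sub>c)\<^sup>2)"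
proof -
  define g where "g = (qpoch (\<rho> ^ 4) (of_real (\<rho> ^ 4)))\<^sup>2"
  have "of_real (\<rho> ^ 4) * complex_of_real (\<rho> ^ 4) ^ n \<noteq> 1" for n
    using rho4 by (metis of_real_1 of_real_eq_iff of_real_mult of_real_power power_Suc power_Suc_less_one less_irrefl)
  then have g: "g \<noteq> 0"
    by (auto simp: g_def qpoch_eq_0_iff[OF rho4])
  define b where "b = (B r\<^sub>c * B (1 / r\<^sub>c))\<^sup>2"
  have b: "b \<noteq> 0" using slit_den_rho by (simp add: b_def)
  define c where "c = - (b * r\<^sub>c\<^sup>2 * g\<^sup>2 / cross_const\<^sup>2)"
  have "c \<noteq> 0"
    using g b cross_const_nonzero by (simp add: c_def)
  moreover have "(z * deriv F z)\<^sup>2 = c * ((F z)\<^sup>2 - (F r\<^sub>c)\<^sup>2) * ((F z)\<^sup>2 - 1 / (F r\<^sub>c)\<^sup>2)"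
    if z: "z \<noteq> 0" "B z \<noteq> 0" for z
  proof -
    define a where "a = r\<^sub>c / z"
    have a: "a \<noteq> 0" using z by (simp add: a_def)
    have diff: "F z - F w = cross_const * cross_theta z w / (B z * B w)" if "w \<noteq> 0" "B w \<noteq> 0" for w
      using that z by (simp add: slit_map_def field_simps flip: cross_num_eq) (simp add: cross_num_def)
    have R1: "cross_theta z r\<^sub>c = z * (theta (\<rho> ^ 4) a)\<^sup>2"
    proof -
      have "theta (\<rho> ^ 4) (of_real (\<rho> ^ 4) / a) = theta (\<rho> ^ 4) a"
        using a by (intro theta_base_div[OF rho4])
      moreover have "of_real (\<rho> ^ 4) / a = r\<^sub>c\<^sup>2 * z * r\<^sub>c"
        using z by (simp add: a_def eval_nat_numeral)
      ultimately show ?thesis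
        by (simp add: cross_theta_def a_def power2_eq_square)
    qed
    have R2: "cross_theta z (- r\<^sub>c) = z * (theta (\<rho> ^ 4) (- a))\<^sup>2"
    proof -
      have "theta (\<rho> ^ 4) (of_real (\<rho> ^ 4) / (- a)) = theta (\<rho> ^ 4) (- a)"
        using a by (intro theta_base_div[OF rho4]) auto
      moreover have "of_real (\<rho> ^ 4) / (- a) = r\<^sub>c\<^sup>2 * z * (- r\<^sub>c)"
        using z by (simp add: a_def eval_nat_numeral)
      ultimately show ?thesis
        by (simp add: cross_theta_def a_def power2_eq_square)
    qed
    have R3: "cross_theta z (1 / r\<^sub>c) = - (1 / r\<^sub>c) * (theta (\<rho> ^ 4) (r\<^sub>c * z))\<^sup>2"
    proof -
      have "1 / r\<^sub>c / z = 1 / (r\<^sub>c * z)" "r\<^sub>c\<^sup>2 * z * (1 / r\<^sub>c) = r\<^sub>c * z"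
        using z by (auto simp: field_simps power2_eq_square)
      moreover have "theta (\<rho> ^ 4) (1 / (r\<^sub>c * z)) = - theta (\<rho> ^ 4) (r\<^sub>c * z) / (r\<^sub>c * z)"
        using z by (intro theta_inverse[OF rho4]) auto
      ultimately show ?thesis
        using z by (simp only: cross_theta_def) (simp add: power2_eq_square)
    qed
    have R4: "cross_theta z (- (1 / r\<^sub>c)) = (1 / r\<^sub>c) * (theta (\<rho> ^ 4) (- (r\<^sub>c * z)))\<^sup>2"
    proof -
      have "- (1 / r\<^sub>c) / z = 1 / (- (r\<^sub>c * z))" "r\<^sub>c\<^sup>2 * z * (- (1 / r\<^sub>c)) = - (r\<^sub>c * z)"
        using z by (auto simp: field_simps power2_eq_square)
      moreover have "theta (\<rho> ^ 4) (1 / (- (r\<^sub>c * z))) = - theta (\<rho> ^ 4) (- (r\<^sub>c * z)) / (- (r\<^sub>c * z))"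
        using z by (intro theta_inverse[OF rho4]) auto
      ultimately show ?thesis
        using z by (simp only: cross_theta_def) (simp add: power2_eq_square)
    qed
    have th: "theta (\<rho> ^ 4) (r\<^sub>c\<^sup>2 * z\<^sup>2) = theta (\<rho> ^ 4) a * theta (\<rho> ^ 4) (- a) *
        (theta (\<rho> ^ 4) (r\<^sub>c * z) * theta (\<rho> ^ 4) (- (r\<^sub>c * z)))"
    proof -
      have "theta (\<rho> ^ 4) (r\<^sub>c\<^sup>2 * z\<^sup>2) = theta (\<rho> ^ 8) ((r\<^sub>c * z)\<^sup>2) * theta (\<rho> ^ 8) (of_real (\<rho> ^ 4) * (r\<^sub>c\<^sup>2 * z\<^sup>2))"
        using theta_split[OF rho4, of "r\<^sub>c\<^sup>2 * z\<^sup>2"] z by (simp add: power_mult_distrib flip: power_mult)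
      also have "theta (\<rho> ^ 8) (of_real (\<rho> ^ 4) * (r\<^sub>c\<^sup>2 * z\<^sup>2)) = theta (\<rho> ^ 8) (a\<^sup>2)"
      proof -
        have "of_real (\<rho> ^ 4) * (r\<^sub>c\<^sup>2 * z\<^sup>2) = of_real (\<rho> ^ 8) / a\<^sup>2"
          using z by (simp add: a_def power_divide divide_simps flip: power_add)
        then show ?thesis
          using theta_base_div[OF rho8, of "a\<^sup>2"] a by simp
      qed
      also have "theta (\<rho> ^ 8) (a\<^sup>2) = theta (\<rho> ^ 4) a * theta (\<rho> ^ 4) (- a)"
        using theta_square[OF rho4, of a] by (simp flip: power_mult)
      also have "theta (\<rho> ^ 8) ((r\<^sub>c * z)\<^sup>2) = theta (\<rho> ^ 4) (r\<^sub>c * z) * theta (\<rho> ^ 4) (- (r\<^sub>c * z))"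
        using theta_square[OF rho4, of "r\<^sub>c * z"] by (simp flip: power_mult)
      finally show ?thesis by (simp add: mult_ac)
    qed
    have "((F z)\<^sup>2 - (F r\<^sub>c)\<^sup>2) * ((F z)\<^sup>2 - 1 / (F r\<^sub>c)\<^sup>2) =
        (F z - F r\<^sub>c) * (F z - F (- r\<^sub>c)) * ((F z - F (1 / r\<^sub>c)) * (F z - F (- (1 / r\<^sub>c))))"
      by (simp add: slit_map_minus slit_map_inverse power2_eq_square algebra_simps)
    also have "\<dots> = (cross_const * cross_theta z r\<^sub>c / (B z * B r\<^sub>c)) * (cross_const * cross_theta z (- r\<^sub>c) / (B z * B r\<^sub>c)) *
        ((cross_const * cross_theta z (1 / r\<^sub>c) / (B z * B (1 / r\<^sub>c))) * (cross_const * cross_theta z (- (1 / r\<^sub>c)) / (B z * B (1 / r\<^sub>c))))"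
      using slit_den_rho by (simp add: diff slit_den_minus)
    also have "\<dots> = - (cross_const ^ 4 * z\<^sup>2 * (theta (\<rho> ^ 4) (r\<^sub>c\<^sup>2 * z\<^sup>2))\<^sup>2 / (r\<^sub>c\<^sup>2 * (B z) ^ 4 * b))"
      unfolding R1 R2 R3 R4 th b_def by (simp add: power_mult_distrib eval_nat_numeral mult_ac)
    finally have 1: "((F z)\<^sup>2 - (F r\<^sub>c)\<^sup>2) * ((F z)\<^sup>2 - 1 / (F r\<^sub>c)\<^sup>2) =
       - (cross_const ^ 4 * z\<^sup>2 * (theta (\<rho> ^ 4) (r\<^sub>c\<^sup>2 * z\<^sup>2))\<^sup>2 / (r\<^sub>c\<^sup>2 * (B z) ^ 4 * b))" .
    have "deriv F z = cross_const * g * theta (\<rho> ^ 4) (r\<^sub>c\<^sup>2 * z\<^sup>2) / (B z)\<^sup>2"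
      using slit_map_has_deriv[OF z] by (simp add: g_def DERIV_imp_deriv)
    then have "(z * deriv F z)\<^sup>2 = cross_const\<^sup>2 * g\<^sup>2 * z\<^sup>2 * (theta (\<rho> ^ 4) (r\<^sub>c\<^sup>2 * z\<^sup>2))\<^sup>2 / (B z) ^ 4"
      by (simp add: power_mult_distrib power_divide mult_ac flip: power_mult)
    moreover have "c * (((F z)\<^sup>2 - (F r\<^sub>c)\<^sup>2) * ((F z)\<^sup>2 - 1 / (F r\<^sub>c)\<^sup>2)) = \<dots>"
      unfolding 1 c_def using b cross_const_nonzero z by (simp add: divide_simps eval_nat_numeral)
    ultimately show ?thesis by (simp add: mult.assoc)
  qed
  ultimately show ?thesis ..
qed

lemma powi_rho_less_iff: "\<rho> powi m < \<rho> powi n \<longleftrightarrow> n < m"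
  using rho power_int_strict_decreasing[of n m \<rho>] power_int_strict_decreasing[of m n \<rho>]
  by (metis less_irrefl less_asym linorder_less_linear)

lemma powi_rho_eq_iff: "\<rho> powi m = \<rho> powi n \<longleftrightarrow> m = n"
  using powi_rho_less_iff by (metis less_irrefl linorder_less_linear)

lemma slit_den_nonzero_norm:
  assumes "\<rho> powi 3 < norm z" "norm z < \<rho> powi (- 1)"
  shows "B z \<noteq> 0"
proof
  assume B0: "B z = 0"
  have "z \<noteq> 0"
    using assms(1) rho by (auto simp: power_int_def)
  with B0 obtain m :: int where "norm z = \<rho> powi (4 * m - 1)"
    using slit_den_eq_0_norm by blast
  with assms have "\<rho> powi 3 < \<rho> powi (4 * m - 1)" "\<rho> powi (4 * m - 1) < \<rho> powi (- 1)"
    by simp_all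
  then have "4 * m - 1 < 3" "- 1 < 4 * m - 1"
    by (simp_all only: powi_rho_less_iff)
  then show False by presburger
qed

lemma slit_map_field_differentiable:
  "z \<noteq> 0 \<Longrightarrow> B z \<noteq> 0 \<Longrightarrow> F field_differentiable (at z)"
  using slit_map_has_deriv field_differentiable_def by blast

lemma slit_map_of_real: "Im (F (of_real x)) = 0"
  using cnj_slit_map[of "of_real x"] by (simp add: complex_eq_iff)

text \<open>On this circle cnj z = rho^2/z, so the reflection symmetry gives F (cnj z) = F
  z.\<close>

lemma slit_map_circle_real:
  assumes "norm z = \<rho>"
  shows "Im (F z) = 0" "F (cnj z) = F z"
proof -
  have z: "z \<noteq> 0" using assms rho by auto
  have "cnj z = r\<^sub>c\<^sup>2 / z"
    using z assms by (simp add: field_simps complex_norm_square[symmetric] mult.commute[of "cnj z"] flip: assms)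
  then show "F (cnj z) = F z"
    using slit_map_reflect[OF z] by simp
  then have "cnj (F z) = F z"
    using cnj_slit_map[of z] by simp
  then show "Im (F z) = 0"
    by (simp add: complex_eq_iff)
qed

section \<open>The boundary circle and the central slit\<close>

definition circle_pt :: "real \<Rightarrow> complex" where "circle_pt \<theta> = r\<^sub>c * cis \<theta>"

definition circle_val :: "real \<Rightarrow> real" where "circle_val \<theta> = Re (F (circle_pt \<theta>))"

lemma norm_circle_pt [simp]: "norm (circle_pt \<theta>) = \<rho>"
  using rho by (simp add: circle_pt_def norm_mult)

lemma circle_pt_nz [simp]: "circle_pt \<theta> \<noteq> 0"
  using norm_circle_pt[of \<theta>] rho by (metis norm_zero less_irrefl)

lemma slit_den_circle_pt [simp]: "B (circle_pt \<theta>) \<noteq> 0"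
proof
  assume "B (circle_pt \<theta>) = 0"
  then obtain m :: int where "\<rho> powi 1 = \<rho> powi (4 * m - 1)"
    using slit_den_eq_0_norm[of "circle_pt \<theta>"] by auto
  then have "1 = 4 * m - 1"
    unfolding powi_rho_eq_iff .
  then show False by presburger
qed

lemma slit_map_circle_pt: "F (circle_pt \<theta>) = of_real (circle_val \<theta>)"
  using slit_map_circle_real[of "circle_pt \<theta>"] by (simp add: circle_val_def complex_eq_iff)

text \<open>The number L of the theorem, introduced as a value of F; the product formula for it is
  derived below.\<close>

definition slit_end :: real where "slit_end = circle_val 0"

lemma slit_map_rho: "F r\<^sub>c = of_real slit_end"
  using slit_map_circle_pt[of 0] by (simp add: slit_end_def circle_pt_def)

lemma circle_val_0: "circle_val 0 = slit_end" by (simp add: slit_end_def)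

lemma circle_val_pi: "circle_val pi = - slit_end"
  using slit_map_circle_pt[of pi] by (simp add: circle_pt_def slit_map_minus slit_map_rho)

lemma circle_val_half_pi: "circle_val (pi / 2) = 0"
  using slit_map_circle_pt[of "pi / 2"] slit_num_irho by (simp add: circle_pt_def slit_map_def mult.commute)

lemma isCont_circle_val: "isCont circle_val \<theta>"
proof -
  have "isCont F (circle_pt \<theta>)"
    by (intro field_differentiable_imp_continuous_at slit_map_field_differentiable) auto
  moreover have "isCont circle_pt \<theta>"
    unfolding circle_pt_def cis_conv_exp by (intro continuous_intros)
  ultimately have "isCont (\<lambda>\<theta>. F (circle_pt \<theta>)) \<theta>"
    by (rule isCont_o2[rotated])
  then show ?thesis
    unfolding circle_val_def by (rule isCont_Re)
qed

text \<open>Comparing moduli forces m = 0 in both alternatives. Then either cis y = cis x, and cos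
  is injective on [0, pi], or cis (x + y) = 1, which leaves only x = y at an endpoint.\<close>

lemma inj_circle_val: "inj_on circle_val {0..pi}"
proof (rule inj_onI)
  fix x y assume xy: "x \<in> {0..pi}" "y \<in> {0..pi}" "circle_val x = circle_val y"
  then have "F (circle_pt x) = F (circle_pt y)"
    by (simp add: slit_map_circle_pt)
  then consider (1) m :: int where "circle_pt y = circle_pt x * r\<^sub>c powi (4 * m)" "\<rho> = \<rho> * \<rho> powi (4 * m)"
    | (2) m :: int where "circle_pt y * circle_pt x = r\<^sub>c powi (4 * m + 2)" "\<rho> * \<rho> = \<rho> powi (4 * m + 2)"
    using slit_map_eq_norm[of "circle_pt x" "circle_pt y"] by auto
  then show "x = y"
  proof cases
    case 1
    then have "\<rho> powi 0 = \<rho> powi (4 * m)"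
      by simp
    then have "m = 0"
      unfolding powi_rho_eq_iff by simp
    then have "cis y = cis x"
      using 1 by (simp add: circle_pt_def)
    then have "cos x = cos y"
      by (simp add: complex_eq_iff)
    then show ?thesis
      using xy cos_inj_pi by auto
  next
    case 2
    then have "\<rho> powi 2 = \<rho> powi (4 * m + 2)"
      by (simp add: power2_eq_square)
    then have "m = 0"
      unfolding powi_rho_eq_iff by simp
    then have "cis (y + x) = 1"
      using 2 by (simp add: circle_pt_def power2_eq_square mult_ac flip: cis_mult)
    then have "cos (y + x) = 1"
      by (simp add: complex_eq_iff)
    then have "(y + x = 0) \<or> (y + x = 2 * pi)"
    proof -
      assume "cos (y + x) = 1"
      then obtain n :: int where n: "y + x = n * 2 * pi"
        using cos_one_2pi_int by auto
      moreover have "0 \<le> y + x" "y + x \<le> 2 * pi"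
        using xy by auto
      ultimately have "0 \<le> real_of_int n" "real_of_int n \<le> 1"
        using pi_gt_zero by (auto simp: zero_le_mult_iff)
      then have "n = 0 \<or> n = 1" by linarith
      then show ?thesis using n by auto
    qed
    then show ?thesis using xy by auto
  qed
qed

text \<open>At z = rho the theta arguments are -1 and - rho^4. The factor 2 in the formula is the
  first factor 1 - (-1) of theta at -1; once it is split off, both theta values are squares of a
  single product.\<close>

lemma slit_map_rho_product:
  "slit_end = 2 * \<rho> * (\<Prod>n. ((1 + \<rho> ^ (8 * Suc n)) / (1 + \<rho> ^ (8 * Suc n - 4)))\<^sup>2)" (is "_ = 2 * \<rho> * ?P")
  and slit_end_pos: "slit_end > 0"
proof -
  define a b where "a = (\<lambda>n. 1 + \<rho> ^ (8 * Suc n))" and "b = (\<lambda>n. 1 + \<rho> ^ (8 * Suc n - 4))"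
  \<comment> \<open>The cases j = 0 and j = 4 give numerator and denominator; j \<le> 8 keeps the
    truncated subtraction in the exponent exact.\<close>
  have hp: "(\<lambda>n. 1 + \<rho> ^ (8 * Suc n - j)) has_prod Re (qpoch (\<rho> ^ 8) (- of_real (\<rho> ^ (8 - j)))) \<and>
     qpoch (\<rho> ^ 8) (- of_real (\<rho> ^ (8 - j))) = of_real (Re (qpoch (\<rho> ^ 8) (- of_real (\<rho> ^ (8 - j)))))" if "j \<le> 8" for j
  proof -
    have re: "qpoch (\<rho> ^ 8) (- of_real (\<rho> ^ (8 - j))) = of_real (Re (qpoch (\<rho> ^ 8) (- of_real (\<rho> ^ (8 - j)))))"
      using cnj_qpoch[OF rho8, of "- of_real (\<rho> ^ (8 - j))"] by (simp add: complex_eq_iff)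
    have "(\<lambda>n. 1 - (- of_real (\<rho> ^ (8 - j))) * of_real (\<rho> ^ 8) ^ n) has_prod qpoch (\<rho> ^ 8) (- of_real (\<rho> ^ (8 - j)))"
      by (rule has_prod_qpoch[OF rho8])
    moreover have "1 - (- of_real (\<rho> ^ (8 - j))) * complex_of_real (\<rho> ^ 8) ^ n = of_real (1 + \<rho> ^ (8 * Suc n - j))" for n
    proof -
      have "8 * Suc n - j = (8 - j) + 8 * n" using that by simp
      then show ?thesis
        by (simp only: power_add power_mult) simp
    qed
    ultimately have "(\<lambda>n. complex_of_real (1 + \<rho> ^ (8 * Suc n - j))) has_prod of_real (Re (qpoch (\<rho> ^ 8) (- of_real (\<rho> ^ (8 - j)))))"
      using re by simp
    then show ?thesis
      using re has_prod_of_real_iff[where 'a = complex] by blast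
  qed
  define qa qb where "qa = Re (qpoch (\<rho> ^ 8) (- of_real (\<rho> ^ 8)))" and "qb = Re (qpoch (\<rho> ^ 8) (- of_real (\<rho> ^ 4)))"
  have a: "a has_prod qa" "qpoch (\<rho> ^ 8) (- of_real (\<rho> ^ 8)) = of_real qa"
    using hp[of 0] by (simp_all add: a_def qa_def)
  have b: "b has_prod qb" "qpoch (\<rho> ^ 8) (- of_real (\<rho> ^ 4)) = of_real qb"
    using hp[of 4] by (simp_all add: b_def qb_def)
  have pos: "a n > 0" "b n > 0" for n
    using rho by (auto simp: a_def b_def add_pos_pos)
  have nz: "qa \<noteq> 0" "qb \<noteq> 0"
    using has_prod_eq_0_iff[OF a(1)] has_prod_eq_0_iff[OF b(1)] pos by (metis imageE less_irrefl)+
  have "convergent_prod a" "convergent_prod b" "prodinf a = qa" "prodinf b = qb"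
    using a b has_prod_iff by blast+
  then have "?P = (qa / qb)\<^sup>2"
    using prodinf_power[of "\<lambda>n. a n / b n" 2] prodinf_divide[of a b] convergent_prod_divide[of a b] pos
    by (simp add: a_def b_def less_imp_neq[symmetric])
  moreover have "F r\<^sub>c = of_real (2 * \<rho> * (qa / qb)\<^sup>2)"
  proof -
    have "- r\<^sub>c\<^sup>2 / r\<^sub>c\<^sup>2 = -1" "- r\<^sub>c\<^sup>2 * r\<^sub>c\<^sup>2 = - of_real (\<rho> ^ 4)"
      by (simp_all flip: power_add)
    moreover have "theta (\<rho> ^ 8) (- 1) = of_real (2 * qa\<^sup>2)"
      using a(2) unfolding theta_def by (subst qpoch_rec[OF rho8]) (simp add: power2_eq_square)
    moreover have "theta (\<rho> ^ 8) (- of_real (\<rho> ^ 4)) = of_real (qb\<^sup>2)"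
    proof -
      have "of_real (\<rho> ^ 8) / (- of_real (\<rho> ^ 4)) = - complex_of_real (\<rho> ^ 4)"
        by (simp add: divide_simps flip: power_add)
      then show ?thesis
        using b(2) unfolding theta_def by (simp only: power2_eq_square of_real_mult)
    qed
    ultimately show ?thesis
      unfolding slit_map_def slit_num_def slit_den_def by (simp only:) (simp add: power_divide)
  qed
  ultimately show "slit_end = 2 * \<rho> * ?P"
    using slit_map_rho by (metis of_real_eq_iff)
  then show "slit_end > 0"
    using nz rho \<open>?P = _\<close> by simp
qed

text \<open>Otherwise the value \<open>1\<close>, which \<open>F\<close> has at \<open>1\<close>, would also be taken on the circle.\<close>

lemma slit_end_less_1: "slit_end < 1"
proof (rule ccontr)
  assume "\<not> slit_end < 1"
  then have "\<exists>\<theta>. 0 \<le> \<theta> \<and> \<theta> \<le> pi / 2 \<and> circle_val \<theta> = 1"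
    by (intro IVT2) (auto simp: circle_val_0 circle_val_half_pi isCont_circle_val)
  then obtain \<theta> where "circle_val \<theta> = 1" by auto
  then have "F 1 = F (circle_pt \<theta>)"
    by (simp add: slit_map_circle_pt slit_map_1)
  then obtain m :: int where "\<rho> powi 1 = \<rho> powi (4 * m) \<or> \<rho> powi 1 = \<rho> powi (4 * m + 2)"
    using slit_map_eq_norm[of 1 "circle_pt \<theta>"] slit_den_1 by auto
  then have "1 = 4 * m \<or> 1 = 4 * m + 2"
    unfolding powi_rho_eq_iff .
  then show False by presburger
qed

text \<open>An injective continuous function on an interval is strictly monotone; the values L at 0
  and - L at pi decide the direction.\<close>

lemma circle_val_strict_antimono:
  assumes "0 \<le> x" "x < y" "y \<le> pi"
  shows "circle_val y < circle_val x"
proof -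
  have "strict_mono_on {0..pi} circle_val \<or> strict_antimono_on {0..pi} circle_val"
    using inj_circle_val isCont_circle_val by (subst injective_eq_monotone_map[symmetric])
      (auto simp: continuous_at_imp_continuous_on is_interval_cc)
  moreover have "\<not> strict_mono_on {0..pi} circle_val"
  proof
    assume "strict_mono_on {0..pi} circle_val"
    from strict_mono_onD[OF this, of 0 pi] show False
      using slit_end_pos by (simp add: circle_val_0 circle_val_pi)
  qed
  ultimately have "strict_antimono_on {0..pi} circle_val" by blast
  then show ?thesis
    using assms unfolding monotone_on_def by auto
qed

lemma circle_val_antimono: "0 \<le> x \<Longrightarrow> x \<le> y \<Longrightarrow> y \<le> pi \<Longrightarrow> circle_val y \<le> circle_val x"
  using circle_val_strict_antimono[of x y] by (cases "x = y") auto

lemma slit_map_circle_range: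
  assumes "norm z = \<rho>"
  shows "\<exists>x. \<bar>x\<bar> \<le> slit_end \<and> F z = of_real x"
proof -
  have main: "\<exists>x. \<bar>x\<bar> \<le> slit_end \<and> F z = of_real x" if z: "norm z = \<rho>" "Im z \<ge> 0" for z
  proof -
    have z0: "z \<noteq> 0" using z rho by auto
    have "z = circle_pt (Arg z)"
      using Arg_eq[OF z0] z by (simp add: circle_pt_def cis_conv_exp)
    moreover have "0 \<le> Arg z" "Arg z \<le> pi"
      using z z0 Arg_less_0[of z] Arg_le_pi[of z] by auto
    then have "circle_val pi \<le> circle_val (Arg z)" "circle_val (Arg z) \<le> circle_val 0"
      by (auto intro!: circle_val_antimono)
    ultimately show ?thesis
      using slit_map_circle_pt[of "Arg z"] by (intro exI[of _ "circle_val (Arg z)"]) (auto simp: circle_val_0 circle_val_pi)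
  qed
  show ?thesis
  proof (cases "Im z \<ge> 0")
    case False
    then show ?thesis
      using main[of "cnj z"] assms slit_map_circle_real(2)[OF assms] by simp
  qed (use main assms in auto)
qed

lemma slit_map_circle_surj:
  assumes "\<bar>x\<bar> \<le> slit_end"
  shows "\<exists>\<theta>. F (circle_pt \<theta>) = of_real x"
proof -
  have "\<exists>\<theta>. 0 \<le> \<theta> \<and> \<theta> \<le> pi \<and> circle_val \<theta> = x"
    by (intro IVT2) (use assms in \<open>auto simp: circle_val_0 circle_val_pi isCont_circle_val\<close>)
  then show ?thesis
    using slit_map_circle_pt by blast
qed

section \<open>Bijectivity onto the slit plane\<close>

definition slits :: "complex set" where
  "slits = {w. Im w = 0 \<and> (\<bar>Re w\<bar> \<le> slit_end \<or> \<bar>Re w\<bar> \<ge> 1 / slit_end)}"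

definition annulus :: "complex set" where
  "annulus = {z. \<rho> < norm z \<and> norm z < 1 / \<rho>}"

lemma annulus_nz: "z \<in> annulus \<Longrightarrow> z \<noteq> 0"
  using rho by (auto simp: annulus_def)

lemma annulus_iff: "z \<in> annulus \<longleftrightarrow> \<rho> powi 1 < norm z \<and> norm z < \<rho> powi (- 1)"
  by (simp add: annulus_def power_int_minus inverse_eq_divide)

lemma slit_den_annulus: "z \<in> annulus \<Longrightarrow> B z \<noteq> 0"
  using powi_rho_less_iff[of 3 1] by (intro slit_den_nonzero_norm) (auto simp: annulus_iff)

text \<open>Quotient and product of two moduli in the annulus lie strictly between rho^2 and
  rho^(-2). An exponent 4m is then 0, and an exponent 4m + 2 is impossible.\<close>

lemma inj_slit_map: "inj_on F annulus"
proof (rule inj_onI)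
  fix z w assume zw: "z \<in> annulus" "w \<in> annulus" "F z = F w"
  note [simp] = annulus_nz[OF zw(1)] annulus_nz[OF zw(2)]
  consider (1) m :: int where "w = z * r\<^sub>c powi (4 * m)" "norm w = norm z * \<rho> powi (4 * m)"
    | (2) m :: int where "norm w * norm z = \<rho> powi (4 * m + 2)"
    using slit_map_eq_norm[of z w] zw slit_den_annulus by auto
  then show "z = w"
  proof cases
    case 1
    have "\<rho> powi (4 * m) = norm w / norm z"
      using 1 by simp
    also have "\<dots> < (\<rho> powi (-1)) / \<rho> powi 1"
      using zw rho by (intro frac_less2) (auto simp: annulus_iff)
    also have "\<dots> = \<rho> powi (-2)"
      using power_int_diff[of \<rho> "-1" 1] by simp
    finally have "m \<ge> 0"
      unfolding powi_rho_less_iff by simp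
    have "\<rho> powi 2 = (\<rho> powi 1) / \<rho> powi (-1)"
      using power_int_diff[of \<rho> 1 "-1"] by simp
    also have "\<dots> < norm w / norm z"
      using zw rho by (intro frac_less2) (auto simp: annulus_iff)
    also have "\<dots> = \<rho> powi (4 * m)"
      using 1 by simp
    finally have "m \<le> 0"
      unfolding powi_rho_less_iff by simp
    with \<open>m \<ge> 0\<close> show ?thesis using 1 by simp
  next
    case 2
    have "norm w * norm z < \<rho> powi (-1) * \<rho> powi (-1)"
      using zw rho by (intro mult_strict_mono) (auto simp: annulus_iff)
    then have "\<rho> powi (4 * m + 2) < \<rho> powi (-2)"
      unfolding 2 using power_int_add[of \<rho> "-1" "-1"] by simp
    then have "m \<ge> 0"
      unfolding powi_rho_less_iff by simp
    have "\<rho> powi 1 * \<rho> powi 1 < norm w * norm z"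
      using zw rho by (intro mult_strict_mono) (auto simp: annulus_iff)
    then have "\<rho> powi 2 < \<rho> powi (4 * m + 2)"
      unfolding 2 using power_int_add[of \<rho> 1 1] by simp
    then have "m < 0"
      unfolding powi_rho_less_iff by simp
    with \<open>m \<ge> 0\<close> show ?thesis by simp
  qed
qed

text \<open>The circle |z| = rho already covers the central slit, and any finite point sharing such
  a value has an odd power of rho as modulus. The open annulus contains no such modulus.\<close>

lemma slit_map_annulus_not_central_slit:
  assumes "z \<in> annulus" "\<bar>x\<bar> \<le> slit_end"
  shows "F z \<noteq> of_real x"
proof
  assume "F z = of_real x"
  then obtain \<theta> where "F z = F (circle_pt \<theta>)"
    using slit_map_circle_surj[OF assms(2)] by metis
  then obtain m :: int where "\<rho> = norm z * \<rho> powi (4 * m) \<or> \<rho> * norm z = \<rho> powi (4 * m + 2)"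
    using slit_map_eq_norm[of z "circle_pt \<theta>"] slit_den_annulus[OF assms(1)] annulus_nz[OF assms(1)] by auto
  then have "norm z = \<rho> powi (1 - 4 * m) \<or> norm z = \<rho> powi (4 * m + 1)"
    using rho by (auto simp: power_int_diff power_int_add power2_eq_square field_simps)
  then obtain j where "norm z = \<rho> powi j" "odd j"
    by (metis dvd_mult2 even_add even_diff even_numeral odd_one)
  then show False
    using assms(1) unfolding annulus_iff by (simp only: powi_rho_less_iff) presburger
qed

lemma inverse_annulus: "z \<in> annulus \<Longrightarrow> 1 / z \<in> annulus"
  using annulus_nz[of z] rho by (auto simp: annulus_def norm_divide field_simps)

text \<open>Inversion z -> 1/z preserves the annulus and carries values on the outer slits to the
  central one, so only the latter has to be excluded.\<close>

lemma slit_map_image_subset: "F ` annulus \<subseteq> - slits"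
proof safe
  fix z assume z: "z \<in> annulus" and "F z \<in> slits"
  then consider "Im (F z) = 0" "\<bar>Re (F z)\<bar> \<le> slit_end" | "Im (F z) = 0" "\<bar>Re (F z)\<bar> \<ge> 1 / slit_end"
    by (auto simp: slits_def)
  then show False
  proof cases
    case 1
    then show False
      using slit_map_annulus_not_central_slit[OF z 1(2)] by (simp add: complex_eq_iff)
  next
    case 2
    have "F (1 / z) = of_real (1 / Re (F z))"
      using 2 slit_map_inverse[OF annulus_nz[OF z]] by (simp add: complex_is_Real_iff[symmetric] flip: of_real_Re)
    moreover have "\<bar>1 / Re (F z)\<bar> \<le> slit_end"
    proof -
      have "0 < \<bar>Re (F z)\<bar>"
        using 2 slit_end_pos by (smt (verit) divide_pos_pos)
      then show ?thesis
        using 2 slit_end_pos by (simp add: abs_divide divide_le_eq mult.commute)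
    qed
    ultimately show False
      using slit_map_annulus_not_central_slit[OF inverse_annulus[OF z]] by blast
  qed
qed

lemma slit_map_powi:
  assumes "z \<noteq> 0"
  shows "F (z * r\<^sub>c powi (4 * m)) = F z"
proof (induction m rule: int_induct[of _ 0])
  case (step1 i)
  have "z * r\<^sub>c powi (4 * (i + 1)) = r\<^sub>c ^ 4 * (z * r\<^sub>c powi (4 * i))"
    by (simp add: power_int_add algebra_simps)
  then have "F (z * r\<^sub>c powi (4 * (i + 1))) = F (z * r\<^sub>c powi (4 * i))"
    using slit_map_mult[of "z * r\<^sub>c powi (4 * i)"] assms by (simp only:) simp
  then show ?case using step1 by simp
next
  case (step2 i)
  have "z * r\<^sub>c powi (4 * i) = r\<^sub>c ^ 4 * (z * r\<^sub>c powi (4 * (i - 1)))"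
    by (simp add: power_int_diff algebra_simps)
  then have "F (z * r\<^sub>c powi (4 * i)) = F (z * r\<^sub>c powi (4 * (i - 1)))"
    using slit_map_mult[of "z * r\<^sub>c powi (4 * (i - 1))"] assms by (simp only:) simp
  then show ?case using step2 by simp
qed auto

text \<open>Some preimage exists in the punctured plane. Powers of rho^4 move it to rho^3 \<le> |z|
  \<le> 1/rho, and the reflection rho^2/z then to rho \<le> |z| \<le> 1/rho. It is not on a boundary
  circle, as these are mapped into the slits.\<close>

lemma slit_map_onto: "- slits \<subseteq> F ` annulus"
proof
  fix w assume w: "w \<in> - slits"
  obtain z where z: "z \<noteq> 0" "F z = w"
    using slit_map_surj by blast
  define t where "t = ln (norm z) / ln \<rho>"
  have t: "norm z = \<rho> powr t"
    using z rho by (simp add: t_def powr_def)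
  \<comment> \<open>With |z| = rho^t, adding 4m brings the exponent into [-1, 3].\<close>
  define m where "m = - \<lfloor>(t + 1) / 4\<rfloor>"
  define z1 where "z1 = z * r\<^sub>c powi (4 * m)"
  have z1: "z1 \<noteq> 0" "F z1 = w"
    using z by (simp_all add: z1_def slit_map_powi)
  have "norm z1 = \<rho> powr (t + 4 * m)"
    using rho t powr_real_of_int'[of \<rho> "4 * m"] by (simp add: z1_def norm_mult norm_power_int powr_add)
  moreover have "-1 \<le> t + 4 * m" "t + 4 * m \<le> 3"
    using floor_correct[of "(t + 1) / 4"] by (simp_all add: m_def field_simps)
  ultimately have n1: "\<rho> powi 3 \<le> norm z1" "norm z1 \<le> 1 / \<rho>"
    using rho powr_mono'[of "t + 4 * m" 3 \<rho>] powr_mono'[of "-1" "t + 4 * m" \<rho>]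
    by (auto simp: powr_minus_divide)
  obtain z2 where z2: "F z2 = w" "\<rho> \<le> norm z2" "norm z2 \<le> 1 / \<rho>"
  proof (cases "norm z1 < \<rho>")
    case True
    have "F (r\<^sub>c\<^sup>2 / z1) = w"
      using slit_map_reflect z1 by simp
    moreover have "\<rho> \<le> norm (r\<^sub>c\<^sup>2 / z1)"
      using True z1 rho by (simp add: norm_divide norm_mult field_simps power2_eq_square)
    moreover have "norm (r\<^sub>c\<^sup>2 / z1) \<le> 1 / \<rho>"
      using n1 z1 rho by (simp add: norm_divide norm_mult field_simps eval_nat_numeral)
    ultimately show ?thesis by (rule that)
  qed (use that z1 n1 in auto)
  have "norm z2 \<noteq> \<rho>"
  proof
    assume "norm z2 = \<rho>"
    then show False
      using slit_map_circle_range[of z2] w z2 by (auto simp: slits_def)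
  qed
  moreover have "norm z2 \<noteq> 1 / \<rho>"
  proof
    assume n: "norm z2 = 1 / \<rho>"
    then have "norm (1 / z2) = \<rho>" and nz: "z2 \<noteq> 0"
      using rho by (auto simp: norm_divide)
    then obtain x where x: "\<bar>x\<bar> \<le> slit_end" "F (1 / z2) = of_real x"
      using slit_map_circle_range by blast
    then have inv: "1 / w = of_real x"
      using slit_map_inverse[OF nz] z2 by simp
    have "w = 1 / (1 / w)" by simp
    also have "\<dots> = of_real (1 / x)"
      by (simp only: inv) simp
    finally have w': "w = of_real (1 / x)" .
    show False
    \<comment> \<open>The case x = 0 is a pole on the outer circle: there F is 0 by convention, and
      0 lies on the central slit.\<close>
    proof (cases "x = 0")
      case True
      then show False using w w' slit_end_pos by (auto simp: slits_def)
    next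
      case False
      then have "1 / slit_end \<le> \<bar>1 / x\<bar>"
        using x slit_end_pos by (simp add: field_simps abs_divide)
      then show False using w w' by (auto simp: slits_def)
    qed
  qed
  ultimately have "z2 \<in> annulus"
    using z2 by (auto simp: annulus_def)
  then show "w \<in> F ` annulus" using z2 by blast
qed

end

section \<open>The Jacobi elliptic sine\<close>

text \<open>Division by zero supplies exactly the value 0 required at a pole. The point \<beta>
  ensures that b is not identically zero, so its zeros are isolated.\<close>

lemma nicely_meromorphic_entire_quotient:
  assumes a: "a holomorphic_on UNIV" and b: "b holomorphic_on UNIV"
    and nz: "\<And>u. b u = 0 \<Longrightarrow> a u \<noteq> 0" "b \<beta> \<noteq> 0"
  shows "(\<lambda>u. a u / b u) nicely_meromorphic_on UNIV"
  unfolding nicely_meromorphic_on_def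
proof (intro conjI ballI)
  show "(\<lambda>u. a u / b u) meromorphic_on UNIV"
    using a b by (intro meromorphic_on_divide analytic_on_imp_meromorphic_on) (auto simp: analytic_on_open)
  fix u :: complex
  have cont: "isCont a u" "isCont b u"
    using a b holomorphic_on_imp_continuous_on continuous_on_eq_continuous_at open_UNIV by blast+
  show "is_pole (\<lambda>u. a u / b u) u \<and> a u / b u = 0 \<or> (\<lambda>u. a u / b u) \<midarrow>u\<rightarrow> a u / b u"
  proof (cases "b u = 0")
    case True
    have "eventually (\<lambda>x. b x \<noteq> 0 \<and> x \<in> UNIV) (at u)"
      by (rule non_zero_neighbour_alt[OF b]) (use nz in auto)
    then have "filterlim b (at 0) (at u)"
      using cont(2) True by (auto simp: filterlim_at isCont_def)
    then have "is_pole (\<lambda>u. a u / b u) u"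
      by (rule is_pole_divide[OF cont(1)]) (use nz True in auto)
    then show ?thesis using True by simp
  next
    case False
    then have "isCont (\<lambda>u. a u / b u) u"
      using cont by (intro continuous_intros)
    then show ?thesis
      by (simp add: isCont_def)
  qed
qed

text \<open>The identity theorem for the difference gives equality on a punctured neighbourhood of
  each point; the value at the point is then determined, as the limit or as 0 at a pole.\<close>

lemma nicely_meromorphic_eqI:
  assumes f: "f nicely_meromorphic_on UNIV" and g: "g nicely_meromorphic_on UNIV"
    and freq: "frequently (\<lambda>z. f z = g z) (at z0)"
  shows "f = g"
proof
  fix u
  have mero: "(\<lambda>z. f z - g z) meromorphic_on UNIV"
    using f g by (intro meromorphic_intros) (auto simp: nicely_meromorphic_on_def)
  have ev: "eventually (\<lambda>w. remove_sings (\<lambda>z. f z - g z) w = f w - g w) (at z)" for z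
    by (rule eventually_remove_sings_eq_at) (intro meromorphic_on_isolated_singularity meromorphic_on_subset[OF mero] subset_UNIV)
  have "frequently (\<lambda>w. remove_sings (\<lambda>z. f z - g z) w = 0) (at z0)"
    using frequently_eventually_conj[OF freq ev[of z0]] by (rule frequently_elim1) auto
  then have "remove_sings (\<lambda>z. f z - g z) w = 0" for w
    by (rule frequently_eq_meromorphic_imp_constant[OF _ remove_sings_nicely_meromorphic[OF mero]]) auto
  then have eq: "eventually (\<lambda>w. f w = g w) (at u)"
    using ev[of u] by (auto elim: eventually_mono)
  have pole: "is_pole f u \<longleftrightarrow> is_pole g u"
    by (rule is_pole_cong[OF eq refl])
  have lim: "f \<midarrow>u\<rightarrow> c \<longleftrightarrow> g \<midarrow>u\<rightarrow> c" for c
    by (rule tendsto_cong[OF eq])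
  have "(is_pole f u \<and> f u = 0) \<or> f \<midarrow>u\<rightarrow> f u" "(is_pole g u \<and> g u = 0) \<or> g \<midarrow>u\<rightarrow> g u"
    using f g by (auto simp: nicely_meromorphic_on_def)
  then show "f u = g u"
    using pole lim not_tendsto_and_filterlim_at_infinity[of "at u"] LIM_unique
    unfolding is_pole_def by (metis trivial_limit_at)
qed

context slit_annulus
begin

section \<open>Inverting the elliptic integral on the circle\<close>

lemma circle_val_has_deriv:
  obtains d where "(circle_val has_real_derivative d) (at \<theta>)" "of_real d = \<i> * circle_pt \<theta> * deriv F (circle_pt \<theta>)"
proof -
  define D where "D = \<i> * circle_pt \<theta> * deriv F (circle_pt \<theta>)"
  have "(circle_pt has_vector_derivative \<i> * circle_pt \<theta>) (at \<theta>)"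
    unfolding circle_pt_def has_vector_derivative_def
    by (auto intro!: derivative_eq_intros simp: scaleR_conv_of_real)
  moreover have "(F has_field_derivative deriv F (circle_pt \<theta>)) (at (circle_pt \<theta>))"
    unfolding DERIV_deriv_iff_field_differentiable by (simp add: slit_map_field_differentiable)
  ultimately have "((F \<circ> circle_pt) has_vector_derivative D) (at \<theta>)"
    unfolding D_def by (rule field_vector_diff_chain_at)
  then have 1: "((\<lambda>t. complex_of_real (circle_val t)) has_vector_derivative D) (at \<theta>)"
    by (simp add: o_def slit_map_circle_pt)
  have "((\<lambda>t. Re (of_real (circle_val t))) has_vector_derivative Re D) (at \<theta>)"
    by (rule bounded_linear.has_vector_derivative[OF bounded_linear_Re 1])
  then have "(circle_val has_real_derivative Re D) (at \<theta>)"
    by (simp add: has_real_derivative_iff_has_vector_derivative)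
  moreover have "((\<lambda>t. Im (of_real (circle_val t))) has_vector_derivative Im D) (at \<theta>)"
    by (rule bounded_linear.has_vector_derivative[OF bounded_linear_Im 1])
  then have "((\<lambda>t. 0 :: real) has_vector_derivative Im D) (at \<theta>)"
    by simp
  then have "Im D = 0"
    using vector_derivative_unique_at has_vector_derivative_const by blast
  then have "of_real (Re D) = D"
    by (simp add: complex_eq_iff)
  ultimately show ?thesis
    using that unfolding D_def by blast
qed

text \<open>The positive constant M with x'^2 = M^2 (1 - x^2) (1 - L^4 x^2) for x =
  \<open>circle_val\<close> / L. As x vanishes at pi/2, M is |x'| there. It turns out to be
  2K/pi.\<close>

definition sn_scale :: real where "sn_scale = \<bar>deriv circle_val (pi / 2)\<bar> / slit_end"

lemma sn_scale_pos: "sn_scale > 0"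
  and sn_ode: "(circle_val has_real_derivative d) (at \<theta>) \<Longrightarrow>
       (d / slit_end)\<^sup>2 = sn_scale\<^sup>2 * ((1 - (circle_val \<theta> / slit_end)\<^sup>2) * (1 - (slit_end\<^sup>2)\<^sup>2 * (circle_val \<theta> / slit_end)\<^sup>2))"
  and slit_map_ode_real: "z \<noteq> 0 \<Longrightarrow> B z \<noteq> 0 \<Longrightarrow>
       (z * deriv F z)\<^sup>2 = - (of_real (sn_scale * slit_end))\<^sup>2 * ((F z)\<^sup>2 - (of_real slit_end)\<^sup>2) * ((F z)\<^sup>2 - 1 / (of_real slit_end)\<^sup>2)"
proof -
  obtain c where c: "c \<noteq> 0" and ode: "\<And>z. z \<noteq> 0 \<Longrightarrow> B z \<noteq> 0 \<Longrightarrow>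
     (z * deriv F z)\<^sup>2 = c * ((F z)\<^sup>2 - (F r\<^sub>c)\<^sup>2) * ((F z)\<^sup>2 - 1 / (F r\<^sub>c)\<^sup>2)"
    using slit_map_ode by blast
  have sq: "of_real (d\<^sup>2) = - c * of_real (((circle_val \<theta>)\<^sup>2 - slit_end\<^sup>2) * ((circle_val \<theta>)\<^sup>2 - 1 / slit_end\<^sup>2))"
    if d: "(circle_val has_real_derivative d) (at \<theta>)" for d \<theta>
  proof -
    obtain d' where d': "(circle_val has_real_derivative d') (at \<theta>)" "of_real d' = \<i> * circle_pt \<theta> * deriv F (circle_pt \<theta>)"
      by (rule circle_val_has_deriv)
    then have "d' = d" using d DERIV_unique by blast
    then have "of_real (d\<^sup>2) = - ((circle_pt \<theta> * deriv F (circle_pt \<theta>))\<^sup>2)"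
      using d' by (simp add: power_mult_distrib)
    then show ?thesis
      using ode[of "circle_pt \<theta>"] by (simp add: slit_map_circle_pt slit_map_rho)
  qed
  obtain m where m: "(circle_val has_real_derivative m) (at (pi / 2))"
    using circle_val_has_deriv by blast
  \<comment> \<open>At pi/2 the value is 0 and the two brackets multiply to 1, which isolates
    c.\<close>
  have cm: "of_real (m\<^sup>2) = - c"
    using sq[OF m] slit_end_pos by (simp add: circle_val_half_pi)
  then have mnz: "m \<noteq> 0" using c by auto
  have sn_scale_eq: "sn_scale = \<bar>m\<bar> / slit_end"
    using m by (simp add: sn_scale_def DERIV_imp_deriv)
  have sn_scale: "(sn_scale * slit_end)\<^sup>2 = m\<^sup>2"
    using slit_end_pos by (simp add: sn_scale_eq)
  show "sn_scale > 0" using mnz slit_end_pos by (simp add: sn_scale_eq)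
  show "(d / slit_end)\<^sup>2 = sn_scale\<^sup>2 * ((1 - (circle_val \<theta> / slit_end)\<^sup>2) * (1 - (slit_end\<^sup>2)\<^sup>2 * (circle_val \<theta> / slit_end)\<^sup>2))"
    if d: "(circle_val has_real_derivative d) (at \<theta>)" for d \<theta>
  proof -
    define x where "x = circle_val \<theta> / slit_end"
    have s: "circle_val \<theta> = slit_end * x" using slit_end_pos by (simp add: x_def)
    have "complex_of_real (d\<^sup>2) = of_real (m\<^sup>2 * (((circle_val \<theta>)\<^sup>2 - slit_end\<^sup>2) * ((circle_val \<theta>)\<^sup>2 - 1 / slit_end\<^sup>2)))"
      using sq[OF d] cm by simp
    then have "d\<^sup>2 = m\<^sup>2 * (((circle_val \<theta>)\<^sup>2 - slit_end\<^sup>2) * ((circle_val \<theta>)\<^sup>2 - 1 / slit_end\<^sup>2))"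
      by (metis of_real_eq_iff)
    also have "((circle_val \<theta>)\<^sup>2 - slit_end\<^sup>2) * ((circle_val \<theta>)\<^sup>2 - 1 / slit_end\<^sup>2) = (1 - x\<^sup>2) * (1 - (slit_end\<^sup>2)\<^sup>2 * x\<^sup>2)"
      using slit_end_pos unfolding s by (simp add: field_simps power2_eq_square)
    finally show ?thesis
      unfolding x_def[symmetric] sn_scale_eq by (simp add: power_divide)
  qed
  show "(z * deriv F z)\<^sup>2 = - (of_real (sn_scale * slit_end))\<^sup>2 * ((F z)\<^sup>2 - (of_real slit_end)\<^sup>2) * ((F z)\<^sup>2 - 1 / (of_real slit_end)\<^sup>2)"
    if z: "z \<noteq> 0" "B z \<noteq> 0" for z
  proof -
    have "c = - (of_real (sn_scale * slit_end))\<^sup>2"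
      using cm sn_scale by (metis minus_minus of_real_power)
    then show ?thesis
      using ode[OF z] slit_map_rho by metis
  qed
qed

definition quarter :: real where
  "quarter = elliptic_F (slit_end\<^sup>2) 1"

text \<open>On [0, pi/2] the function x = \<open>circle_val\<close> / L decreases from 1 to 0. By
  the differential equation its inverse y has derivative - 1 / (M sqrt(...)), so - M y is a
  primitive of the elliptic integrand.\<close>

lemma elliptic_F_circle_val:
  assumes \<theta>: "0 \<le> \<theta>" "\<theta> \<le> pi / 2"
  shows "elliptic_F (slit_end\<^sup>2) (circle_val \<theta> / slit_end) = sn_scale * (pi / 2 - \<theta>)"
proof -
  note sn_scale = sn_scale_pos and ode = sn_ode
  define x where "x = (\<lambda>t. circle_val t / slit_end)"
  define y where "y = the_inv_into {0..pi/2} x"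
  have slit_end: "slit_end \<noteq> 0" using slit_end_pos by simp
  have anti: "x t < x s" if "0 \<le> s" "s < t" "t \<le> pi" for s t
    using circle_val_strict_antimono[OF that] slit_end_pos by (simp add: x_def divide_strict_right_mono)
  have ends: "x 0 = 1" "x (pi / 2) = 0"
    using slit_end by (auto simp: x_def circle_val_0 circle_val_half_pi)
  have contx: "isCont x t" for t
    unfolding x_def using slit_end by (intro continuous_intros isCont_circle_val)
  have inj: "inj_on x {0..pi/2}"
    using anti by (intro linorder_inj_onI) (auto, fastforce)
  have img: "x ` {0..pi/2} = {0..1}"
  proof (intro equalityI subsetI)
    fix v assume "v \<in> x ` {0..pi/2}"
    then obtain t where t: "v = x t" "0 \<le> t" "t \<le> pi / 2" by auto
    then show "v \<in> {0..1}"
      using anti[of 0 t] anti[of t "pi / 2"] ends by (cases "t = 0"; cases "t = pi / 2") auto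
  next
    fix v :: real assume v: "v \<in> {0..1}"
    have "\<exists>t. 0 \<le> t \<and> t \<le> pi / 2 \<and> x t = v"
      by (intro IVT2) (use v ends contx in auto)
    then show "v \<in> x ` {0..pi/2}" by auto
  qed
  have yx: "y (x t) = t" if "t \<in> {0..pi/2}" for t
    unfolding y_def using the_inv_into_f_f[OF inj that] .
  have xy: "x (y v) = v" if "v \<in> {0..1}" for v
    unfolding y_def using f_the_inv_into_f[OF inj] that img by blast
  have conty: "continuous_on {0..1} y"
    using continuous_on_inv[of "{0..pi/2}" x y] yx img contx
    by (simp add: continuous_at_imp_continuous_on)
  have yr: "y v \<in> {0..pi/2}" if "v \<in> {0..1}" for v
    using that img yx by (metis imageE)
  have y_open: "0 < y v \<and> y v < pi / 2" if "0 < v" "v < 1" for v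
    using yr[of v] xy[of v] ends that by (cases "y v = 0"; cases "y v = pi / 2") auto
  have dery: "(y has_real_derivative - 1 / (sn_scale * sqrt ((1 - v\<^sup>2) * (1 - (slit_end\<^sup>2)\<^sup>2 * v\<^sup>2)))) (at v)" if v: "0 < v" "v < 1" for v
  proof -
    obtain d where d: "(circle_val has_real_derivative d) (at (y v))"
      using circle_val_has_deriv by blast
    have dx: "(x has_real_derivative d / slit_end) (at (y v))"
      unfolding x_def by (rule DERIV_cdivide[OF d])
    have xv: "x (y v) = v" using xy v by simp
    have sq: "(d / slit_end)\<^sup>2 = sn_scale\<^sup>2 * ((1 - v\<^sup>2) * (1 - (slit_end\<^sup>2)\<^sup>2 * v\<^sup>2))"
      using ode[OF d] xv by (simp add: x_def)
    have "v\<^sup>2 < 1" using v by (simp add: power_less_one_iff)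
    moreover have "(slit_end\<^sup>2)\<^sup>2 < 1"
      using slit_end_pos slit_end_less_1 by (simp add: power_less_one_iff)
    then have "(slit_end\<^sup>2)\<^sup>2 * v\<^sup>2 < 1"
      using \<open>v\<^sup>2 < 1\<close> by (smt (verit) mult_le_one zero_le_power2 mult_less_cancel_right1 mult_left_le)
    ultimately have pos: "(1 - v\<^sup>2) * (1 - (slit_end\<^sup>2)\<^sup>2 * v\<^sup>2) > 0" by simp
    \<comment> \<open>The equation determines the derivative only up to sign; a positive one would
      contradict that x decreases.\<close>
    have "\<not> d / slit_end > 0"
    proof
      assume "d / slit_end > 0"
      from DERIV_pos_inc_right[OF dx this] obtain e where e: "e > 0" "\<And>h. h > 0 \<Longrightarrow> h < e \<Longrightarrow> x (y v) < x (y v + h)"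
        by auto
      define h where "h = min (e / 2) (pi / 2)"
      have "x (y v + h) < x (y v)"
        using y_open[OF v] e pi_gt_zero by (intro anti) (auto simp: h_def)
      moreover have "x (y v) < x (y v + h)"
        using e pi_gt_zero by (intro e(2)) (auto simp: h_def)
      ultimately show False by simp
    qed
    moreover have "\<bar>d / slit_end\<bar> = sn_scale * sqrt ((1 - v\<^sup>2) * (1 - (slit_end\<^sup>2)\<^sup>2 * v\<^sup>2))"
      using sq sn_scale by (metis abs_of_pos real_sqrt_abs real_sqrt_mult)
    ultimately have dval: "d / slit_end = - (sn_scale * sqrt ((1 - v\<^sup>2) * (1 - (slit_end\<^sup>2)\<^sup>2 * v\<^sup>2)))"
      by linarith
    have "(y has_real_derivative inverse (d / slit_end)) (at v)"
    proof (rule has_field_derivative_inverse_basic[where f = x and f' = "d / slit_end" and t = "{0<..<1}"])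
      show "(x has_real_derivative d / slit_end) (at (y v))" by (rule dx)
      show "d / slit_end \<noteq> 0"
        using dval mult_pos_pos[OF sn_scale real_sqrt_gt_zero[OF pos]] by linarith
      show "continuous (at v) y"
        using conty v by (intro continuous_on_interior[of "{0..1}"]) auto
    qed (use v xy in auto)
    then show ?thesis
      unfolding dval by (simp add: inverse_eq_divide)
  qed
  define X where "X = x \<theta>"
  have X: "X \<in> {0..1}" "y X = \<theta>"
    using img \<theta> yx by (auto simp: X_def)
  have "((\<lambda>t. 1 / sqrt ((1 - t\<^sup>2) * (1 - (slit_end\<^sup>2)\<^sup>2 * t\<^sup>2))) has_integral
      sn_scale * (pi / 2 - y X) - sn_scale * (pi / 2 - y 0)) {0..X}"
  \<comment> \<open>The integrand is unbounded at 1, so for X = 1 the derivative is available only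
    in the open interval.\<close>
  proof (rule fundamental_theorem_of_calculus_interior)
    show "continuous_on {0..X} (\<lambda>v. sn_scale * (pi / 2 - y v))"
      using X by (intro continuous_intros continuous_on_subset[OF conty]) auto
    fix v assume "v \<in> {0<..<X}"
    then have v: "0 < v" "v < 1" using X by auto
    have "((\<lambda>v. sn_scale * (pi / 2 - y v)) has_real_derivative
        sn_scale * (0 - - 1 / (sn_scale * sqrt ((1 - v\<^sup>2) * (1 - (slit_end\<^sup>2)\<^sup>2 * v\<^sup>2))))) (at v)"
      by (intro DERIV_cmult DERIV_diff dery[OF v] DERIV_const)
    then show "((\<lambda>v. sn_scale * (pi / 2 - y v)) has_vector_derivative
        1 / sqrt ((1 - v\<^sup>2) * (1 - (slit_end\<^sup>2)\<^sup>2 * v\<^sup>2))) (at v)"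
      using sn_scale by (simp add: has_real_derivative_iff_has_vector_derivative)
  qed (use X in auto)
  moreover have "y 0 = pi / 2"
    using yx[of "pi / 2"] ends by simp
  ultimately show ?thesis
    using X unfolding elliptic_F_def x_def[symmetric] by (simp add: X_def integral_unique x_def)
qed

lemma quarter_eq: "quarter = sn_scale * pi / 2"
  using elliptic_F_circle_val[of 0] slit_end_pos by (simp add: circle_val_0 quarter_def)

lemma quarter_pos: "quarter > 0"
  using sn_scale_pos by (simp add: quarter_eq)

text \<open>The exponent is the affine function of u that takes M (pi/2 - \<theta>) to i \<theta>.
  Real u in [0, K] thus run over a quarter of the circle |z| = rho, where F / L inverts the elliptic
  integral.\<close>

theorem jacobi_sn_eq:
  "jacobi_sn (slit_end\<^sup>2) = (\<lambda>u. F (r\<^sub>c * exp (- \<i> * of_real pi * (u - of_real quarter) / (2 * of_real quarter))) / of_real slit_end)"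
  (is "_ = ?S")
proof -
  note sn_scale = sn_scale_pos and K = quarter_eq and eF = elliptic_F_circle_val
  have slit_end: "slit_end \<noteq> 0" using slit_end_pos by simp
  have qnz: "complex_of_real quarter \<noteq> 0"
    using quarter_pos by simp
  define e where "e = (\<lambda>u. r\<^sub>c * exp (- \<i> * of_real pi * (u - of_real quarter) / (2 * of_real quarter)))"
  have he: "e holomorphic_on UNIV"
    unfolding e_def using qnz by (intro holomorphic_intros) auto
  have enz: "e u \<noteq> 0" for u
    by (simp add: e_def)
  have comp: "(\<lambda>u. g (e u)) holomorphic_on UNIV" if "g holomorphic_on - {0}" for g :: "complex \<Rightarrow> complex"
  proof -
    have "(g \<circ> e) holomorphic_on UNIV"
      by (intro holomorphic_on_compose he holomorphic_on_subset[OF that]) (use enz in auto)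
    then show ?thesis by (simp add: o_def)
  qed
  have hA: "(\<lambda>u. A (e u) / of_real slit_end) holomorphic_on UNIV" and hB: "(\<lambda>u. B (e u)) holomorphic_on UNIV"
    using slit_end by (auto intro!: holomorphic_intros comp slit_num_holomorphic slit_den_holomorphic)
  have e_theta: "e (of_real (sn_scale * (pi / 2 - \<theta>))) = circle_pt \<theta>" for \<theta>
  proof -
    have "- \<i> * of_real pi * (of_real (sn_scale * (pi / 2 - \<theta>)) - of_real quarter) / (2 * of_real quarter) = \<i> * of_real \<theta>"
    proof -
      have "sn_scale * (pi / 2 - \<theta>) - quarter = - (sn_scale * \<theta>)"
        by (simp add: K algebra_simps)
      then have "of_real (sn_scale * (pi / 2 - \<theta>)) - of_real quarter = - complex_of_real (sn_scale * \<theta>)"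
        by (metis of_real_diff of_real_minus)
      then show ?thesis
        using sn_scale by (simp add: K)
    qed
    then show ?thesis
      by (simp add: e_def circle_pt_def cis_conv_exp)
  qed
  have Sdef: "?S = (\<lambda>u. (A (e u) / of_real slit_end) / B (e u))"
    by (rule ext) (simp add: slit_map_def e_def)
  have nice: "?S nicely_meromorphic_on UNIV"
    unfolding Sdef
  proof (rule nicely_meromorphic_entire_quotient[OF hA hB])
    show "A (e u) / of_real slit_end \<noteq> 0" if "B (e u) = 0" for u
      using slit_den_nonzero[OF enz] that slit_end by auto
    show "B (e (of_real (sn_scale * (pi / 2 - 0)))) \<noteq> 0"
      unfolding e_theta by simp
  qed
  have val: "?S (of_real (elliptic_F (slit_end\<^sup>2) x)) = of_real x" if x: "x \<in> {0..1}" for x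
  proof -
    have "\<exists>t. 0 \<le> t \<and> t \<le> pi / 2 \<and> circle_val t = slit_end * x"
      by (intro IVT2) (use x slit_end_pos in \<open>auto simp: circle_val_0 circle_val_half_pi isCont_circle_val mult_left_le\<close>)
    then obtain t where t: "0 \<le> t" "t \<le> pi / 2" "circle_val t = slit_end * x" by auto
    have "elliptic_F (slit_end\<^sup>2) x = sn_scale * (pi / 2 - t)"
      using eF[OF t(1,2)] t(3) slit_end by simp
    then have "?S (of_real (elliptic_F (slit_end\<^sup>2) x)) = F (circle_pt t) / of_real slit_end"
      using e_theta[of t] by (simp add: e_def)
    then show ?thesis
      using t(3) slit_end by (simp add: slit_map_circle_pt)
  qed
  show ?thesis
    unfolding jacobi_sn_def
  proof (rule the_equality)
    show "?S nicely_meromorphic_on UNIV \<and> (\<forall>x\<in>{0..1}. ?S (of_real (elliptic_F (slit_end\<^sup>2) x)) = of_real x)"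
      using nice val by blast
    fix s assume s: "s nicely_meromorphic_on UNIV \<and> (\<forall>x\<in>{0..1}. s (of_real (elliptic_F (slit_end\<^sup>2) x)) = of_real x)"
    define u0 where "u0 = sn_scale * (pi / 4)"
    have agree: "s (of_real u) = ?S (of_real u)" if u: "0 \<le> u" "u \<le> sn_scale * (pi / 2)" for u
    proof -
      define t where "t = pi / 2 - u / sn_scale"
      have t: "0 \<le> t" "t \<le> pi / 2" "sn_scale * (pi / 2 - t) = u"
        using u sn_scale by (auto simp: t_def field_simps)
      have "circle_val (pi / 2) \<le> circle_val t" "circle_val t \<le> circle_val 0"
        using t pi_gt_zero by (auto intro!: circle_val_antimono)
      then have x: "circle_val t / slit_end \<in> {0..1}"
        using slit_end_pos by (auto simp: circle_val_0 circle_val_half_pi)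
      have "elliptic_F (slit_end\<^sup>2) (circle_val t / slit_end) = u"
        using eF[OF t(1,2)] t(3) by simp
      then show ?thesis
        using s val[OF x] x by metis
    qed
    have u0: "u0 > 0" "u0 < sn_scale * (pi / 2)"
      using sn_scale by (auto simp: u0_def)
    \<comment> \<open>Agreement on the segment [0, K] suffices, because \<open>u0\<close>, its
      midpoint, is an accumulation point.\<close>
    have "frequently (\<lambda>z. s z = ?S z) (at (of_real u0))"
      unfolding frequently_at dist_norm
    proof (intro allI impI)
      fix d :: real assume d: "d > 0"
      define u where "u = u0 - min (d / 2) (u0 / 2)"
      have "0 \<le> u" "u \<le> sn_scale * (pi / 2)" "u \<noteq> u0" "\<bar>u - u0\<bar> < d"
        using d u0 by (auto simp: u_def min_def)
      then show "\<exists>z\<in>UNIV. z \<noteq> complex_of_real u0 \<and> cmod (z - of_real u0) < d \<and> s z = ?S z"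
        using agree[of u] by (intro bexI[of _ "of_real u"]) (auto simp flip: of_real_diff)
    qed
    then show "s = ?S"
      by (rule nicely_meromorphic_eqI[OF conjunct1[OF s] nice])
  qed
qed

lemma slit_map_minus_1: "F (- 1) = - 1"
  using slit_map_minus[of 1] slit_map_1 by simp

text \<open>The differential equation at 1 gives the square of the derivative. For the sign: on
  [rho, 1] F is real and injective with F(rho) = L < 1 = F(1), so it cannot decrease towards 1.
  Oddness transfers the value to -1.\<close>

theorem deriv_slit_map_minus_1: "deriv F (- 1) = of_real (2 * quarter / pi * (1 - slit_end\<^sup>2))"
proof -
  note sn_scale = sn_scale_pos and ode2 = slit_map_ode_real
  have slit_end: "slit_end \<noteq> 0" using slit_end_pos by simp
  have M': "2 * quarter / pi = sn_scale"
    using quarter_eq by (simp add: field_simps)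
  define D where "D = deriv F 1"
  have DF: "(F has_field_derivative D) (at 1)"
    unfolding D_def DERIV_deriv_iff_field_differentiable
    by (rule slit_map_field_differentiable) (use slit_den_1 in auto)
  have "D\<^sup>2 = - (of_real (sn_scale * slit_end))\<^sup>2 * (1 - (of_real slit_end)\<^sup>2) * (1 - 1 / (of_real slit_end)\<^sup>2)"
    using ode2[of 1] slit_den_1 by (simp add: slit_map_1 D_def)
  also have "\<dots> = (of_real (sn_scale * (1 - slit_end\<^sup>2)))\<^sup>2"
    using slit_end by (simp add: field_simps power2_eq_square)
  finally have D2: "D\<^sup>2 = (of_real (sn_scale * (1 - slit_end\<^sup>2)))\<^sup>2" .
  have "((\<lambda>x. F (of_real x)) has_vector_derivative D) (at 1)"
    using has_vector_derivative_real_field[of F D 1] DF by simp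
  then have "((\<lambda>x. Re (F (of_real x))) has_vector_derivative Re D) (at 1)"
    by (rule bounded_linear.has_vector_derivative[OF bounded_linear_Re])
  then have Dg: "((\<lambda>x. Re (F (of_real x))) has_real_derivative Re D) (at 1)"
    by (simp add: has_real_derivative_iff_has_vector_derivative)
  define g where "g = (\<lambda>x. Re (F (of_real x)))"
  have gF: "F (of_real x) = of_real (g x)" for x
    using slit_map_of_real[of x] by (simp add: g_def complex_eq_iff)
  have Bx: "B (of_real x) \<noteq> 0" if "\<rho> \<le> x" "x \<le> 1" for x
  proof (rule slit_den_nonzero_norm)
    have "\<rho> powi 3 < \<rho> powi 1" "\<rho> powi 0 < \<rho> powi (-1)"
      unfolding powi_rho_less_iff by auto
    then show "\<rho> powi 3 < norm (complex_of_real x)" "norm (complex_of_real x) < \<rho> powi (-1)"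
      using that rho by auto
  qed
  have contg: "continuous_on {\<rho>..1} g"
  proof -
    have "continuous_on {\<rho>..1} (\<lambda>x. F (of_real x))"
    proof (rule continuous_at_imp_continuous_on, rule ballI)
      fix x assume "x \<in> {\<rho>..1}"
      then have "isCont F (of_real x)"
        using Bx[of x] rho by (intro field_differentiable_imp_continuous_at slit_map_field_differentiable) auto
      then show "isCont (\<lambda>x. F (of_real x)) x"
        by (rule isCont_o2[rotated]) (intro continuous_intros)
    qed
    then show ?thesis
      unfolding g_def by (intro continuous_intros)
  qed
  have injg: "inj_on g {\<rho>..1}"
  proof (rule inj_onI)
    fix x y assume xy: "x \<in> {\<rho>..1}" "y \<in> {\<rho>..1}" "g x = g y"
    then have pos: "x > 0" "y > 0" using rho by auto
    have "F (of_real x) = F (of_real y)"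
      by (simp add: gF xy)
    then consider (1) m :: int where "y = x * \<rho> powi (4 * m)" | (2) m :: int where "y * x = \<rho> powi (4 * m + 2)"
      using slit_map_eq_norm[of "of_real x" "of_real y"] Bx xy pos by auto
    then show "x = y"
    proof cases
      case 1
      have "\<rho> powi (4 * m) = y / x" using 1 pos by simp
      also have "\<dots> \<le> 1 / \<rho>" using xy rho pos by (intro frac_le) auto
      also have "\<dots> < \<rho> powi (-4)"
        using powi_rho_less_iff[of "-1" "-4"] by (simp add: power_int_minus inverse_eq_divide)
      finally have "m > -1" unfolding powi_rho_less_iff by simp
      have "\<rho> powi 4 < \<rho> / 1"
        using powi_rho_less_iff[of 4 1] by simp
      also have "\<dots> \<le> y / x" using xy rho pos by (intro frac_le) auto
      also have "\<dots> = \<rho> powi (4 * m)" using 1 pos by simp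
      finally have "m < 1" unfolding powi_rho_less_iff by simp
      with \<open>m > -1\<close> have "m = 0" by simp
      then show ?thesis using 1 by simp
    next
      case 2
      have "\<rho> * \<rho> \<le> y * x" using xy rho by (intro mult_mono) auto
      then have "\<rho> powi 3 < \<rho> powi (4 * m + 2)"
        using 2 powi_rho_less_iff[of 3 2] by (simp add: power2_eq_square)
      then have "m < 1" unfolding powi_rho_less_iff by simp
      have "y * x \<le> 1" using xy pos by (intro mult_le_one) auto
      then have "\<rho> powi (4 * m + 2) < \<rho> powi (-1)"
        using 2 powi_rho_less_iff[of 0 "-1"] by simp
      then have "m > -1" unfolding powi_rho_less_iff by simp
      then have "m = 0" using \<open>m < 1\<close> by simp
      then have yx: "y * x = \<rho> * \<rho>" using 2 by (simp add: power2_eq_square)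
      have "x \<le> \<rho>"
        using yx xy rho mult_left_mono[of \<rho> y x] pos by (smt (verit) atLeastAtMost_iff mult.commute mult_less_cancel_right mult_strict_mono')
      moreover have "y \<le> \<rho>"
        using yx xy rho pos by (smt (verit) atLeastAtMost_iff mult.commute mult_less_cancel_right mult_strict_mono')
      ultimately show ?thesis using xy by auto
    qed
  qed
  have g1: "g 1 = 1" "g \<rho> = slit_end"
    by (simp_all add: g_def slit_map_1 slit_map_rho)
  have "Re D \<ge> 0"
  proof (rule ccontr)
    assume "\<not> Re D \<ge> 0"
    then have "Re D < 0" by simp
    from DERIV_neg_dec_left[OF Dg[folded g_def] this]
    obtain e where e: "e > 0" "\<And>h. h > 0 \<Longrightarrow> h < e \<Longrightarrow> g 1 < g (1 - h)" by auto
    define h where "h = min (e / 2) ((1 - \<rho>) / 2)"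
    have h: "h > 0" "h < e" "\<rho> < 1 - h" "1 - h < 1"
      using e rho by (auto simp: h_def min_def field_simps)
    have "g \<rho> < g (1 - h) \<and> g (1 - h) < g 1 \<or> g 1 < g (1 - h) \<and> g (1 - h) < g \<rho>"
      by (rule continuous_inj_imp_mono[OF h(3,4) contg injg])
    then show False
      using e(2)[OF h(1,2)] g1 slit_end_less_1 by auto
  qed
  moreover have "sn_scale * (1 - slit_end\<^sup>2) > 0"
    using sn_scale slit_end_pos slit_end_less_1 by (simp add: power_less_one_iff)
  ultimately have "D = of_real (sn_scale * (1 - slit_end\<^sup>2))"
    using D2 by (smt (verit) Re_complex_of_real power2_eq_iff uminus_complex.simps(1))
  moreover have "deriv F (- 1) = D"
  proof (rule DERIV_imp_deriv)
    have "((\<lambda>z. - F (- z)) has_field_derivative - (D * (- 1))) (at (- 1))"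
      by (intro DERIV_minus DERIV_chain2[where f = F] ) (use DF in \<open>auto intro!: derivative_eq_intros\<close>)
    then show "(F has_field_derivative D) (at (- 1))"
      by (simp add: slit_map_minus)
  qed
  ultimately show ?thesis
    by (simp add: M')
qed

end

section \<open>Conformal maps of exterior domains\<close>

lemma eventually_notin_compact: "compact S \<Longrightarrow> eventually (\<lambda>z. z \<notin> S) at_infinity"
  for S :: "complex set"
proof -
  assume "compact S"
  then obtain b where "\<And>z. z \<in> S \<Longrightarrow> norm z \<le> b"
    using compact_imp_bounded bounded_iff by metis
  then show ?thesis
    unfolding eventually_at_infinity by (intro exI[of _ "b + 1"]) force
qed

lemma filterlim_at_infinity_of_quotient:
  fixes g :: "complex \<Rightarrow> complex"
  assumes "((\<lambda>z. g z / z) \<longlongrightarrow> c) at_infinity" "c \<noteq> 0"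
  shows "filterlim g at_infinity at_infinity"
proof -
  have "filterlim (\<lambda>z. (g z / z) * z) at_infinity at_infinity"
    by (rule tendsto_mult_filterlim_at_infinity[OF assms]) (rule filterlim_ident)
  moreover have "eventually (\<lambda>z. (g z / z) * z = g z) at_infinity"
    using eventually_not_equal_at_infinity[of 0] by eventually_elim simp
  ultimately show ?thesis
    by (subst (asm) filterlim_cong[OF refl refl])
qed

lemma Compl_Some_image: "UNIV - Some ` S = insert None (Some ` (- S))"
  by (auto, metis not_None_eq ComplI image_eqI)

text \<open>Both the map of the two intervals and the final map of the discs are instances, so the
  passage to the sphere, the expansion at infinity and the capacity are treated once.\<close>

locale exterior_map =
  fixes E :: "complex set" and \<phi> :: "complex \<Rightarrow> complex"
  assumes compact_E: "compact E"
    and holo: "\<phi> holomorphic_on - E"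
    and inj: "inj_on \<phi> (- E)"
    and lim: "((\<lambda>z. \<phi> z / z) \<longlongrightarrow> 1) at_infinity"
begin

lemma open_compl: "open (- E)"
  using compact_E compact_imp_closed by auto

text \<open>Here \<psi>(x) = x \<phi>(1/x), with value 1 at the singularity x = 0, which is
  removable because of \<open>lim\<close>. In the chart at infinity the map is x /
  \<psi>(x).\<close>

lemma coordinate_at_infinity:
  obtains e \<psi> where "e > 0" "\<psi> holomorphic_on ball 0 e" "\<psi> 0 = 1"
    "\<And>x. x \<in> ball 0 e \<Longrightarrow> \<psi> x \<noteq> 0"
    "\<And>x. x \<in> ball 0 e \<Longrightarrow> x \<noteq> 0 \<Longrightarrow> 1 / x \<notin> E"
    "\<And>x. x \<in> ball 0 e \<Longrightarrow> x \<noteq> 0 \<Longrightarrow> \<phi> (1 / x) = \<psi> x / x"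
proof -
  define \<psi> where "\<psi> = (\<lambda>x. if x = 0 then 1 else x * \<phi> (1 / x))"
  have "((\<lambda>x. \<phi> (inverse x) / inverse x) \<longlongrightarrow> 1) (at 0)"
    using lim unfolding lim_at_infinity_0 by (simp add: o_def)
  moreover have "eventually (\<lambda>x. \<phi> (inverse x) / inverse x = \<psi> x) (at 0)"
    by (auto simp: eventually_at_filter \<psi>_def field_simps)
  ultimately have l0: "(\<psi> \<longlongrightarrow> 1) (at 0)"
    by (rule Lim_transform_eventually)
  then have "eventually (\<lambda>x. \<psi> x \<noteq> 0) (at 0)"
    by (rule tendsto_imp_eventually_ne) simp
  then obtain e1 where e1: "e1 > 0" "\<And>x. norm x < e1 \<Longrightarrow> \<psi> x \<noteq> 0"
    unfolding eventually_at by (auto simp: \<psi>_def)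
  obtain b where b: "b > 0" "\<And>z. z \<in> E \<Longrightarrow> norm z \<le> b"
    using compact_imp_bounded[OF compact_E] bounded_pos by blast
  define e where "e = min e1 (1 / b)"
  have e: "e > 0" using e1 b by (simp add: e_def)
  have out: "1 / x \<notin> E" if "x \<in> ball 0 e" "x \<noteq> 0" for x
  proof
    assume "1 / x \<in> E"
    then have "1 / norm x \<le> b" using b(2) by (force simp: norm_divide)
    moreover have "norm x < 1 / b" using that by (simp add: e_def)
    ultimately show False using that b(1) by (simp add: field_simps)
  qed
  have "\<psi> holomorphic_on ball 0 e"
  proof (rule no_isolated_singularity'[of "{0}"])
    show "(\<psi> \<longlongrightarrow> \<psi> z) (at z within ball 0 e)" if "z \<in> {0}" for z
      using l0 that by (auto simp: \<psi>_def intro: tendsto_within_subset)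
    have "(\<phi> \<circ> (\<lambda>x. 1 / x)) holomorphic_on ball 0 e - {0}"
      by (intro holomorphic_on_compose holomorphic_intros holomorphic_on_subset[OF holo])
        (use out in auto)
    then have "(\<lambda>x. x * \<phi> (1 / x)) holomorphic_on ball 0 e - {0}"
      by (intro holomorphic_intros) (simp add: o_def)
    then show "\<psi> holomorphic_on ball 0 e - {0}"
      by (rule holomorphic_transform) (auto simp: \<psi>_def)
  qed auto
  then show ?thesis
    using e1 out e by (intro that[of e \<psi>]) (auto simp: e_def \<psi>_def)
qed

lemma filterlim_map: "filterlim \<phi> at_infinity at_infinity"
  by (rule filterlim_at_infinity_of_quotient[OF lim]) simp

text \<open>For odd \<phi> the function \<psi> is even, so \<psi>'(0) = 0. This removes the constant
  term of \<phi>(z) - z, about which \<open>lim\<close> says nothing.\<close>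

lemma odd_expansion:
  assumes sym: "\<And>z. z \<notin> E \<Longrightarrow> - z \<notin> E \<and> \<phi> (- z) = - \<phi> z"
  shows "(\<lambda>z. \<phi> z - z) \<in> O[at_infinity](\<lambda>z. 1 / z)"
proof -
  obtain e \<psi> where e: "e > 0" and \<psi>: "\<psi> holomorphic_on ball 0 e" "\<psi> 0 = 1"
    and out: "\<And>x. x \<in> ball 0 e \<Longrightarrow> x \<noteq> 0 \<Longrightarrow> 1 / x \<notin> E"
    and eq: "\<And>x. x \<in> ball 0 e \<Longrightarrow> x \<noteq> 0 \<Longrightarrow> \<phi> (1 / x) = \<psi> x / x"
    by (rule coordinate_at_infinity) blast
  have even: "\<psi> (- x) = \<psi> x" if "x \<in> ball 0 e" for x
  proof (cases "x = 0")
    case False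
    then show ?thesis
      using eq[of x] eq[of "- x"] sym[OF out[OF that False]] that by simp
  qed simp
  have d: "(\<psi> has_field_derivative deriv \<psi> 0) (at 0)"
    using \<psi> e by (intro holomorphic_derivI[of _ "ball 0 e"]) auto
  then have "((\<lambda>x. \<psi> (- x)) has_field_derivative deriv \<psi> 0 * (- 1)) (at 0)"
    by (intro DERIV_chain2[where f = \<psi>]) (auto intro!: derivative_eq_intros)
  then have "(\<psi> has_field_derivative deriv \<psi> 0 * (- 1)) (at 0)"
    by (rule has_field_derivative_transform_within_open[where S = "ball 0 e"]) (use e even in auto)
  then have "deriv \<psi> 0 * (- 1) = deriv \<psi> 0"
    using d DERIV_unique by blast
  then have d0: "deriv \<psi> 0 = 0" by simp
  define \<eta> where "\<eta> = (\<lambda>x. if x = 0 then deriv \<psi> 0 else (\<psi> x - \<psi> 0) / (x - 0))"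
  have "\<eta> holomorphic_on ball 0 e"
    unfolding \<eta>_def by (rule pole_lemma_open) (use \<psi> in auto)
  then have "(\<eta> has_field_derivative deriv \<eta> 0) (at 0)"
    using e by (intro holomorphic_derivI[of _ "ball 0 e"]) auto
  then have "((\<lambda>x. (\<eta> x - \<eta> 0) / (x - 0)) \<longlongrightarrow> deriv \<eta> 0) (at 0)"
    unfolding has_field_derivative_iff .
  then have "((\<lambda>x. \<eta> x / x) \<longlongrightarrow> deriv \<eta> 0) (at 0)"
    by (simp add: \<eta>_def d0)
  then have "((\<lambda>z. \<eta> (inverse z) / inverse z) \<longlongrightarrow> deriv \<eta> 0) at_infinity"
    unfolding lim_at_infinity_0 by (simp add: o_def)
  moreover have "eventually (\<lambda>z. \<eta> (inverse z) / inverse z = (\<phi> z - z) / (1 / z)) at_infinity"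
    unfolding eventually_at_infinity
  proof (intro exI allI impI)
    fix z :: complex assume z: "2 / e \<le> norm z"
    have "z \<noteq> 0" using z e by auto
    moreover have "2 \<le> e * norm z"
      using z e by (simp add: field_simps)
    then have "inverse z \<in> ball 0 e"
      using \<open>z \<noteq> 0\<close> by (simp add: norm_divide inverse_eq_divide pos_divide_less_eq)
    ultimately show "\<eta> (inverse z) / inverse z = (\<phi> z - z) / (1 / z)"
      using eq[of "inverse z"] by (simp add: \<eta>_def \<psi> field_simps)
  qed
  ultimately have "((\<lambda>z. (\<phi> z - z) / (1 / z)) \<longlongrightarrow> deriv \<eta> 0) at_infinity"
    by (rule Lim_transform_eventually)
  then show ?thesis
  proof (rule bigoI_tendsto)
    show "eventually (\<lambda>z. 1 / z \<noteq> (0 :: complex)) at_infinity"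
      using eventually_not_equal_at_infinity[of "0::complex"] by eventually_elim simp
  qed
qed

text \<open>At finite points an injective holomorphic map has nonzero derivative; at infinity the
  local expression x / \<psi>(x) has derivative 1.\<close>

lemma sphere_conformal:
  assumes \<Phi>: "\<Phi> None = None" "\<And>z. z \<notin> E \<Longrightarrow> \<Phi> (Some z) = Some (\<phi> z)"
  shows "sphere_conformal_on \<Phi> (UNIV - Some ` E)"
proof -
  note S = Compl_Some_image[of E]
  have opS: "openin sphere_top (UNIV - Some ` E)"
    unfolding S openin_Alexandroff_compactification
    using compact_E compact_imp_closed by (intro disjI2 exI[of _ E]) (auto simp: Compl_eq_Diff_UNIV)
  have cont: "continuous_map (subtopology sphere_top (UNIV - Some ` E)) sphere_top \<Phi>"
  proof -
    have "openin (subtopology sphere_top (UNIV - Some ` E)) {p \<in> UNIV - Some ` E. \<Phi> p \<in> U}"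
      if opU: "openin sphere_top U" for U
    proof -
      have "openin sphere_top {p \<in> UNIV - Some ` E. \<Phi> p \<in> U}"
      proof -
        consider (1) V where "open V" "U = Some ` V" | (2) C where "compact C" "U = insert None (Some ` (- C))"
          using opU unfolding openin_Alexandroff_compactification
          by (auto simp flip: Compl_eq_Diff_UNIV)
        then show ?thesis
        proof cases
          case 1
          have "{p \<in> UNIV - Some ` E. \<Phi> p \<in> U} = Some ` ((- E) \<inter> \<phi> -` V)"
            unfolding S 1 using \<Phi> by auto
          moreover have "open ((- E) \<inter> \<phi> -` V)"
            by (rule continuous_open_preimage[OF holomorphic_on_imp_continuous_on[OF holo] open_compl 1(1)])
          ultimately show ?thesis
            by simp
        next
          case 2
          \<comment> \<open>The preimage of a neighbourhood of infinity is the complement of E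
            together with the preimage of C. That union is compact: closed because \<phi> is
            continuous, bounded because \<phi> tends to infinity.\<close>
          have eq: "{p \<in> UNIV - Some ` E. \<Phi> p \<in> U} = insert None (Some ` (UNIV - (E \<union> {z \<in> - E. \<phi> z \<in> C})))"
            unfolding S 2 using \<Phi> by auto
          have "open ((- E) \<inter> \<phi> -` (- C))"
            using 2(1) compact_imp_closed
            by (intro continuous_open_preimage[OF holomorphic_on_imp_continuous_on[OF holo] open_compl]) auto
          moreover have "(- E) \<inter> \<phi> -` (- C) = - (E \<union> {z \<in> - E. \<phi> z \<in> C})"
            by auto
          ultimately have "closed (E \<union> {z \<in> - E. \<phi> z \<in> C})"
            by (simp add: closed_def)
          moreover have "bounded (E \<union> {z \<in> - E. \<phi> z \<in> C})"
          proof -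
            obtain b where b: "\<And>w. w \<in> C \<Longrightarrow> norm w \<le> b"
              using compact_imp_bounded[OF 2(1)] bounded_iff by blast
            have "eventually (\<lambda>z. \<bar>b\<bar> + 1 \<le> norm (\<phi> z)) at_infinity"
              using filterlim_map unfolding filterlim_at_infinity[OF order_refl] by (metis abs_ge_zero add_nonneg_pos zero_less_one)
            then obtain R where R: "\<And>z. norm z \<ge> R \<Longrightarrow> \<bar>b\<bar> + 1 \<le> norm (\<phi> z)"
              unfolding eventually_at_infinity by blast
            have "norm z \<le> R" if "\<phi> z \<in> C" for z
              using R[of z] b[OF that] by (smt (verit))
            then have "bounded {z \<in> - E. \<phi> z \<in> C}"
              unfolding bounded_iff by blast
            then show ?thesis
              using compact_imp_bounded[OF compact_E] by simp
          qed
          ultimately have "compact (E \<union> {z \<in> - E. \<phi> z \<in> C})"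
            by (simp add: compact_eq_bounded_closed)
          then show ?thesis
            unfolding eq openin_Alexandroff_compactification using compact_imp_closed by (intro disjI2) auto
        qed
      qed
      then show ?thesis
        using openin_open_subtopology[OF opS] by blast
    qed
    moreover have "topspace sphere_top = (UNIV :: sphere set)"
      by (simp add: UNIV_option_conv)
    ultimately show ?thesis
      unfolding continuous_map_def by simp
  qed
  have finite_part: "local_expr \<Phi> (Some z) analytic_on {local_coord (Some z)} \<and>
      deriv (local_expr \<Phi> (Some z)) (local_coord (Some z)) \<noteq> 0" if z: "z \<notin> E" for z
  proof -
    have lc: "local_coord (Some z) = z"
      by (simp add: local_coord_def sphere_chart_def)
    have ev: "eventually (\<lambda>x. local_expr \<Phi> (Some z) x = \<phi> x) (nhds z)"
      using eventually_nhds_in_open[OF open_compl, of z] z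
      by (auto elim!: eventually_mono simp: local_expr_def sphere_chart_def \<Phi>)
    have "\<phi> analytic_on {z}"
      using holo open_compl z by (meson ComplI analytic_at)
    moreover have "deriv \<phi> z \<noteq> 0"
      using holomorphic_injective_imp_regular[OF holo open_compl inj] z by blast
    ultimately show ?thesis
      unfolding lc using analytic_at_cong[OF ev] deriv_cong_ev[OF ev] by simp
  qed
  have infinite_part: "local_expr \<Phi> None analytic_on {local_coord None} \<and>
      deriv (local_expr \<Phi> None) (local_coord None) \<noteq> 0"
  proof -
    obtain e \<psi> where e: "e > 0" and \<psi>: "\<psi> holomorphic_on ball 0 e" "\<psi> 0 = 1"
      and nz: "\<And>x. x \<in> ball 0 e \<Longrightarrow> \<psi> x \<noteq> 0"
      and out: "\<And>x. x \<in> ball 0 e \<Longrightarrow> x \<noteq> 0 \<Longrightarrow> 1 / x \<notin> E"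
      and eq: "\<And>x. x \<in> ball 0 e \<Longrightarrow> x \<noteq> 0 \<Longrightarrow> \<phi> (1 / x) = \<psi> x / x"
      by (rule coordinate_at_infinity) blast
    have lc: "local_coord None = 0"
      by (simp add: local_coord_def sphere_chart_def sphere_inverse_def)
    have ev: "eventually (\<lambda>x. local_expr \<Phi> None x = x / \<psi> x) (nhds 0)"
    proof (rule eventually_mono)
      show "eventually (\<lambda>x. x \<in> ball 0 e) (nhds (0 :: complex))"
        using e by (intro eventually_nhds_in_open) auto
      fix x :: complex assume x: "x \<in> ball 0 e"
      then show "local_expr \<Phi> None x = x / \<psi> x"
        using out[OF x] nz[OF x] eq[OF x]
        by (auto simp: local_expr_def sphere_chart_def sphere_inverse_def \<Phi>)
    qed
    have h: "(\<lambda>x. x / \<psi> x) holomorphic_on ball 0 e"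
      using \<psi> nz by (intro holomorphic_intros) auto
    then have an: "(\<lambda>x. x / \<psi> x) analytic_on {0}"
      using e by (metis analytic_at centre_in_ball open_ball)
    have "(\<psi> has_field_derivative deriv \<psi> 0) (at 0)"
      using \<psi> e by (intro holomorphic_derivI[of _ "ball 0 e"]) auto
    then have "((\<lambda>x. x / \<psi> x) has_field_derivative 1) (at 0)"
      using \<psi> by (auto intro!: derivative_eq_intros)
    then have "deriv (\<lambda>x. x / \<psi> x) 0 = 1"
      by (rule DERIV_imp_deriv)
    then show ?thesis
      unfolding lc using analytic_at_cong[OF ev] deriv_cong_ev[OF ev] an by simp
  qed
  show ?thesis
    unfolding sphere_conformal_on_def
    using opS cont finite_part infinite_part by (auto simp: S)
qed

lemma is_lemniscatic_mapI:
  assumes \<Phi>: "\<Phi> None = None" "\<And>z. z \<notin> E \<Longrightarrow> \<Phi> (Some z) = Some (\<phi> z)"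
    and sym: "\<And>z. z \<notin> E \<Longrightarrow> - z \<notin> E \<and> \<phi> (- z) = - \<phi> z"
    and "walsh_union n E" "is_lemniscatic_domain n (insert None (Some ` (\<phi> ` (- E))))"
  shows "is_lemniscatic_map E \<Phi> (insert None (Some ` (\<phi> ` (- E))))"
proof -
  note S = Compl_Some_image[of E]
  have "bij_betw \<Phi> (UNIV - Some ` E) (insert None (Some ` (\<phi> ` (- E))))"
    unfolding S
    using inj \<Phi> by (auto simp: bij_betw_def inj_on_def image_iff)
  moreover have "(\<lambda>z. the (\<Phi> (Some z)) - z) \<in> O[at_infinity](\<lambda>z. 1 / z)"
  proof -
    have "eventually (\<lambda>z. the (\<Phi> (Some z)) - z = \<phi> z - z) at_infinity"
      using eventually_notin_compact[OF compact_E] by eventually_elim (simp add: \<Phi>)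
    then show ?thesis
      using odd_expansion[OF sym] by (subst landau_o.big.in_cong)
  qed
  ultimately show ?thesis
    unfolding is_lemniscatic_map_def
    using assms(4,5) sphere_conformal[OF \<Phi>] \<Phi>(1) by (intro conjI exI[of _ n])
qed

end

text \<open>In the plane the complement of a bounded convex set is connected. Infinity lies in its
  closure in the sphere, so adding it preserves connectedness.\<close>

lemma simply_connected_compact_convex:
  assumes "compact S" "convex S" "S \<noteq> {}"
  shows "simply_connected_compact S"
proof -
  note eq = Compl_Some_image[of S]
  have "connected (- S)"
    using assms by (intro connected_complement_bounded_convex compact_imp_bounded) auto
  then have "connectedin sphere_top (Some ` (- S))"
    by (intro connectedin_continuous_map_image[OF continuous_map_Some]) (simp add: connectedin_iff_connected)
  moreover have "None \<in> sphere_top closure_of (Some ` (- S))"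
    unfolding in_closure_of
  proof (intro conjI allI impI)
    fix T assume T: "None \<in> T \<and> openin sphere_top T"
    then obtain C where C: "compact C" "T = insert None (Some ` (UNIV - C))"
      unfolding openin_Alexandroff_compactification by auto
    have "bounded (C \<union> S)"
      using C assms by (simp add: compact_imp_bounded)
    then have "C \<union> S \<noteq> UNIV"
      using not_bounded_UNIV by metis
    then obtain z where "z \<notin> C \<union> S"
      by blast
    then show "\<exists>y. y \<in> Some ` (- S) \<and> y \<in> T"
      using C by auto
  qed simp
  moreover have "Some ` (- S) \<subseteq> sphere_top closure_of (Some ` (- S))"
    by (rule closure_of_subset) auto
  ultimately have "connectedin sphere_top (insert None (Some ` (- S)))"
    by (rule connectedin_intermediate_closure_of[OF _ subset_insertI insert_subsetI])
  then show ?thesis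
    unfolding simply_connected_compact_def eq using assms convex_connected by blast
qed

lemma walsh_union_two_convex:
  assumes "compact S" "convex S" "S \<noteq> {}" "\<And>z. S \<noteq> {z}"
    and "compact T" "convex T" "T \<noteq> {}" "\<And>z. T \<noteq> {z}" "S \<inter> T = {}"
  shows "walsh_union 2 (S \<union> T)"
  unfolding walsh_union_def
proof (intro exI[of _ "\<lambda>j::nat. if j = 0 then S else T"] conjI allI impI)
  show "S \<union> T = (\<Union>j<(2::nat). if j = 0 then S else T)"
    by (auto simp: numeral_2_eq_2 lessThan_Suc)
qed (use assms in \<open>auto simp: simply_connected_compact_convex\<close>)

text \<open>The two points are a and - a, each with exponent 1/2.\<close>

lemma is_lemniscatic_domain_two:
  assumes "a \<noteq> 0" "\<mu> > 0"
  shows "is_lemniscatic_domain 2 (insert None (Some ` {w. norm (w\<^sup>2 - a\<^sup>2) powr (1 / 2) > \<mu>}))"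
  unfolding is_lemniscatic_domain_def
proof (intro exI conjI)
  define b where "b = (\<lambda>j::nat. if j = 0 then a else - a)"
  show "inj_on b {..<2}"
    using assms by (auto simp: inj_on_def b_def)
  show "\<forall>j<2. (1 / 2 :: real) > 0" "(\<Sum>j<(2::nat). 1 / 2 :: real) = 1" "\<mu> > 0"
    using assms by auto
  have "(\<Prod>j<2. norm (w - b j) powr (1 / 2)) = norm (w\<^sup>2 - a\<^sup>2) powr (1 / 2)" for w
  proof -
    have "w\<^sup>2 - a\<^sup>2 = (w - a) * (w + a)"
      by (simp add: power2_eq_square algebra_simps)
    then show ?thesis
      by (simp add: numeral_2_eq_2 lessThan_Suc b_def norm_mult powr_mult)
  qed
  then show "insert None (Some ` {w. norm (w\<^sup>2 - a\<^sup>2) powr (1 / 2) > \<mu>}) =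
    insert None (Some ` {w. (\<Prod>j<2. norm (w - b j) powr (1 / 2)) > \<mu>})"
    by simp
qed

section \<open>Green's functions\<close>

text \<open>The gradient of ln |h| is (Re q, - Im q) for the logarithmic derivative q = h'/h; the
  Cauchy-Riemann equations for q make the Laplacian vanish.\<close>

lemma harmonic_on_ln_norm:
  assumes h: "h holomorphic_on U" and U: "open U" and nz: "\<And>z. z \<in> U \<Longrightarrow> h z \<noteq> 0"
    and g: "\<And>z. z \<in> U \<Longrightarrow> g z = c * ln (norm (h z)) + b"
  shows "harmonic_on g U"
proof -
  define q where "q = (\<lambda>z. deriv h z / h z)"
  have hq: "q holomorphic_on U"
    unfolding q_def using h U nz by (intro holomorphic_intros holomorphic_deriv)
  have hq': "deriv q holomorphic_on U"
    using hq U by (rule holomorphic_deriv)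
  have Dh: "(h has_derivative (\<lambda>t. deriv h z * t)) (at z)" if "z \<in> U" for z
    using holomorphic_derivI[OF h U that] by (simp add: has_field_derivative_def)
  have Dq: "(q has_derivative (\<lambda>t. deriv q z * t)) (at z)" if "z \<in> U" for z
    using holomorphic_derivI[OF hq U that] by (simp add: has_field_derivative_def)
  have Dg: "(g has_derivative (\<lambda>t. (c * Re (q z)) * Re t + (- c * Im (q z)) * Im t)) (at z)" if z: "z \<in> U" for z
  proof -
    have "((\<lambda>z. c * ln (norm (h z)) + b) has_derivative
       (\<lambda>t. c * ((h z \<bullet> (deriv h z * t)) / norm (h z) / norm (h z)))) (at z)"
    proof -
      have "((\<lambda>z. norm (h z)) has_derivative (\<lambda>t. (deriv h z * t) \<bullet> sgn (h z))) (at z)"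
        using has_derivative_compose[OF Dh[OF z] has_derivative_norm[OF nz[OF z]]] .
      moreover have "(deriv h z * t) \<bullet> sgn (h z) = (h z \<bullet> (deriv h z * t)) / norm (h z)" for t
        by (simp add: sgn_div_norm inner_commute divide_inverse_commute)
      ultimately have "((\<lambda>z. norm (h z)) has_derivative (\<lambda>t. (h z \<bullet> (deriv h z * t)) / norm (h z))) (at z)"
        by simp
      then show ?thesis
        using nz[OF z] by (auto intro!: derivative_eq_intros simp: divide_inverse mult_ac)
    qed
    moreover have "c * ((h z \<bullet> (deriv h z * t)) / norm (h z) / norm (h z)) = (c * Re (q z)) * Re t + (- c * Im (q z)) * Im t" for t
    proof -
      have "(h z \<bullet> (deriv h z * t)) / norm (h z) / norm (h z) = Re (q z * t)"
      proof -
        have "h z * cnj (h z) = of_real ((norm (h z))\<^sup>2)"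
          by (rule complex_norm_square[symmetric])
        then have "q z * t = (deriv h z * t) * cnj (h z) / of_real ((norm (h z))\<^sup>2)"
          unfolding q_def using nz[OF z] by (simp add: field_simps)
        then have "Re (q z * t) = Re ((deriv h z * t) * cnj (h z)) / (norm (h z))\<^sup>2"
          by (simp only: Re_divide_of_real)
        also have "Re ((deriv h z * t) * cnj (h z)) = h z \<bullet> (deriv h z * t)"
          by (simp add: inner_complex_def algebra_simps)
        finally show ?thesis by (simp add: power2_eq_square)
      qed
      then show ?thesis
        by (simp only:) (simp add: algebra_simps)
    qed
    ultimately have "((\<lambda>z. c * ln (norm (h z)) + b) has_derivative
       (\<lambda>t. (c * Re (q z)) * Re t + (- c * Im (q z)) * Im t)) (at z)"
      by simp
    then show ?thesis
      by (rule has_derivative_transform_within_open[OF _ U z]) (simp add: g)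
  qed
  have D1: "((\<lambda>z. c * Re (q z)) has_derivative (\<lambda>t. (c * Re (deriv q z)) * Re t + (- c * Im (deriv q z)) * Im t)) (at z)"
    and D2: "((\<lambda>z. - c * Im (q z)) has_derivative (\<lambda>t. (- c * Im (deriv q z)) * Re t + (- c * Re (deriv q z)) * Im t)) (at z)"
    if z: "z \<in> U" for z
    using has_derivative_mult_right[OF bounded_linear.has_derivative[OF bounded_linear_Re Dq[OF z]], of c]
      has_derivative_mult_right[OF bounded_linear.has_derivative[OF bounded_linear_Im Dq[OF z]], of "- c"]
    by (simp_all add: algebra_simps)
  have cont: "continuous_on U (\<lambda>z. c * Re (deriv q z))" "continuous_on U (\<lambda>z. - c * Im (deriv q z))"
    "continuous_on U (\<lambda>z. - c * Re (deriv q z))"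
    using holomorphic_on_imp_continuous_on[OF hq'] by (auto intro!: continuous_intros)
  show ?thesis
    unfolding harmonic_on_def
  proof (intro conjI exI ballI)
    fix z assume z: "z \<in> U"
    show "(g has_derivative (\<lambda>t. (c * Re (q z)) * Re t + (- c * Im (q z)) * Im t)) (at z)"
      by (rule Dg[OF z])
    show "((\<lambda>z. c * Re (q z)) has_derivative (\<lambda>t. (c * Re (deriv q z)) * Re t + (- c * Im (deriv q z)) * Im t)) (at z)"
      by (rule D1[OF z])
    show "((\<lambda>z. - c * Im (q z)) has_derivative (\<lambda>t. (- c * Im (deriv q z)) * Re t + (- c * Re (deriv q z)) * Im t)) (at z)"
      by (rule D2[OF z])
  qed (use U cont in auto)
qed

lemma harmonic_on_lincomb:
  assumes "harmonic_on f U" "harmonic_on g U"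
  shows "harmonic_on (\<lambda>z. f z + c * g z) U"
proof -
  obtain fx fy fxx fxy fyx fyy where U: "open U" and f:
     "\<forall>z\<in>U. (f has_derivative (\<lambda>h. fx z * Re h + fy z * Im h)) (at z) \<and>
               (fx has_derivative (\<lambda>h. fxx z * Re h + fxy z * Im h)) (at z) \<and>
               (fy has_derivative (\<lambda>h. fyx z * Re h + fyy z * Im h)) (at z) \<and>
               fxx z + fyy z = 0"
     "continuous_on U fxx" "continuous_on U fxy" "continuous_on U fyx" "continuous_on U fyy"
    using assms(1) unfolding harmonic_on_def by blast
  obtain gx gy gxx gxy gyx gyy where g:
     "\<forall>z\<in>U. (g has_derivative (\<lambda>h. gx z * Re h + gy z * Im h)) (at z) \<and>
               (gx has_derivative (\<lambda>h. gxx z * Re h + gxy z * Im h)) (at z) \<and>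
               (gy has_derivative (\<lambda>h. gyx z * Re h + gyy z * Im h)) (at z) \<and>
               gxx z + gyy z = 0"
     "continuous_on U gxx" "continuous_on U gxy" "continuous_on U gyx" "continuous_on U gyy"
    using assms(2) unfolding harmonic_on_def by blast
  have comb: "((\<lambda>z. u z + c * v z) has_derivative (\<lambda>h. (a1 + c * b1) * Re h + (a2 + c * b2) * Im h)) (at z)"
    if "(u has_derivative (\<lambda>h. a1 * Re h + a2 * Im h)) (at z)"
       "(v has_derivative (\<lambda>h. b1 * Re h + b2 * Im h)) (at z)" for u v :: "complex \<Rightarrow> real" and a1 a2 b1 b2 z
  proof -
    have "((\<lambda>z. u z + c * v z) has_derivative (\<lambda>h. (a1 * Re h + a2 * Im h) + c * (b1 * Re h + b2 * Im h))) (at z)"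
      by (intro has_derivative_add has_derivative_mult_right that)
    then show ?thesis
      by (simp add: algebra_simps)
  qed
  have lap: "(fxx z + c * gxx z) + (fyy z + c * gyy z) = 0" if "z \<in> U" for z
  proof -
    have "fyy z = - fxx z" "gyy z = - gxx z"
      using f(1) g(1) that by (simp_all add: eq_neg_iff_add_eq_0 add.commute)
    then show ?thesis by simp
  qed
  show ?thesis
    unfolding harmonic_on_def
  proof (intro conjI exI ballI)
    show "continuous_on U (\<lambda>z. fxx z + c * gxx z)" "continuous_on U (\<lambda>z. fxy z + c * gxy z)"
         "continuous_on U (\<lambda>z. fyx z + c * gyx z)" "continuous_on U (\<lambda>z. fyy z + c * gyy z)"
      using f g by (auto intro!: continuous_intros)
    fix z assume z: "z \<in> U"
    show "((\<lambda>z. f z + c * g z) has_derivative (\<lambda>h. (fx z + c * gx z) * Re h + (fy z + c * gy z) * Im h)) (at z)"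
      "((\<lambda>z. fx z + c * gx z) has_derivative (\<lambda>h. (fxx z + c * gxx z) * Re h + (fxy z + c * gxy z) * Im h)) (at z)"
      "((\<lambda>z. fy z + c * gy z) has_derivative (\<lambda>h. (fyx z + c * gyx z) * Re h + (fyy z + c * gyy z) * Im h)) (at z)"
      "(fxx z + c * gxx z) + (fyy z + c * gyy z) = 0"
      using f(1) g(1) z comb lap by blast+
  qed fact
qed

lemma harmonic_on_imp_continuous_on: "harmonic_on g U \<Longrightarrow> continuous_on U g"
  unfolding harmonic_on_def
  by (meson continuous_at_imp_continuous_on has_derivative_continuous)

text \<open>At a maximum p' vanishes, and s > 0 makes p' positive just to the right, so p would
  increase there.\<close>

lemma no_local_max_second_derivative:
  fixes p p' :: "real \<Rightarrow> real"
  assumes p: "\<And>t. \<bar>t\<bar> < e \<Longrightarrow> (p has_real_derivative p' t) (at t)"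
    and p': "(p' has_real_derivative s) (at 0)" "s > 0" and e: "e > 0"
    and max: "\<And>t. \<bar>t\<bar> < e \<Longrightarrow> p t \<le> p 0"
  shows False
proof -
  have "p' 0 = 0"
    by (rule DERIV_local_max[of p _ 0 e]) (use p max e in auto)
  then obtain d where d: "d > 0" "\<And>h. h > 0 \<Longrightarrow> h < d \<Longrightarrow> p' h > 0"
    using DERIV_pos_inc_right[OF p'] by auto
  define b where "b = min d e / 2"
  have b: "0 < b" "b < d" "b < e"
    using d e by (auto simp: b_def)
  have "p 0 < p b"
  proof (rule DERIV_pos_imp_increasing_open[OF b(1)])
    show "\<exists>y. (p has_real_derivative y) (at x) \<and> 0 < y" if "0 < x" "x < b" for x
      using p[of x] d(2)[of x] that b by auto
    show "continuous_on {0..b} p"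
      using p b by (intro continuous_at_imp_continuous_on ballI DERIV_isCont) force
  qed
  then show False
    using max[of b] b by auto
qed

text \<open>Perturbing by \<open>\<delta> |z|\<^sup>2\<close> makes the Laplacian positive, which rules out interior maxima.\<close>

lemma harmonic_maximum_principle:
  assumes h: "harmonic_on u U" and cpt: "\<And>\<epsilon>. \<epsilon> > 0 \<Longrightarrow> compact {z \<in> U. u z \<ge> \<epsilon>}"
    and z0: "z0 \<in> U"
  shows "u z0 \<le> 0"
proof (rule ccontr)
  assume "\<not> u z0 \<le> 0"
  define \<epsilon> where "\<epsilon> = u z0 / 2"
  have \<epsilon>: "\<epsilon> > 0" "u z0 = 2 * \<epsilon>"
    using \<open>\<not> u z0 \<le> 0\<close> by (auto simp: \<epsilon>_def)
  obtain gx gy gxx gxy gyx gyy where U: "open U" and D: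
     "\<And>z. z \<in> U \<Longrightarrow> (u has_derivative (\<lambda>h. gx z * Re h + gy z * Im h)) (at z)"
     "\<And>z. z \<in> U \<Longrightarrow> (gx has_derivative (\<lambda>h. gxx z * Re h + gxy z * Im h)) (at z)"
     "\<And>z. z \<in> U \<Longrightarrow> (gy has_derivative (\<lambda>h. gyx z * Re h + gyy z * Im h)) (at z)"
     "\<And>z. z \<in> U \<Longrightarrow> gxx z + gyy z = 0"
    using h unfolding harmonic_on_def by blast
  define S where "S = {z \<in> U. u z \<ge> \<epsilon>}"
  have S: "compact S" "z0 \<in> S"
    using cpt \<epsilon> z0 by (auto simp: S_def)
  have contu: "continuous_on U u"
    using h by (rule harmonic_on_imp_continuous_on)
  obtain r where r: "r > 0" "\<And>z. z \<in> S \<Longrightarrow> norm z \<le> r"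
    using compact_imp_bounded[OF S(1)] bounded_pos by blast
  \<comment> \<open>On S the perturbation stays below \<epsilon>. As the maximum of v is at least 2
    \<epsilon>, u exceeds \<epsilon> at the maximum point, which is therefore interior to S.\<close>
  define \<delta> where "\<delta> = \<epsilon> / (2 * r\<^sup>2)"
  have \<delta>: "\<delta> > 0" "\<delta> * r\<^sup>2 < \<epsilon>"
    using \<epsilon> r by (auto simp: \<delta>_def)
  define v where "v = (\<lambda>z. u z + \<delta> * ((Re z)\<^sup>2 + (Im z)\<^sup>2))"
  have "continuous_on S v"
    unfolding v_def using contu by (intro continuous_intros) (auto intro: continuous_on_subset simp: S_def)
  then obtain z1 where z1: "z1 \<in> S" "\<And>z. z \<in> S \<Longrightarrow> v z \<le> v z1"
    using continuous_attains_sup[OF S(1)] S(2) by blast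
  have z1U: "z1 \<in> U" using z1 by (simp add: S_def)
  have "2 * \<epsilon> \<le> v z0" using \<epsilon> \<delta> by (simp add: v_def)
  also have "\<dots> \<le> v z1" using z1 S by blast
  also have "\<dots> = u z1 + \<delta> * (norm z1)\<^sup>2"
    by (simp add: v_def cmod_power2)
  also have "\<dots> \<le> u z1 + \<delta> * r\<^sup>2"
    using \<delta> r z1 by (intro add_left_mono mult_left_mono power_mono) auto
  finally have "u z1 > \<epsilon>" using \<delta> by simp
  then have "open (U \<inter> u -` {\<epsilon><..})" "z1 \<in> U \<inter> u -` {\<epsilon><..}"
    using continuous_open_preimage[OF contu U] z1U by auto
  then obtain e where e: "e > 0" "ball z1 e \<subseteq> U \<inter> u -` {\<epsilon><..}"
    using open_contains_ball by blast
  have near: "v z \<le> v z1" "z \<in> U" if "dist z1 z < e" for z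
  proof -
    have "z \<in> U \<inter> u -` {\<epsilon><..}"
      using e that by (meson mem_ball subsetD)
    then show "v z \<le> v z1" "z \<in> U"
      using z1(2)[of z] by (auto simp: S_def)
  qed
  have chain: "((\<lambda>t. w (z1 + of_real t * d)) has_real_derivative (a * Re d + b * Im d)) (at t)"
    if "(w has_derivative (\<lambda>h. a * Re h + b * Im h)) (at (z1 + of_real t * d))" for w :: "complex \<Rightarrow> real" and a b t d
  proof -
    have 1: "((\<lambda>t. z1 + of_real t * d) has_derivative (\<lambda>s. of_real s * d)) (at t)"
      by (auto intro!: derivative_eq_intros)
    have "(w \<circ> (\<lambda>t. z1 + of_real t * d) has_derivative (\<lambda>h. a * Re h + b * Im h) \<circ> (\<lambda>s. of_real s * d)) (at t)"
      by (rule diff_chain_at[OF 1 that])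
    then show ?thesis
      unfolding has_field_derivative_def o_def by (rule has_derivative_eq_rhs) (auto simp: algebra_simps)
  qed
  \<comment> \<open>After adding 2 \<delta> to each, one of the two second derivatives is positive;
    v is then tested along the horizontal or the vertical line through \<open>z1\<close>.\<close>
  have "gxx z1 + gyy z1 = 0" using D(4) z1U .
  then consider "gxx z1 + 2 * \<delta> > 0" | "gyy z1 + 2 * \<delta> > 0"
    using \<delta> by linarith
  then show False
  proof cases
    case 1
    show False
    proof (rule no_local_max_second_derivative[of e "\<lambda>t. v (z1 + of_real t * 1)"
          "\<lambda>t. gx (z1 + of_real t * 1) + 2 * \<delta> * (Re z1 + t)"])
      fix t :: real assume t: "\<bar>t\<bar> < e"
      then have "z1 + of_real t * 1 \<in> U"
        by (intro near) (simp add: dist_norm)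
      from chain[OF D(1)[OF this]]
      show "((\<lambda>t. v (z1 + of_real t * 1)) has_real_derivative gx (z1 + of_real t * 1) + 2 * \<delta> * (Re z1 + t)) (at t)"
        unfolding v_def by (auto intro!: derivative_eq_intros simp: algebra_simps)
      show "v (z1 + of_real t * 1) \<le> v (z1 + of_real 0 * 1)"
        using near[of "z1 + of_real t * 1"] t by (simp add: dist_norm)
    next
      have "z1 + of_real 0 * 1 \<in> U" using z1U by simp
      from chain[OF D(2)[OF this]]
      show "((\<lambda>t. gx (z1 + of_real t * 1) + 2 * \<delta> * (Re z1 + t)) has_real_derivative gxx z1 + 2 * \<delta>) (at 0)"
        by (auto intro!: derivative_eq_intros)
    qed (use 1 e in auto)
  next
    case 2
    show False
    proof (rule no_local_max_second_derivative[of e "\<lambda>t. v (z1 + of_real t * \<i>)"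
          "\<lambda>t. gy (z1 + of_real t * \<i>) + 2 * \<delta> * (Im z1 + t)"])
      fix t :: real assume t: "\<bar>t\<bar> < e"
      then have "z1 + of_real t * \<i> \<in> U"
        by (intro near) (simp add: dist_norm norm_mult)
      from chain[OF D(1)[OF this]]
      show "((\<lambda>t. v (z1 + of_real t * \<i>)) has_real_derivative gy (z1 + of_real t * \<i>) + 2 * \<delta> * (Im z1 + t)) (at t)"
        unfolding v_def by (auto intro!: derivative_eq_intros simp: algebra_simps)
      show "v (z1 + of_real t * \<i>) \<le> v (z1 + of_real 0 * \<i>)"
        using near[of "z1 + of_real t * \<i>"] t by (simp add: dist_norm norm_mult)
    next
      have "z1 + of_real 0 * \<i> \<in> U" using z1U by simp
      from chain[OF D(3)[OF this]]
      show "((\<lambda>t. gy (z1 + of_real t * \<i>) + 2 * \<delta> * (Im z1 + t)) has_real_derivative gyy z1 + 2 * \<delta>) (at 0)"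
        by (auto intro!: derivative_eq_intros)
    qed (use 2 e in auto)
  qed
qed

text \<open>The maximum principle is applied to g - (1 + \<eta>) h. Near infinity g - h is bounded
  while \<eta> h grows like a logarithm, so the superlevel sets are compact and infinity never has
  to be treated as a point of the domain.\<close>

lemma green_function_diff_le:
  assumes E: "compact E" and g: "is_green_function E g" and h: "is_green_function E h"
    and z: "z \<in> - E" and "\<eta> > 0"
  shows "g z - h z \<le> \<eta> * h z"
proof -
  have bigo: "(\<lambda>z. g z - h z) \<in> O[at_infinity](\<lambda>_. 1)"
  proof -
    have "(\<lambda>z. (g z - ln (norm z)) - (h z - ln (norm z))) \<in> O[at_infinity](\<lambda>_. 1)"
      using g h unfolding is_green_function_def by (intro sum_in_bigo(2)[where f = "\<lambda>z. g z - ln (norm z)"]) auto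
    then show ?thesis by simp
  qed
  then obtain b where "eventually (\<lambda>z. norm (g z - h z) \<le> b * norm (1 :: real)) at_infinity"
    by (auto elim: landau_o.bigE)
  then have gh: "eventually (\<lambda>z. g z - h z \<le> b) at_infinity"
    by eventually_elim simp
  from h obtain b' where "eventually (\<lambda>z. norm (h z - ln (norm z)) \<le> b' * norm (1 :: real)) at_infinity"
    unfolding is_green_function_def by (auto elim: landau_o.bigE)
  then have hb: "eventually (\<lambda>z. h z \<ge> ln (norm z) - b') at_infinity"
    by eventually_elim (simp add: abs_le_iff)
  define u where "u = (\<lambda>z. (g z + (-1) * h z) + (- \<eta>) * h z)"
  have "harmonic_on u (- E)"
    unfolding u_def using g h by (intro harmonic_on_lincomb) (auto simp: is_green_function_def)
  moreover have "compact {z \<in> - E. u z \<ge> \<epsilon>}" if \<epsilon>: "\<epsilon> > 0" for \<epsilon>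
  proof -
    let ?S = "{z \<in> - E. u z \<ge> \<epsilon>}"
    have "eventually (\<lambda>z. z \<notin> ?S) at_infinity"
    proof -
      have "filterlim (\<lambda>z :: complex. ln (norm z)) at_top at_infinity"
        by (intro filterlim_compose[OF ln_at_top] filterlim_norm_at_top)
      then have "eventually (\<lambda>z :: complex. ln (norm z) > b' + b / \<eta>) at_infinity"
        by (simp add: filterlim_at_top_dense)
      with gh hb show ?thesis
      proof eventually_elim
        case (elim z)
        then have "h z > b / \<eta>" by linarith
        then have "\<eta> * h z > b" using \<open>\<eta> > 0\<close> by (simp add: field_simps)
        then show ?case using elim \<epsilon> by (auto simp: u_def)
      qed
    qed
    then obtain R where "\<And>z. norm z \<ge> R \<Longrightarrow> z \<notin> ?S"
      unfolding eventually_at_infinity by blast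
    then have "bounded ?S"
      unfolding bounded_iff by (metis linear)
    moreover have "closed ?S"
      unfolding closed_sequential_limits
    proof (intro allI impI, elim conjE)
      fix x l assume x: "\<forall>n. x n \<in> ?S" and l: "x \<longlonglongrightarrow> l"
      show "l \<in> ?S"
      proof (cases "l \<in> E")
        \<comment> \<open>A limit on E would be a frontier point, where u tends to 0 and not to
          something \<ge> \<epsilon>.\<close>
        case True
        have "l \<in> closure (- E)"
          using x l closure_sequential by blast
        then have fr: "l \<in> frontier E"
          using True compact_imp_closed[OF E] by (simp add: frontier_closures)
        then have "(u \<longlongrightarrow> (0 + (-1) * 0) + (- \<eta>) * 0) (at l within - E)"
          unfolding u_def using g h unfolding is_green_function_def by (intro tendsto_intros) auto
        moreover have "filterlim x (at l within - E) sequentially"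
          unfolding filterlim_at using x l True by (auto intro!: always_eventually)
        ultimately have "(\<lambda>n. u (x n)) \<longlonglongrightarrow> 0"
          using filterlim_compose by fastforce
        then have "\<epsilon> \<le> 0"
          using x by (intro LIMSEQ_le_const) auto
        then show ?thesis using \<epsilon> by simp
      next
        case False
        have "isCont u l"
          using harmonic_on_imp_continuous_on[OF \<open>harmonic_on u (- E)\<close>] False compact_imp_closed[OF E]
          by (simp add: continuous_on_eq_continuous_at open_Compl)
        then have "(\<lambda>n. u (x n)) \<longlonglongrightarrow> u l"
          using l isCont_tendsto_compose by blast
        then have "\<epsilon> \<le> u l"
          using x by (intro LIMSEQ_le_const) auto
        then show ?thesis using False by simp
      qed
    qed
    ultimately show ?thesis by (simp add: compact_eq_bounded_closed)
  qed
  ultimately have "u z \<le> 0"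
    using z by (rule harmonic_maximum_principle)
  then show ?thesis
    by (simp add: u_def algebra_simps)
qed

text \<open>Letting \<eta> tend to 0 in the comparison, in both directions, gives equality off E; on
  E both are 0.\<close>

lemma green_function_unique:
  assumes E: "compact E" and g: "is_green_function E g" and h: "is_green_function E h"
  shows "g = h"
proof
  have le: "f z \<le> k z" if f: "is_green_function E f" and k: "is_green_function E k" and "z \<in> - E" for f k z
  proof (rule field_le_epsilon)
    fix e :: real assume e: "e > 0"
    define \<eta> where "\<eta> = e / (\<bar>k z\<bar> + 1)"
    have \<eta>: "\<eta> > 0" using e by (simp add: \<eta>_def add_nonneg_pos)
    have "f z - k z \<le> \<eta> * k z"
      by (rule green_function_diff_le[OF E f k \<open>z \<in> - E\<close> \<eta>])
    also have "\<dots> \<le> \<eta> * (\<bar>k z\<bar> + 1)"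
      using \<eta> by (intro mult_left_mono) auto
    also have "\<dots> = e"
      by (simp add: \<eta>_def)
    finally show "f z \<le> k z + e" by simp
  qed
  fix z
  show "g z = h z"
    using le[OF g h] le[OF h g] g h
    by (cases "z \<in> E") (auto simp: is_green_function_def intro: antisym)
qed

section \<open>Green's function from the lemniscatic map\<close>

context exterior_map
begin

text \<open>By the open mapping theorem at infinity, all large values are already taken near
  infinity; by injectivity \<phi> stays bounded on the rest of the domain.\<close>

lemma map_bounded_near_compact:
  obtains R r where "\<And>z. z \<in> E \<Longrightarrow> norm z < r" "\<And>z. z \<notin> E \<Longrightarrow> norm z < r \<Longrightarrow> norm (\<phi> z) \<le> R"
proof -
  obtain e \<psi> where e: "e > 0" and \<psi>: "\<psi> holomorphic_on ball 0 e" "\<psi> 0 = 1"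
    and nz: "\<And>x. x \<in> ball 0 e \<Longrightarrow> \<psi> x \<noteq> 0"
    and out: "\<And>x. x \<in> ball 0 e \<Longrightarrow> x \<noteq> 0 \<Longrightarrow> 1 / x \<notin> E"
    and eq: "\<And>x. x \<in> ball 0 e \<Longrightarrow> x \<noteq> 0 \<Longrightarrow> \<phi> (1 / x) = \<psi> x / x"
    by (rule coordinate_at_infinity) blast
  define k where "k = (\<lambda>x. x / \<psi> x)"
  have hk: "k holomorphic_on ball 0 e"
    unfolding k_def using \<psi> nz by (intro holomorphic_intros) auto
  have "\<not> k constant_on ball 0 e"
  proof
    assume "k constant_on ball 0 e"
    moreover have "0 \<in> ball (0::complex) e" "of_real (e / 2) \<in> ball (0::complex) e"
      using e by auto
    ultimately have "k 0 = k (of_real (e / 2))"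
      unfolding constant_on_def by metis
    then show False
      using nz[of "of_real (e / 2)"] e by (simp add: k_def)
  qed
  then have "open (k ` ball 0 (e / 2))"
    using e by (intro open_mapping_thm[OF hk]) auto
  moreover have "0 \<in> k ` ball 0 (e / 2)"
    using e by (intro image_eqI[of _ _ 0]) (auto simp: k_def)
  ultimately obtain d where d: "d > 0" "ball 0 d \<subseteq> k ` ball 0 (e / 2)"
    using open_contains_ball by blast
  define r where "r = 2 / e"
  show ?thesis
  proof (rule that[of r "1 / d"])
    show "norm z < r" if "z \<in> E" for z
    proof (rule ccontr)
      assume "\<not> norm z < r"
      then have n: "norm z \<ge> 2 / e" by (simp add: r_def)
      then have "z \<noteq> 0" using e by auto
      have "2 \<le> e * norm z"
        using n e by (simp add: field_simps)
      then have "1 / z \<in> ball 0 e"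
        using \<open>z \<noteq> 0\<close> by (simp add: norm_divide pos_divide_less_eq)
      then show False
        using out[of "1 / z"] \<open>z \<noteq> 0\<close> that by simp
    qed
    show "norm (\<phi> z) \<le> 1 / d" if z: "z \<notin> E" "norm z < r" for z
    proof (rule ccontr)
      assume *: "\<not> norm (\<phi> z) \<le> 1 / d"
      moreover have "1 / d > 0" using d by simp
      ultimately have nz': "\<phi> z \<noteq> 0" by auto
      have "1 / \<phi> z \<in> ball 0 d"
        using * d nz' by (simp add: norm_divide field_simps)
      then obtain x where x: "x \<in> ball 0 (e / 2)" "k x = 1 / \<phi> z"
        using d by (metis imageE subsetD)
      then have x0: "x \<noteq> 0" using nz' by (auto simp: k_def)
      have xe: "x \<in> ball 0 e" using x e by auto
      have "\<phi> (1 / x) = 1 / k x"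
        using eq[OF xe x0] by (simp add: k_def)
      then have "\<phi> (1 / x) = \<phi> z"
        using x by simp
      then have "1 / x = z"
        using inj out[OF xe x0] z by (auto simp: inj_on_def)
      then have "x * z = 1" "z \<noteq> 0"
        using x0 by auto
      then have "norm x * norm z = 1"
        by (metis norm_mult norm_one)
      moreover have "2 * norm x * norm z < e * norm z"
        using x \<open>z \<noteq> 0\<close> by (intro mult_strict_right_mono) auto
      ultimately have "norm z > r"
        using e by (simp add: r_def field_simps)
      then show False using z by simp
    qed
  qed
qed

context
  fixes a :: complex and \<mu> :: real
  assumes \<mu>: "\<mu> > 0" and image: "\<phi> ` (- E) = {w. norm (w\<^sup>2 - a\<^sup>2) powr (1 / 2) > \<mu>}"
begin

definition green :: "complex \<Rightarrow> real" where
  "green z = (if z \<in> E then 0 else 1 / 2 * ln (norm ((\<phi> z)\<^sup>2 - a\<^sup>2)) + (- ln \<mu>))"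

lemma image_iff: "norm (w\<^sup>2 - a\<^sup>2) > \<mu>\<^sup>2 \<longleftrightarrow> w \<in> \<phi> ` (- E)"
proof -
  have "norm (w\<^sup>2 - a\<^sup>2) powr (1 / 2) = sqrt (norm (w\<^sup>2 - a\<^sup>2))"
    by (simp add: powr_half_sqrt)
  moreover have "\<mu> < sqrt x \<longleftrightarrow> \<mu>\<^sup>2 < x" for x
    using \<mu> by (metis less_eq_real_def real_less_rsqrt real_sqrt_abs real_sqrt_less_iff abs_of_pos)
  ultimately show ?thesis
    unfolding image by simp
qed

lemma green_asymptotics: "((\<lambda>z. green z - ln (norm z)) \<longlongrightarrow> - ln \<mu>) at_infinity"
proof -
  have "((\<lambda>z. a / z) \<longlongrightarrow> 0) at_infinity"
    by (intro tendsto_divide_0[OF tendsto_const] filterlim_ident)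
  then have "((\<lambda>z. norm ((\<phi> z / z)\<^sup>2 - (a / z)\<^sup>2)) \<longlongrightarrow> norm (1\<^sup>2 - 0\<^sup>2 :: complex)) at_infinity"
    by (intro tendsto_intros lim)
  then have "((\<lambda>z. 1 / 2 * ln (norm ((\<phi> z / z)\<^sup>2 - (a / z)\<^sup>2)) + (- ln \<mu>)) \<longlongrightarrow> 1 / 2 * ln 1 + (- ln \<mu>)) at_infinity"
    by (intro tendsto_intros) auto
  moreover have "eventually (\<lambda>z. 1 / 2 * ln (norm ((\<phi> z / z)\<^sup>2 - (a / z)\<^sup>2)) + (- ln \<mu>) = green z - ln (norm z)) at_infinity"
  proof -
    show ?thesis
      using eventually_notin_compact[OF compact_E] eventually_not_equal_at_infinity[of 0]
    proof eventually_elim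
      case (elim z)
      have "norm ((\<phi> z)\<^sup>2 - a\<^sup>2) > \<mu>\<^sup>2"
        using image_iff elim by blast
      moreover have "\<mu>\<^sup>2 > 0" using \<mu> by simp
      ultimately have pos: "norm ((\<phi> z)\<^sup>2 - a\<^sup>2) > 0" by linarith
      have "norm ((\<phi> z / z)\<^sup>2 - (a / z)\<^sup>2) = norm ((\<phi> z)\<^sup>2 - a\<^sup>2) / (norm z)\<^sup>2"
        by (simp add: power_divide norm_divide norm_power flip: diff_divide_distrib)
      then have "ln (norm ((\<phi> z / z)\<^sup>2 - (a / z)\<^sup>2)) = ln (norm ((\<phi> z)\<^sup>2 - a\<^sup>2)) - 2 * ln (norm z)"
        using elim pos by (simp add: ln_div ln_realpow)
      then show ?case
        using elim by (simp add: green_def)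
    qed
  qed
  ultimately show ?thesis
    by (subst (asm) tendsto_cong) auto
qed

text \<open>The image points with |w| \<le> R and level at least e above the boundary form a compact
  set C. Its preimage is compact in the complement of E, hence away from \<zeta>, while |\<phi>|
  \<le> R holds near E.\<close>

lemma green_boundary:
  assumes "\<zeta> \<in> E"
  shows "(green \<longlongrightarrow> 0) (at \<zeta> within - E)"
proof -
  obtain \<psi> where \<psi>: "\<psi> holomorphic_on \<phi> ` (- E)" "\<And>z. z \<in> - E \<Longrightarrow> \<psi> (\<phi> z) = z"
    using holomorphic_has_inverse[OF holo open_compl inj] by metis
  obtain R r where Rr: "\<And>z. z \<in> E \<Longrightarrow> norm z < r" "\<And>z. z \<notin> E \<Longrightarrow> norm z < r \<Longrightarrow> norm (\<phi> z) \<le> R"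
    by (rule map_bounded_near_compact) blast
  show ?thesis
  proof (rule tendstoI)
    fix e :: real assume e: "e > 0"
    define C where "C = {w. norm w \<le> R \<and> norm (w\<^sup>2 - a\<^sup>2) \<ge> \<mu>\<^sup>2 * exp (2 * e)}"
    have "closed C"
      unfolding C_def by (intro closed_Collect_conj closed_Collect_le continuous_intros)
    moreover have "bounded C"
      unfolding C_def bounded_iff by blast
    ultimately have "compact C"
      by (simp add: compact_eq_bounded_closed)
    have "C \<subseteq> \<phi> ` (- E)"
    proof
      fix w assume "w \<in> C"
      moreover have "\<mu>\<^sup>2 * 1 < \<mu>\<^sup>2 * exp (2 * e)"
        using \<mu> e by (intro mult_strict_left_mono) auto
      ultimately show "w \<in> \<phi> ` (- E)"
        by (subst image_iff[symmetric]) (auto simp: C_def)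
    qed
    then have "compact (\<psi> ` C)" "\<psi> ` C \<subseteq> - E"
      using \<open>compact C\<close> \<psi> by (auto intro!: compact_continuous_image holomorphic_on_imp_continuous_on
          intro: holomorphic_on_subset)
    then have "open (- \<psi> ` C \<inter> ball 0 r)" "\<zeta> \<in> - \<psi> ` C \<inter> ball 0 r"
      using assms Rr(1) compact_imp_closed by (blast intro: open_Int open_Compl open_ball, auto)
    then have "eventually (\<lambda>z. z \<in> - \<psi> ` C \<inter> ball 0 r) (at \<zeta> within - E)"
      unfolding eventually_at_topological by blast
    moreover have "eventually (\<lambda>z. z \<in> - E) (at \<zeta> within - E)"
      by (simp add: eventually_at_filter)
    ultimately show "eventually (\<lambda>z. dist (green z) 0 < e) (at \<zeta> within - E)"
    proof eventually_elim
      case (elim z)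
      have "\<phi> z \<notin> C"
        using elim \<psi>(2)[of z] by (auto intro: image_eqI[of z \<psi> "\<phi> z"])
      then have lt: "norm ((\<phi> z)\<^sup>2 - a\<^sup>2) < \<mu>\<^sup>2 * exp (2 * e)"
        using Rr(2)[of z] elim by (auto simp: C_def)
      have gt: "norm ((\<phi> z)\<^sup>2 - a\<^sup>2) > \<mu>\<^sup>2"
        using image_iff elim by blast
      have "\<mu>\<^sup>2 > 0" using \<mu> by simp
      then have pos: "norm ((\<phi> z)\<^sup>2 - a\<^sup>2) > 0" using gt by linarith
      have "ln (norm ((\<phi> z)\<^sup>2 - a\<^sup>2)) < ln (\<mu>\<^sup>2 * exp (2 * e))"
        using lt pos \<mu> by (subst ln_less_cancel_iff) auto
      also have "\<dots> = 2 * ln \<mu> + 2 * e"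
        using \<mu> by (simp add: ln_mult ln_realpow)
      finally have "green z < e"
        using elim by (simp add: green_def)
      have "ln (\<mu>\<^sup>2) < ln (norm ((\<phi> z)\<^sup>2 - a\<^sup>2))"
        using gt pos \<mu> by (subst ln_less_cancel_iff) auto
      then have "green z > 0"
        using elim \<mu> by (simp add: green_def ln_realpow)
      then show ?case
        using \<open>green z < e\<close> by simp
    qed
  qed
qed

lemma is_green_function_green: "is_green_function E green"
  unfolding is_green_function_def
proof (intro conjI ballI)
  have nz: "(\<phi> z)\<^sup>2 - a\<^sup>2 \<noteq> 0" if "z \<in> - E" for z
  proof
    assume "(\<phi> z)\<^sup>2 - a\<^sup>2 = 0"
    then show False
      using image_iff[of "\<phi> z"] that \<mu> by auto
  qed
  show "harmonic_on green (- E)"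
    by (rule harmonic_on_ln_norm[of "\<lambda>z. (\<phi> z)\<^sup>2 - a\<^sup>2" _ _ "1 / 2" "- ln \<mu>"])
      (use holo open_compl nz in \<open>auto intro!: holomorphic_intros simp: green_def\<close>)
  show "(\<lambda>z. green z - ln (norm z)) \<in> O[at_infinity](\<lambda>_. 1)"
    by (rule bigoI_tendsto[where c = "- ln \<mu>"]) (use green_asymptotics in auto)
  show "(green \<longlongrightarrow> 0) (at \<zeta> within - E)" if "\<zeta> \<in> frontier E" for \<zeta>
    using green_boundary that compact_imp_closed[OF compact_E] by (simp add: frontier_def)
qed (simp add: green_def)

text \<open>The constant term of the Green's function at infinity is - ln \<mu>.\<close>

lemma log_capacity_eq: "log_capacity E = \<mu>"
proof -
  have "green_function E = green"
    unfolding green_function_def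
    by (rule the_equality) (auto intro: is_green_function_green green_function_unique[OF compact_E])
  moreover have "((\<lambda>z. exp (- (green z - ln (norm z)))) \<longlongrightarrow> exp (- (- ln \<mu>))) at_infinity"
    by (intro tendsto_intros green_asymptotics)
  then have "((\<lambda>z. exp (ln (norm z) - green z)) \<longlongrightarrow> \<mu>) at_infinity"
    using \<mu> by simp
  ultimately show ?thesis
    unfolding log_capacity_def by (simp add: tendsto_Lim[OF trivial_limit_at_infinity])
qed

end

end

section \<open>The lemniscatic map of two intervals\<close>

definition joukowski :: "complex \<Rightarrow> complex" where
  "joukowski \<zeta> = (\<zeta> + 1 / \<zeta>) / 2"

lemma joukowski_holomorphic: "joukowski holomorphic_on {\<zeta>. norm \<zeta> > 1}"
  unfolding joukowski_def by (intro holomorphic_intros) auto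

lemma inj_joukowski: "inj_on joukowski {\<zeta>. norm \<zeta> > 1}"
proof (rule inj_onI)
  fix x y :: complex assume xy: "x \<in> {\<zeta>. norm \<zeta> > 1}" "y \<in> {\<zeta>. norm \<zeta> > 1}" "joukowski x = joukowski y"
  then have nz: "x \<noteq> 0" "y \<noteq> 0" by auto
  have "norm (x * y) > 1 * 1"
    unfolding norm_mult using xy by (intro mult_strict_mono) auto
  then have "x * y \<noteq> 1" by auto
  moreover have "x + 1 / x = y + 1 / y"
    using xy(3) unfolding joukowski_def by (simp only: divide_cancel_right) simp
  then have "(x - y) * (x * y - 1) = 0"
    using nz by (simp add: field_simps)
  ultimately show "x = y" by simp
qed

text \<open>The preimages of w are the roots of \<zeta>^2 - 2 w \<zeta> + 1, whose product is 1. If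
  they have modulus 1 they are conjugate, and w is real in [-1, 1]; otherwise one of them lies
  outside the unit circle.\<close>

lemma joukowski_image: "joukowski ` {\<zeta>. norm \<zeta> > 1} = - (of_real ` {-1..1})"
proof (intro equalityI subsetI)
  fix w assume "w \<in> joukowski ` {\<zeta>. norm \<zeta> > 1}"
  then obtain \<zeta> where \<zeta>: "norm \<zeta> > 1" "w = joukowski \<zeta>" by auto
  have "w \<noteq> of_real x" if x: "x \<in> {-1..1}" for x
  proof
    assume w: "w = of_real x"
    have "\<bar>x\<bar> \<le> 1" using x by auto
    then have "x\<^sup>2 \<le> 1" by (simp add: abs_square_le_1)
    define y where "y = sqrt (1 - x\<^sup>2)"
    have y: "y\<^sup>2 = 1 - x\<^sup>2" using \<open>x\<^sup>2 \<le> 1\<close> by (simp add: y_def)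
    have "\<zeta> \<noteq> 0" using \<zeta> by auto
    then have "\<zeta>\<^sup>2 - 2 * of_real x * \<zeta> + 1 = 0"
      using \<zeta>(2) w by (simp add: joukowski_def field_simps power2_eq_square)
    then have "(\<zeta> - of_real x)\<^sup>2 = - of_real (1 - x\<^sup>2)"
      by (simp add: power2_eq_square algebra_simps)
    also have "\<dots> = (\<i> * of_real y)\<^sup>2"
      using y by (simp add: power_mult_distrib flip: of_real_power)
    finally have "\<zeta> - of_real x = \<i> * of_real y \<or> \<zeta> - of_real x = - (\<i> * of_real y)"
      by (simp add: power2_eq_iff)
    then have "\<zeta> = Complex x y \<or> \<zeta> = Complex x (- y)"
      by (auto simp: complex_eq_iff algebra_simps)
    then have "norm \<zeta> = 1"
      using y by (auto simp: cmod_def)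
    then show False using \<zeta> by simp
  qed
  then show "w \<in> - (of_real ` {-1..1})" by blast
next
  fix w :: complex assume w: "w \<in> - (of_real ` {-1..1})"
  define \<zeta> \<eta> where "\<zeta> = w + csqrt (w\<^sup>2 - 1)" and "\<eta> = w - csqrt (w\<^sup>2 - 1)"
  have "\<zeta> * \<eta> = w\<^sup>2 - (csqrt (w\<^sup>2 - 1))\<^sup>2"
    by (simp add: \<zeta>_def \<eta>_def power2_eq_square algebra_simps)
  then have prod: "\<zeta> * \<eta> = 1" by simp
  then have nz: "\<zeta> \<noteq> 0" "\<eta> \<noteq> 0" by auto
  have sum: "\<zeta> + \<eta> = 2 * w" by (simp add: \<zeta>_def \<eta>_def)
  have eta: "\<eta> = 1 / \<zeta>" using prod nz by (simp add: field_simps)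
  have J: "joukowski \<zeta> = w" "joukowski \<eta> = w"
    using sum nz by (simp_all add: joukowski_def eta add.commute)
  have "norm \<zeta> \<noteq> 1"
  proof
    assume n: "norm \<zeta> = 1"
    then have "\<eta> = cnj \<zeta>"
      using eta complex_div_cnj[of 1 \<zeta>] by simp
    then have "2 * w = of_real (2 * Re \<zeta>)"
      using sum by (simp add: complex_eq_iff)
    then have "w = of_real (Re \<zeta>)"
      by (simp add: complex_eq_iff)
    moreover have "\<bar>Re \<zeta>\<bar> \<le> 1"
      using abs_Re_le_cmod[of \<zeta>] n by simp
    ultimately show False using w by (auto simp: abs_le_iff)
  qed
  moreover have "norm \<zeta> * norm \<eta> = 1"
    using prod by (metis norm_mult norm_one)
  ultimately have "norm \<zeta> > 1 \<or> norm \<eta> > 1"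
    by (smt (verit) mult_le_one mult_less_cancel_left2 norm_ge_zero mult_left_le)
  then show "w \<in> joukowski ` {\<zeta>. norm \<zeta> > 1}"
    using J by (metis (mono_tags, lifting) image_eqI mem_Collect_eq)
qed

definition inv_joukowski :: "complex \<Rightarrow> complex" where
  "inv_joukowski = the_inv_into {\<zeta>. norm \<zeta> > 1} joukowski"

lemma inv_joukowski_joukowski: "norm \<zeta> > 1 \<Longrightarrow> inv_joukowski (joukowski \<zeta>) = \<zeta>"
  unfolding inv_joukowski_def by (rule the_inv_into_f_f[OF inj_joukowski]) simp

lemma
  assumes "w \<notin> of_real ` {-1..1}"
  shows joukowski_inv_joukowski: "joukowski (inv_joukowski w) = w"
    and norm_inv_joukowski: "norm (inv_joukowski w) > 1"
proof -
  obtain \<zeta> where "norm \<zeta> > 1" "w = joukowski \<zeta>"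
    using assms joukowski_image by (metis (no_types, lifting) ComplI imageE mem_Collect_eq)
  then show "joukowski (inv_joukowski w) = w" "norm (inv_joukowski w) > 1"
    using inv_joukowski_joukowski by auto
qed

lemma inv_joukowski_holomorphic: "inv_joukowski holomorphic_on - (of_real ` {-1..1})"
proof -
  have op: "open {\<zeta> :: complex. norm \<zeta> > 1}"
    by (intro open_Collect_less continuous_intros)
  obtain g where g: "g holomorphic_on joukowski ` {\<zeta>. norm \<zeta> > 1}"
      "\<And>z. z \<in> {\<zeta>. norm \<zeta> > 1} \<Longrightarrow> g (joukowski z) = z"
    using holomorphic_has_inverse[OF joukowski_holomorphic op inj_joukowski] by metis
  have "g w = inv_joukowski w" if "w \<in> joukowski ` {\<zeta>. norm \<zeta> > 1}" for w
    using that g(2) inv_joukowski_joukowski by auto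
  then show ?thesis
    using holomorphic_transform[OF g(1)] joukowski_image by metis
qed

text \<open>Because 1/|\<zeta>| \<le> |\<zeta>|. It serves to show that the exterior coordinate
  tends to infinity.\<close>

lemma norm_le_norm_inv_joukowski:
  assumes "w \<notin> of_real ` {-1..1}"
  shows "norm w \<le> norm (inv_joukowski w)"
proof -
  let ?\<zeta> = "inv_joukowski w"
  have n: "norm ?\<zeta> > 1" by (rule norm_inv_joukowski[OF assms])
  have "norm w = norm (?\<zeta> + 1 / ?\<zeta>) / 2"
    using joukowski_inv_joukowski[OF assms] by (simp add: joukowski_def norm_divide flip: norm_divide)
  also have "\<dots> \<le> (norm ?\<zeta> + norm (1 / ?\<zeta>)) / 2"
    by (intro divide_right_mono norm_triangle_ineq) auto
  also have "norm (1 / ?\<zeta>) \<le> norm ?\<zeta>"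
    using n by (simp add: norm_divide divide_le_eq) (smt (verit) mult_less_cancel_left2)
  finally show ?thesis by simp
qed

section \<open>Reduction to one interval by squaring\<close>

locale two_intervals =
  fixes C D :: real
  assumes CD: "0 < C" "C < D"
begin

definition intervals :: "complex set" where
  "intervals = of_real ` ({- D..- C} \<union> {C..D})"

definition halfwidth :: real where "halfwidth = (D\<^sup>2 - C\<^sup>2) / 2"
definition midpoint :: real where "midpoint = (D\<^sup>2 + C\<^sup>2) / 2"
text \<open>Chosen so that - \<kappa> and - 1/\<kappa> are the two solutions \<zeta> belonging to
  z^2 = 0; the one outside the unit disc, - 1/\<kappa>, is the exterior coordinate of 0.\<close>

definition \<kappa> :: real where "\<kappa> = (D - C) / (D + C)"

definition outer_coord :: "complex \<Rightarrow> complex" where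
  "outer_coord z = inv_joukowski ((z\<^sup>2 - of_real midpoint) / of_real halfwidth)"

text \<open>The radicand of \<open>\<Phi>\<^sub>1\<close> simplifies to \<open>1 / (1 + \<kappa> / \<zeta>)\<close>, where \<open>\<zeta>\<close> is the exterior coordinate and
  \<open>\<kappa> < 1 < |\<zeta>|\<close>; so it has positive real part, also near \<open>z = 0\<close>.\<close>

definition lem_map :: "complex \<Rightarrow> complex" where
  "lem_map z = z * csqrt (1 / (1 + of_real \<kappa> / outer_coord z))"

lemma halfwidth_pos: "halfwidth > 0"
  using CD by (simp add: halfwidth_def power_strict_mono)

lemma kappa: "0 < \<kappa>" "\<kappa> < 1"
  using CD by (auto simp: \<kappa>_def)

lemma halfwidth_over_kappa: "halfwidth / \<kappa> = (C + D)\<^sup>2 / 2"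
  and halfwidth_kappa: "halfwidth * (\<kappa> + 1 / \<kappa>) = 2 * midpoint"
proof -
  have "halfwidth = (D - C) * (D + C) / 2" by (simp add: halfwidth_def power2_eq_square algebra_simps)
  have quot: "d * s / 2 / (d / s) = s\<^sup>2 / 2" "d * s / 2 * (d / s) = d\<^sup>2 / 2" if "d \<noteq> 0" "s \<noteq> 0" for d s :: real
    using that by (simp_all add: power2_eq_square)
  show "halfwidth / \<kappa> = (C + D)\<^sup>2 / 2"
    unfolding \<open>halfwidth = _\<close> \<kappa>_def using quot(1)[of "D - C" "D + C"] CD by (simp add: add.commute)
  have "halfwidth * \<kappa> = (D - C)\<^sup>2 / 2"
    unfolding \<open>halfwidth = _\<close> \<kappa>_def using quot(2)[of "D - C" "D + C"] CD by simp
  then show "halfwidth * (\<kappa> + 1 / \<kappa>) = 2 * midpoint"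
    using \<open>halfwidth / \<kappa> = _\<close> by (simp add: distrib_left midpoint_def power2_eq_square algebra_simps)
qed

lemma not_interval_iff: "z \<notin> intervals \<longleftrightarrow> (z\<^sup>2 - of_real midpoint) / of_real halfwidth \<notin> of_real ` {-1..1}"
proof -
  have "z \<in> intervals \<longleftrightarrow> (z\<^sup>2 - of_real midpoint) / of_real halfwidth \<in> of_real ` {-1..1}"
  proof
    assume "z \<in> intervals"
    then obtain t where t: "z = of_real t" "t \<in> {- D..- C} \<union> {C..D}"
      by (auto simp: intervals_def)
    then have "C \<le> \<bar>t\<bar>" "\<bar>t\<bar> \<le> D" using CD by auto
    then have "C\<^sup>2 \<le> t\<^sup>2" "t\<^sup>2 \<le> D\<^sup>2"
      using CD by (auto simp: abs_le_square_iff[symmetric])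
    then have "(t\<^sup>2 - midpoint) / halfwidth \<in> {-1..1}"
      using halfwidth_pos by (auto simp: field_simps halfwidth_def midpoint_def)
    moreover have "(z\<^sup>2 - of_real midpoint) / of_real halfwidth = of_real ((t\<^sup>2 - midpoint) / halfwidth)"
      by (simp add: t)
    ultimately show "(z\<^sup>2 - of_real midpoint) / of_real halfwidth \<in> of_real ` {-1..1}"
      by blast
  next
    assume "(z\<^sup>2 - of_real midpoint) / of_real halfwidth \<in> of_real ` {-1..1}"
    then obtain x where x: "x \<in> {-1..1}" "(z\<^sup>2 - of_real midpoint) / of_real halfwidth = of_real x" by auto
    then have "z\<^sup>2 = of_real (halfwidth * x + midpoint)"
      using halfwidth_pos by (simp add: field_simps)
    moreover have b: "C\<^sup>2 \<le> halfwidth * x + midpoint" "halfwidth * x + midpoint \<le> D\<^sup>2"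
    proof -
      have "halfwidth * (-1) \<le> halfwidth * x" "halfwidth * x \<le> halfwidth * 1"
        using x halfwidth_pos mult_left_mono[of "-1" x halfwidth] mult_left_mono[of x 1 halfwidth] by auto
      then show "C\<^sup>2 \<le> halfwidth * x + midpoint" "halfwidth * x + midpoint \<le> D\<^sup>2"
        by (auto simp: halfwidth_def midpoint_def field_simps)
    qed
    define s where "s = sqrt (halfwidth * x + midpoint)"
    have "0 \<le> halfwidth * x + midpoint" using b(1) by (smt (verit) zero_le_power2)
    then have s: "s\<^sup>2 = halfwidth * x + midpoint" by (simp add: s_def)
    have "C \<le> s" "s \<le> D"
      using b CD by (auto simp: s_def intro: real_le_rsqrt real_le_lsqrt)
    have "z\<^sup>2 = (of_real s)\<^sup>2"
      using \<open>z\<^sup>2 = _\<close> s by (metis of_real_power)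
    then have "z = of_real s \<or> z = of_real (- s)"
      by (simp add: power2_eq_iff)
    then show "z \<in> intervals"
      using \<open>C \<le> s\<close> \<open>s \<le> D\<close> unfolding intervals_def by auto
  qed
  then show ?thesis by blast
qed

lemma norm_outer_coord: "z \<notin> intervals \<Longrightarrow> norm (outer_coord z) > 1"
  unfolding outer_coord_def by (rule norm_inv_joukowski) (simp add: not_interval_iff)

text \<open>The Joukowski relation is quadratic in \<zeta>; \<open>halfwidth_kappa\<close> gives its
  factorisation with the roots of the numerator at - \<kappa> and - 1/\<kappa>.\<close>

lemma square_eq_outer_coord:
  assumes "z \<notin> intervals"
  shows "z\<^sup>2 = of_real (halfwidth / 2) * (outer_coord z + of_real \<kappa>) * (outer_coord z + of_real (1 / \<kappa>)) / outer_coord z"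
proof -
  have nz: "outer_coord z \<noteq> 0" using norm_outer_coord[OF assms] by auto
  have "joukowski (outer_coord z) = (z\<^sup>2 - of_real midpoint) / of_real halfwidth"
    unfolding outer_coord_def by (rule joukowski_inv_joukowski) (use assms not_interval_iff in blast)
  then have "z\<^sup>2 = of_real (halfwidth / 2) * (outer_coord z + 1 / outer_coord z) + of_real midpoint"
    using halfwidth_pos by (simp add: joukowski_def field_simps)
  also have "of_real midpoint = (of_real (halfwidth / 2 * (\<kappa> + 1 / \<kappa>)) :: complex)"
    using halfwidth_kappa by simp
  also have "of_real (halfwidth / 2) * (outer_coord z + 1 / outer_coord z) + of_real (halfwidth / 2 * (\<kappa> + 1 / \<kappa>)) =
     of_real (halfwidth / 2) * (outer_coord z + of_real \<kappa>) * (outer_coord z + of_real (1 / \<kappa>)) / outer_coord z"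
  proof -
    have "complex_of_real \<kappa> * of_real (1 / \<kappa>) = 1"
      using kappa by simp
    then have "(outer_coord z + of_real \<kappa>) * (outer_coord z + of_real (1 / \<kappa>)) = outer_coord z * (outer_coord z + of_real (\<kappa> + 1 / \<kappa>)) + 1"
      by (simp add: algebra_simps)
    then show ?thesis
      using nz kappa by (simp add: mult.assoc add_divide_distrib distrib_left)
  qed
  finally show ?thesis .
qed

lemma factor_nonzero:
  assumes "z \<notin> intervals"
  shows "outer_coord z \<noteq> 0" "outer_coord z + of_real \<kappa> \<noteq> 0" "Re (1 + of_real \<kappa> / outer_coord z) > 0" "1 + of_real \<kappa> / outer_coord z \<noteq> 0"
proof -
  show nz: "outer_coord z \<noteq> 0" using norm_outer_coord[OF assms] by auto
  have "norm (complex_of_real \<kappa> / outer_coord z) < 1"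
    using norm_outer_coord[OF assms] kappa by (simp add: norm_divide divide_less_eq)
  then have "Re (complex_of_real \<kappa> / outer_coord z) > -1"
    using abs_Re_le_cmod[of "complex_of_real \<kappa> / outer_coord z"] by linarith
  then show re: "Re (1 + of_real \<kappa> / outer_coord z) > 0" by simp
  then show "1 + of_real \<kappa> / outer_coord z \<noteq> 0"
    by (metis less_irrefl zero_complex.simps(1))
  show "outer_coord z + of_real \<kappa> \<noteq> 0"
  proof
    assume "outer_coord z + of_real \<kappa> = 0"
    then have "of_real \<kappa> = - outer_coord z" by (simp add: eq_neg_iff_add_eq_0 add.commute)
    then have "norm (outer_coord z) = \<kappa>" using kappa by (metis abs_of_pos norm_minus_cancel norm_of_real)
    then show False using norm_outer_coord[OF assms] kappa by simp
  qed
qed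

text \<open>The radicand is \<zeta> / (\<zeta> + \<kappa>). It cancels one linear factor and the
  denominator of z^2 and leaves an affine function of \<zeta>.\<close>

lemma lem_map_square:
  assumes "z \<notin> intervals"
  shows "(lem_map z)\<^sup>2 = (of_real ((C + D) / 2))\<^sup>2 + of_real (halfwidth / 2) * outer_coord z"
proof -
  note nz = factor_nonzero[OF assms]
  have "(lem_map z)\<^sup>2 = z\<^sup>2 * (1 / (1 + of_real \<kappa> / outer_coord z))"
    by (simp add: lem_map_def power_mult_distrib)
  also have "\<dots> = of_real (halfwidth / 2) * (outer_coord z + of_real (1 / \<kappa>))"
  proof -
    have "1 / (1 + of_real \<kappa> / outer_coord z) = outer_coord z / (outer_coord z + of_real \<kappa>)"
      using nz by (simp add: field_simps)
    moreover have "a * s * b / e * (e / s) = a * b" if "e \<noteq> 0" "s \<noteq> 0" for a b e s :: complex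
      using that by simp
    ultimately show ?thesis
      unfolding square_eq_outer_coord[OF assms] using nz(1,2) by (simp only:)
  qed
  also have "\<dots> = of_real (halfwidth / \<kappa> / 2) + of_real (halfwidth / 2) * outer_coord z"
    by (simp add: algebra_simps)
  finally show ?thesis
    unfolding halfwidth_over_kappa by (simp add: power_divide)
qed

text \<open>For a candidate s the number whose modulus must exceed 1 is (z^2 - midpoint + s) /
  halfwidth. The equation for s says that its Joukowski image is (z^2 - midpoint) / halfwidth, so
  this number is the exterior coordinate.\<close>

lemma exterior_root_eq:
  assumes "z \<notin> intervals"
  shows "exterior_root C D z = of_real halfwidth * outer_coord z - (z\<^sup>2 - of_real midpoint)"
  unfolding exterior_root_def
proof (rule the_equality)
  have pnz: "complex_of_real halfwidth \<noteq> 0" using halfwidth_pos by simp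
  have scale: "2 / ((of_real D)\<^sup>2 - (of_real C)\<^sup>2) * (z\<^sup>2 - ((of_real D)\<^sup>2 + (of_real C)\<^sup>2) / 2 + s) =
      (z\<^sup>2 - of_real midpoint + s) / complex_of_real halfwidth" for s
    by (simp add: halfwidth_def midpoint_def)
  have prod: "(z\<^sup>2 - (of_real C)\<^sup>2) * (z\<^sup>2 - (of_real D)\<^sup>2) = (z\<^sup>2 - of_real midpoint)\<^sup>2 - (of_real halfwidth)\<^sup>2"
    by (simp add: halfwidth_def midpoint_def power2_eq_square field_simps)
  have J: "z\<^sup>2 - of_real midpoint = of_real halfwidth * joukowski (outer_coord z)"
    unfolding outer_coord_def using joukowski_inv_joukowski[of "(z\<^sup>2 - of_real midpoint) / of_real halfwidth"] assms pnz
    by (simp add: not_interval_iff)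
  have nz: "outer_coord z \<noteq> 0" by (rule factor_nonzero[OF assms])
  show "(of_real halfwidth * outer_coord z - (z\<^sup>2 - of_real midpoint))\<^sup>2 = (z\<^sup>2 - (of_real C)\<^sup>2) * (z\<^sup>2 - (of_real D)\<^sup>2) \<and>
     1 < norm (2 / ((of_real D)\<^sup>2 - (of_real C)\<^sup>2) * (z\<^sup>2 - ((of_real D)\<^sup>2 + (of_real C)\<^sup>2) / 2 + (of_real halfwidth * outer_coord z - (z\<^sup>2 - of_real midpoint))))"
  proof
    show "(of_real halfwidth * outer_coord z - (z\<^sup>2 - of_real midpoint))\<^sup>2 = (z\<^sup>2 - (of_real C)\<^sup>2) * (z\<^sup>2 - (of_real D)\<^sup>2)"
      unfolding prod J using nz by (simp add: joukowski_def field_simps power2_eq_square)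
    show "1 < norm (2 / ((of_real D)\<^sup>2 - (of_real C)\<^sup>2) * (z\<^sup>2 - ((of_real D)\<^sup>2 + (of_real C)\<^sup>2) / 2 + (of_real halfwidth * outer_coord z - (z\<^sup>2 - of_real midpoint))))"
      unfolding scale using norm_outer_coord[OF assms] pnz by simp
  qed
  fix s assume s: "s\<^sup>2 = (z\<^sup>2 - (of_real C)\<^sup>2) * (z\<^sup>2 - (of_real D)\<^sup>2) \<and>
     1 < norm (2 / ((of_real D)\<^sup>2 - (of_real C)\<^sup>2) * (z\<^sup>2 - ((of_real D)\<^sup>2 + (of_real C)\<^sup>2) / 2 + s))"
  define \<zeta> where "\<zeta> = (z\<^sup>2 - of_real midpoint + s) / of_real halfwidth"
  have n: "norm \<zeta> > 1" using s unfolding scale \<zeta>_def by simp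
  then have znz: "\<zeta> \<noteq> 0" by auto
  have s\<zeta>: "s = of_real halfwidth * \<zeta> - (z\<^sup>2 - of_real midpoint)"
    using pnz by (simp add: \<zeta>_def)
  have "(of_real halfwidth * \<zeta> - (z\<^sup>2 - of_real midpoint))\<^sup>2 = (z\<^sup>2 - of_real midpoint)\<^sup>2 - (of_real halfwidth)\<^sup>2"
    using s prod unfolding s\<zeta> by simp
  then have "of_real halfwidth * (of_real halfwidth * (\<zeta>\<^sup>2 + 1)) = of_real halfwidth * (2 * \<zeta> * (z\<^sup>2 - of_real midpoint))"
    by (simp add: power2_eq_square algebra_simps)
  then have "of_real halfwidth * (\<zeta>\<^sup>2 + 1) = 2 * \<zeta> * (z\<^sup>2 - of_real midpoint)"
    using pnz by (simp only: mult_cancel_left) simp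
  then have "joukowski \<zeta> = (z\<^sup>2 - of_real midpoint) / of_real halfwidth"
    using pnz znz by (simp add: joukowski_def field_simps power2_eq_square)
  then have "outer_coord z = \<zeta>"
    unfolding outer_coord_def using inv_joukowski_joukowski[OF n] by simp
  then show "s = of_real halfwidth * outer_coord z - (z\<^sup>2 - of_real midpoint)"
    using s\<zeta> by simp
qed

text \<open>For z \<noteq> 0 the radicands agree, as the factor \<zeta> + 1/\<kappa> cancels; at 0
  both sides vanish through the factor z.\<close>

lemma two_interval_map_Some:
  assumes "z \<notin> intervals"
  shows "two_interval_map C D (Some z) = Some (lem_map z)"
proof (cases "z = 0")
  case False
  note nz = factor_nonzero[OF assms]
  have "1 / 2 + of_real (D * C) / (2 * z\<^sup>2) + 1 / (2 * z\<^sup>2) * exterior_root C D z =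
      (z\<^sup>2 + of_real (D * C) + exterior_root C D z) / (2 * z\<^sup>2)"
    using False by (simp add: add_divide_distrib)
  also have "z\<^sup>2 + of_real (D * C) + exterior_root C D z = of_real halfwidth * (outer_coord z + of_real (1 / \<kappa>))"
  proof -
    have "complex_of_real (D * C) + of_real midpoint = of_real (halfwidth / \<kappa>)"
      unfolding halfwidth_over_kappa by (simp add: midpoint_def power2_eq_square algebra_simps)
    then show ?thesis
      unfolding exterior_root_eq[OF assms] by (simp add: algebra_simps)
  qed
  also have "of_real halfwidth * (outer_coord z + of_real (1 / \<kappa>)) / (2 * z\<^sup>2) = 1 / (1 + of_real \<kappa> / outer_coord z)"
  proof -
    have "outer_coord z + of_real (1 / \<kappa>) \<noteq> 0"
      using square_eq_outer_coord[OF assms] False by auto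
    then show ?thesis
      unfolding square_eq_outer_coord[OF assms] using nz halfwidth_pos by (simp add: divide_simps)
  qed
  finally show ?thesis
    by (simp add: two_interval_map_def lem_map_def)
qed (simp add: two_interval_map_def lem_map_def)

lemma lem_map_minus: "lem_map (- z) = - lem_map z"
  by (simp add: lem_map_def outer_coord_def)

lemma intervals_minus: "- z \<in> intervals \<longleftrightarrow> z \<in> intervals"
  using not_interval_iff[of z] not_interval_iff[of "- z"] by simp

text \<open>The distance in question is halfwidth / 2 times |\<zeta>|. Conversely w determines
  \<zeta>, hence z up to sign, and oddness provides the right sign.\<close>

lemma lem_map_image: "lem_map ` (- intervals) = {w. norm (w\<^sup>2 - (of_real ((C + D) / 2))\<^sup>2) > halfwidth / 2}"
proof (intro equalityI subsetI)
  fix w assume "w \<in> lem_map ` (- intervals)"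
  then obtain z where z: "z \<notin> intervals" "w = lem_map z" by auto
  have "norm (w\<^sup>2 - (of_real ((C + D) / 2))\<^sup>2) = halfwidth / 2 * norm (outer_coord z)"
    unfolding z(2) lem_map_square[OF z(1)] using halfwidth_pos by (simp add: norm_mult norm_divide)
  then show "w \<in> {w. norm (w\<^sup>2 - (of_real ((C + D) / 2))\<^sup>2) > halfwidth / 2}"
    using norm_outer_coord[OF z(1)] halfwidth_pos by simp
next
  fix w :: complex assume w: "w \<in> {w. norm (w\<^sup>2 - (of_real ((C + D) / 2))\<^sup>2) > halfwidth / 2}"
  define \<zeta> where "\<zeta> = (w\<^sup>2 - (of_real ((C + D) / 2))\<^sup>2) / of_real (halfwidth / 2)"
  have n: "norm \<zeta> > 1"
  proof -
    have "norm \<zeta> = norm (w\<^sup>2 - (of_real ((C + D) / 2))\<^sup>2) / (halfwidth / 2)"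
      using halfwidth_pos by (simp only: \<zeta>_def norm_divide norm_of_real abs_of_pos half_gt_zero)
    then show ?thesis
      using w halfwidth_pos less_divide_eq_1_pos[of "halfwidth / 2"] by simp
  qed
  define z where "z = csqrt (of_real halfwidth * joukowski \<zeta> + of_real midpoint)"
  have J: "(z\<^sup>2 - of_real midpoint) / of_real halfwidth = joukowski \<zeta>"
    using halfwidth_pos by (simp add: z_def)
  have zI: "z \<notin> intervals"
    using joukowski_image n by (auto simp: not_interval_iff J)
  have "outer_coord z = \<zeta>"
    unfolding outer_coord_def J by (rule inv_joukowski_joukowski[OF n])
  moreover have "complex_of_real (halfwidth / 2) * \<zeta> = w\<^sup>2 - (of_real ((C + D) / 2))\<^sup>2"
    using halfwidth_pos unfolding \<zeta>_def by (intro nonzero_mult_div_cancel_left[THEN trans[OF times_divide_eq_right]]) auto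
  ultimately have "(lem_map z)\<^sup>2 = w\<^sup>2"
    unfolding lem_map_square[OF zI] by (simp only:) simp
  then have "lem_map z = w \<or> lem_map (- z) = w"
    by (auto simp: power2_eq_iff lem_map_minus)
  moreover have "- z \<notin> intervals"
    using zI by (simp add: intervals_minus)
  ultimately show "w \<in> lem_map ` (- intervals)"
    using zI by blast
qed

sublocale exterior_map intervals lem_map
proof
  have "compact ({- D..- C} \<union> {C..D})"
    by (intro compact_Un) auto
  then show "compact intervals"
    unfolding intervals_def by (intro compact_continuous_image continuous_intros)
  have outer_coord_hol: "outer_coord holomorphic_on - intervals"
  proof -
    have "(inv_joukowski \<circ> (\<lambda>z. (z\<^sup>2 - of_real midpoint) / of_real halfwidth)) holomorphic_on - intervals"
      using halfwidth_pos by (intro holomorphic_on_compose holomorphic_intros holomorphic_on_subset[OF inv_joukowski_holomorphic])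
        (auto simp: not_interval_iff)
    then show ?thesis by (simp add: o_def outer_coord_def[abs_def])
  qed
  show "lem_map holomorphic_on - intervals"
    unfolding lem_map_def
  proof (intro holomorphic_intros outer_coord_hol)
    fix z assume z: "z \<in> - intervals"
    then have "Re (1 + of_real \<kappa> / outer_coord z) > 0" using factor_nonzero by blast
    \<comment> \<open>Inversion preserves the right half-plane, so the radicand avoids the branch
      cut of \<open>csqrt\<close>.\<close>
    then have "Re (1 / (1 + of_real \<kappa> / outer_coord z)) > 0"
      using factor_nonzero(4)[of z] z by (auto simp: Re_divide complex_eq_iff sum_power2_gt_zero_iff intro!: divide_pos_pos)
    then show "1 / (1 + of_real \<kappa> / outer_coord z) \<notin> \<real>\<^sub>\<le>\<^sub>0"
      using complex_nonpos_Reals_iff by auto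
    show "outer_coord z \<noteq> 0" using factor_nonzero z by blast
    show "1 + of_real \<kappa> / outer_coord z \<noteq> 0"
      using factor_nonzero z by blast
  qed
  \<comment> \<open>The square of the value determines \<zeta> and with it z^2. By oddness x = - y
    forces the value 0, which is taken at 0 only.\<close>
  show "inj_on lem_map (- intervals)"
  proof (rule inj_onI)
    fix x y assume xy: "x \<in> - intervals" "y \<in> - intervals" "lem_map x = lem_map y"
    have eq: "x'\<^sup>2 = y'\<^sup>2" if "x' \<notin> intervals" "y' \<notin> intervals" "(lem_map x')\<^sup>2 = (lem_map y')\<^sup>2" for x' y'
    proof -
      have "outer_coord x' = outer_coord y'"
        using that(3) halfwidth_pos unfolding lem_map_square[OF that(1)] lem_map_square[OF that(2)] by simp
      then show ?thesis
        using square_eq_outer_coord[OF that(1)] square_eq_outer_coord[OF that(2)] by simp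
    qed
    have "x\<^sup>2 = y\<^sup>2" using eq[of x y] xy by simp
    then consider "x = y" | "x = - y" by (auto simp: power2_eq_iff)
    then show "x = y"
    proof cases
      case 2
      then have "lem_map y = 0" using xy(3) by (simp add: lem_map_minus)
      then have y: "y = 0"
        using factor_nonzero[of y] xy(2) by (auto simp: lem_map_def)
      then show ?thesis using 2 by simp
    qed
  qed
  show "((\<lambda>z. lem_map z / z) \<longlongrightarrow> 1) at_infinity"
  proof -
    have sq: "filterlim (\<lambda>z. (z\<^sup>2 - of_real midpoint) / complex_of_real halfwidth) at_infinity at_infinity"
    proof -
      have "filterlim (\<lambda>z::complex. z\<^sup>2) at_infinity at_infinity"
        by (rule filterlim_power_at_infinity) simp
      then have "filterlim (\<lambda>z. - of_real midpoint + z\<^sup>2) at_infinity (at_infinity :: complex filter)"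
        by (rule tendsto_add_filterlim_at_infinity[OF tendsto_const])
      then have "filterlim (\<lambda>z. inverse (of_real halfwidth) * (- of_real midpoint + z\<^sup>2)) at_infinity (at_infinity :: complex filter)"
        by (rule tendsto_mult_filterlim_at_infinity[OF tendsto_const, rotated]) (use halfwidth_pos in simp)
      then show ?thesis
        by (simp add: field_simps)
    qed
    have ev: "eventually (\<lambda>z. z \<notin> intervals) at_infinity"
      by (rule eventually_notin_compact) fact
    have "filterlim outer_coord at_infinity at_infinity"
      unfolding filterlim_at_infinity[OF order_refl]
    proof (intro allI impI)
      fix r :: real assume "r > 0"
      then have "eventually (\<lambda>z. r \<le> norm ((z\<^sup>2 - of_real midpoint) / complex_of_real halfwidth)) at_infinity"
        using sq unfolding filterlim_at_infinity[OF order_refl] by blast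
      with ev show "eventually (\<lambda>z. r \<le> norm (outer_coord z)) at_infinity"
      proof eventually_elim
        case (elim z)
        then show ?case
          using norm_le_norm_inv_joukowski[of "(z\<^sup>2 - of_real midpoint) / of_real halfwidth"]
          by (auto simp: not_interval_iff outer_coord_def intro: order_trans)
      qed
    qed
    then have "((\<lambda>z. of_real \<kappa> / outer_coord z) \<longlongrightarrow> 0) at_infinity"
      by (intro tendsto_divide_0[OF tendsto_const])
    then have "((\<lambda>z. 1 / (1 + of_real \<kappa> / outer_coord z)) \<longlongrightarrow> 1 / (1 + 0)) at_infinity"
      by (intro tendsto_intros) auto
    then have "((\<lambda>z. csqrt (1 / (1 + of_real \<kappa> / outer_coord z))) \<longlongrightarrow> csqrt 1) at_infinity"
      by (intro isCont_tendsto_compose[where g = csqrt] continuous_at_csqrt) (auto simp: complex_nonpos_Reals_iff)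
    moreover have "eventually (\<lambda>z. csqrt (1 / (1 + of_real \<kappa> / outer_coord z)) = lem_map z / z) at_infinity"
      using eventually_not_equal_at_infinity[of 0] by eventually_elim (simp add: lem_map_def)
    ultimately show ?thesis
      by (auto intro: Lim_transform_eventually)
  qed
qed

end

section \<open>The lemniscatic map of two discs\<close>

locale two_discs =
  fixes r z0 :: real
  assumes r: "0 < r" "r < z0"
begin

definition \<alpha> :: real where "\<alpha> = sqrt (z0\<^sup>2 - r\<^sup>2)"
definition \<rho> :: real where "\<rho> = (sqrt (z0 + r) - sqrt (z0 - r)) / (sqrt (z0 + r) + sqrt (z0 - r))"

lemma alpha_square: "\<alpha>\<^sup>2 = z0\<^sup>2 - r\<^sup>2" and alpha_pos: "\<alpha> > 0"
  using r power_strict_mono[of r z0 2] by (simp_all add: \<alpha>_def)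

text \<open>With a and b the square roots of z0 + r and z0 - r, \<alpha> = a b and \<rho> = (a - b)
  / (a + b). The last identity is what turns the disc around z0 into the region |T z| \<ge>
  1/rho.\<close>

lemma rho_bounds: "0 < \<rho>" "\<rho> < 1"
  and rho_alpha: "\<alpha> * (1 + \<rho>\<^sup>2) = z0 * (1 - \<rho>\<^sup>2)"
proof -
  define a b where "a = sqrt (z0 + r)" and "b = sqrt (z0 - r)"
  have ab: "0 < b" "b < a" "a\<^sup>2 = z0 + r" "b\<^sup>2 = z0 - r"
    using r by (auto simp: a_def b_def)
  have \<rho>: "\<rho> = (a - b) / (a + b)" by (simp add: \<rho>_def a_def b_def)
  show "0 < \<rho>" "\<rho> < 1" using ab by (auto simp: \<rho>)
  have e1: "\<alpha> = a * b"
    using r by (simp add: \<alpha>_def a_def b_def power2_eq_square algebra_simps flip: real_sqrt_mult)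
  have z: "a\<^sup>2 + b\<^sup>2 = 2 * z0" using ab by simp
  have r2: "\<rho>\<^sup>2 = (a - b)\<^sup>2 / (a + b)\<^sup>2" "(a + b)\<^sup>2 \<noteq> 0"
    using ab by (simp_all add: \<rho> power_divide flip: diff_divide_distrib)
  have e2: "1 + \<rho>\<^sup>2 = 2 * (a\<^sup>2 + b\<^sup>2) / (a + b)\<^sup>2"
  proof -
    have "1 + \<rho>\<^sup>2 = ((a + b)\<^sup>2 + (a - b)\<^sup>2) / (a + b)\<^sup>2"
      using r2 by (simp add: add_divide_distrib)
    then show ?thesis by (simp add: power2_eq_square algebra_simps)
  qed
  have e3: "1 - \<rho>\<^sup>2 = 4 * (a * b) / (a + b)\<^sup>2"
  proof -
    have "1 - \<rho>\<^sup>2 = ((a + b)\<^sup>2 - (a - b)\<^sup>2) / (a + b)\<^sup>2"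
      using r2 by (simp add: diff_divide_distrib)
    then show ?thesis by (simp add: power2_eq_square algebra_simps)
  qed
  show "\<alpha> * (1 + \<rho>\<^sup>2) = z0 * (1 - \<rho>\<^sup>2)"
    unfolding e1 e2 e3 z by simp
qed

sublocale slit_annulus \<rho>
  using rho_bounds by unfold_locales

definition scale :: real where "scale = 2 * quarter * \<alpha> / pi"
definition C :: real where "C = scale * (1 - slit_end)\<^sup>2"
definition D :: real where "D = scale * (1 + slit_end)\<^sup>2"
text \<open>This is f'(-1) \<alpha>, as \<open>beta_deriv\<close> shows: the factor of the inverse
  of T after rescaling.\<close>

definition \<beta> :: real where "\<beta> = scale * (1 - slit_end\<^sup>2)"
definition E :: "complex set" where "E = cball (of_real z0) r \<union> cball (- of_real z0) r"
definition to_annulus :: "complex \<Rightarrow> complex" where "to_annulus z = (z + of_real \<alpha>) / (of_real \<alpha> - z)"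
definition to_intervals :: "complex \<Rightarrow> complex" where "to_intervals z = of_real \<beta> * (F (to_annulus z) - 1) / (F (to_annulus z) + 1)"

lemma scale_pos: "scale > 0"
  using quarter_pos alpha_pos by (simp add: scale_def)

lemma beta_pos: "\<beta> > 0"
  using scale_pos slit_end_pos slit_end_less_1 by (simp add: \<beta>_def power_less_one_iff)

lemma C_pos: "0 < C" and C_less_D: "C < D"
proof -
  show "0 < C" using scale_pos slit_end_less_1 by (simp add: C_def)
  have "(1 - slit_end)\<^sup>2 < (1 + slit_end)\<^sup>2" using slit_end_pos slit_end_less_1 by (intro power_strict_mono) auto
  then show "C < D" using scale_pos by (simp add: C_def D_def)
qed

lemma C_beta: "(1 + slit_end) * C = (1 - slit_end) * \<beta>" and D_beta: "(1 - slit_end) * D = (1 + slit_end) * \<beta>"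
  by (simp_all add: C_def D_def \<beta>_def power2_eq_square algebra_simps)

sublocale intv: two_intervals C D
  using C_pos C_less_D by unfold_locales

text \<open>The disc is an Apollonius disc for the points \<alpha> and - \<alpha>;
  \<open>rho_alpha\<close> matches the terms linear in Re z.\<close>

lemma disc_identity:
  fixes z :: complex
  shows "(norm (of_real \<alpha> - z))\<^sup>2 - \<rho>\<^sup>2 * (norm (z + of_real \<alpha>))\<^sup>2 = (1 - \<rho>\<^sup>2) * ((norm (z - of_real z0))\<^sup>2 - r\<^sup>2)"
proof -
  obtain x y where z: "z = Complex x y" by (cases z)
  have "(norm (of_real \<alpha> - z))\<^sup>2 - \<rho>\<^sup>2 * (norm (z + of_real \<alpha>))\<^sup>2 =
      (1 - \<rho>\<^sup>2) * (\<alpha>\<^sup>2 + x\<^sup>2 + y\<^sup>2) - 2 * x * (\<alpha> * (1 + \<rho>\<^sup>2))"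
    unfolding z cmod_power2 by (simp add: power2_eq_square algebra_simps)
  also have "\<dots> = (1 - \<rho>\<^sup>2) * ((norm (z - of_real z0))\<^sup>2 - r\<^sup>2)"
    unfolding rho_alpha alpha_square z cmod_power2 by (simp add: power2_eq_square algebra_simps)
  finally show ?thesis .
qed

lemma outside_disc_iff:
  fixes z :: complex
  shows "norm (z - of_real z0) > r \<longleftrightarrow> \<rho> * norm (z + of_real \<alpha>) < norm (of_real \<alpha> - z)"
proof -
  have "norm (z - of_real z0) > r \<longleftrightarrow> (norm (z - of_real z0))\<^sup>2 > r\<^sup>2"
    using r by (metis norm_ge_zero power2_less_imp_less power_strict_mono less_imp_le pos2)
  also have "\<dots> \<longleftrightarrow> (1 - \<rho>\<^sup>2) * ((norm (z - of_real z0))\<^sup>2 - r\<^sup>2) > 0"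
  proof -
    have "1 - \<rho>\<^sup>2 > 0" using rho by (simp add: power_less_one_iff)
    then show ?thesis by (auto simp: zero_less_mult_iff)
  qed
  also have "\<dots> \<longleftrightarrow> (\<rho> * norm (z + of_real \<alpha>))\<^sup>2 < (norm (of_real \<alpha> - z))\<^sup>2"
    unfolding disc_identity[symmetric] by (simp add: power_mult_distrib)
  also have "\<dots> \<longleftrightarrow> \<rho> * norm (z + of_real \<alpha>) < norm (of_real \<alpha> - z)"
    using rho by (metis norm_ge_zero power2_less_imp_less power_strict_mono less_imp_le pos2 mult_nonneg_nonneg)
  finally show ?thesis .
qed

text \<open>The second disc is the mirror image of the first under z -> -z, which turns T z into 1 /
  T z. The pole \<alpha> of T lies in E and is listed separately because division by zero would map
  it into the finite plane.\<close>

lemma not_in_E_iff: "z \<notin> E \<longleftrightarrow> z \<noteq> of_real \<alpha> \<and> to_annulus z \<in> annulus"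
proof -
  have "z \<notin> E \<longleftrightarrow> norm (z - of_real z0) > r \<and> norm (- z - of_real z0) > r"
    by (auto simp: E_def dist_norm not_le norm_minus_commute)
      (metis minus_diff_eq norm_minus_cancel diff_minus_eq_add add.commute)+
  also have "\<dots> \<longleftrightarrow> \<rho> * norm (z + of_real \<alpha>) < norm (of_real \<alpha> - z) \<and> \<rho> * norm (of_real \<alpha> - z) < norm (z + of_real \<alpha>)"
    unfolding outside_disc_iff by (simp add: add.commute)
  also have "\<dots> \<longleftrightarrow> z \<noteq> of_real \<alpha> \<and> to_annulus z \<in> annulus"
  proof (cases "z = of_real \<alpha>")
    case True
    then show ?thesis using rho alpha_pos by (simp add: not_less mult_nonneg_nonneg)
  next
    case False
    then have "norm (of_real \<alpha> - z) > 0" by auto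
    then show ?thesis
      using False rho by (auto simp: to_annulus_def annulus_def norm_divide field_simps)
  qed
  finally show ?thesis .
qed

lemma minus_not_in_E: "z \<notin> E \<Longrightarrow> - z \<notin> E"
  by (auto simp: E_def dist_norm norm_minus_commute)
    (metis minus_diff_eq norm_minus_cancel diff_minus_eq_add add.commute)+

lemma to_annulus_inverse: "u \<noteq> - 1 \<Longrightarrow> to_annulus (of_real \<alpha> * (u - 1) / (u + 1)) = u \<and> of_real \<alpha> * (u - 1) / (u + 1) \<noteq> of_real \<alpha>"
proof -
  assume u: "u \<noteq> - 1"
  then have u1: "u + 1 \<noteq> 0" by (simp add: eq_neg_iff_add_eq_0)
  have a: "complex_of_real \<alpha> \<noteq> 0" using alpha_pos by simp
  have e: "of_real \<alpha> - of_real \<alpha> * (u - 1) / (u + 1) = 2 * of_real \<alpha> / (u + 1)"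
      "of_real \<alpha> * (u - 1) / (u + 1) + of_real \<alpha> = 2 * of_real \<alpha> * u / (u + 1)"
    using u1 by (simp_all add: field_simps)
  then have "of_real \<alpha> - of_real \<alpha> * (u - 1) / (u + 1) \<noteq> 0"
    using u1 a by simp
  then have "of_real \<alpha> * (u - 1) / (u + 1) \<noteq> of_real \<alpha>"
    by (metis diff_self)
  moreover have "to_annulus (of_real \<alpha> * (u - 1) / (u + 1)) = u"
    unfolding to_annulus_def e using u1 a by simp
  ultimately show ?thesis by blast
qed

lemma to_annulus_nontrivial: "z \<noteq> of_real \<alpha> \<Longrightarrow> to_annulus z \<noteq> - 1"
  using alpha_pos by (auto simp: to_annulus_def field_simps)

lemma inj_to_annulus: "inj_on to_annulus (- {of_real \<alpha>})"
proof (rule inj_onI)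
  fix x y assume xy: "x \<in> - {of_real \<alpha>}" "y \<in> - {of_real \<alpha>}" "to_annulus x = to_annulus y"
  have "(x + of_real \<alpha>) * (of_real \<alpha> - y) = (y + of_real \<alpha>) * (of_real \<alpha> - x)"
    using xy by (simp add: to_annulus_def frac_eq_eq)
  then have "2 * of_real \<alpha> * x = 2 * of_real \<alpha> * y"
    by (simp add: algebra_simps)
  then show "x = y" using alpha_pos by simp
qed

lemma minus_1_ann: "- 1 \<in> annulus"
  using rho by (simp add: annulus_def)

lemma F_to_annulus:
  assumes "z \<notin> E"
  shows "F (to_annulus z) \<notin> slits" "F (to_annulus z) \<noteq> - 1" "F (to_annulus z) \<noteq> 0"
proof -
  have z: "z \<noteq> of_real \<alpha>" "to_annulus z \<in> annulus" using assms not_in_E_iff by auto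
  show 1: "F (to_annulus z) \<notin> slits"
    using slit_map_image_subset z by blast
  show "F (to_annulus z) \<noteq> 0"
    using 1 slit_end_pos by (auto simp: slits_def)
  show "F (to_annulus z) \<noteq> - 1"
    using inj_onD[OF inj_slit_map _ z(2) minus_1_ann] slit_map_minus_1 to_annulus_nontrivial[OF z(1)] by auto
qed

text \<open>Squaring |\<beta> + t| \<le> L |\<beta> - t| gives a quadratic inequality with the roots
  - C and - D. The outer slits are the same condition for - t.\<close>

lemma slit_interval_iff_real:
  assumes "t \<noteq> \<beta>"
  shows "\<bar>(\<beta> + t) / (\<beta> - t)\<bar> \<le> slit_end \<or> \<bar>(\<beta> + t) / (\<beta> - t)\<bar> \<ge> 1 / slit_end \<longleftrightarrow> t \<in> {- D..- C} \<union> {C..D}"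
proof -
  have L: "0 < slit_end" "slit_end < 1" by (rule slit_end_pos slit_end_less_1)+
  have pos: "\<bar>\<beta> - t\<bar> > 0" using assms by simp
  have sq: "\<bar>\<beta> + s\<bar> \<le> slit_end * \<bar>\<beta> - s\<bar> \<longleftrightarrow> s \<in> {- D..- C}" for s
  proof -
    have "\<bar>\<beta> + s\<bar> \<le> slit_end * \<bar>\<beta> - s\<bar> \<longleftrightarrow> \<bar>\<beta> + s\<bar> \<le> \<bar>slit_end * (\<beta> - s)\<bar>"
      using L by (simp add: abs_mult)
    also have "\<dots> \<longleftrightarrow> (\<beta> + s)\<^sup>2 \<le> (slit_end * (\<beta> - s))\<^sup>2"
      by (rule abs_le_square_iff)
    also have "\<dots> \<longleftrightarrow> ((1 + slit_end) * s + (1 - slit_end) * \<beta>) * ((1 - slit_end) * s + (1 + slit_end) * \<beta>) \<le> 0"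
    proof -
      have "(\<beta> + s)\<^sup>2 - (slit_end * (\<beta> - s))\<^sup>2 = ((1 + slit_end) * s + (1 - slit_end) * \<beta>) * ((1 - slit_end) * s + (1 + slit_end) * \<beta>)"
        by (simp add: power2_eq_square algebra_simps)
      then show ?thesis by linarith
    qed
    also have "\<dots> \<longleftrightarrow> ((1 + slit_end) * (1 - slit_end)) * ((s + C) * (s + D)) \<le> 0"
      unfolding C_beta[symmetric] D_beta[symmetric] by (simp add: algebra_simps)
    also have "\<dots> \<longleftrightarrow> (s + C) * (s + D) \<le> 0"
      using L by (simp add: mult_le_0_iff)
    also have "\<dots> \<longleftrightarrow> s \<in> {- D..- C}"
      using C_less_D by (auto simp: mult_le_0_iff)
    finally show ?thesis .
  qed
  have "\<bar>(\<beta> + t) / (\<beta> - t)\<bar> \<le> slit_end \<longleftrightarrow> t \<in> {- D..- C}"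
    using sq[of t] pos by (simp add: abs_divide pos_divide_le_eq)
  moreover have "\<bar>(\<beta> + t) / (\<beta> - t)\<bar> \<ge> 1 / slit_end \<longleftrightarrow> - t \<in> {- D..- C}"
    using sq[of "- t"] pos L by (simp add: abs_divide pos_le_divide_eq pos_divide_le_eq mult.commute)
  ultimately show ?thesis by auto
qed

lemma slit_interval_iff:
  assumes "v \<noteq> of_real \<beta>"
  shows "v \<in> intv.intervals \<longleftrightarrow> (of_real \<beta> + v) / (of_real \<beta> - v) \<in> slits"
proof -
  have main: "of_real t \<in> intv.intervals \<longleftrightarrow> (of_real \<beta> + of_real t) / (of_real \<beta> - of_real t :: complex) \<in> slits"
    if "t \<noteq> \<beta>" for t
  proof -
    have "(of_real \<beta> + of_real t) / (of_real \<beta> - of_real t :: complex) = of_real ((\<beta> + t) / (\<beta> - t))"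
      by simp
    then have "(of_real \<beta> + of_real t) / (of_real \<beta> - of_real t :: complex) \<in> slits \<longleftrightarrow>
        \<bar>(\<beta> + t) / (\<beta> - t)\<bar> \<le> slit_end \<or> \<bar>(\<beta> + t) / (\<beta> - t)\<bar> \<ge> 1 / slit_end"
      by (simp only: slits_def mem_Collect_eq Re_complex_of_real Im_complex_of_real) simp
    then show ?thesis
      unfolding slit_interval_iff_real[OF that] intv.intervals_def by (auto simp: image_iff)
  qed
  show ?thesis
  proof (cases "\<exists>t. v = of_real t")
    case True
    then show ?thesis using main assms by auto
  next
    case False
    have "(of_real \<beta> + v) / (of_real \<beta> - v) \<notin> slits"
    proof
      assume "(of_real \<beta> + v) / (of_real \<beta> - v) \<in> slits"
      then obtain x where x: "(of_real \<beta> + v) / (of_real \<beta> - v) = of_real x"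
        unfolding slits_def by (metis (mono_tags, lifting) mem_Collect_eq complex_is_Real_iff Reals_cases)
      have "of_real \<beta> - v \<noteq> 0" using assms by simp
      then have "of_real \<beta> + v = of_real x * (of_real \<beta> - v)"
        using x by (simp add: divide_eq_eq)
      then have eq: "v * of_real (1 + x) = of_real (\<beta> * (x - 1))"
        by (simp add: algebra_simps)
      moreover have "x \<noteq> - 1"
        using eq beta_pos by auto
      ultimately have "v = of_real (\<beta> * (x - 1) / (1 + x))"
        by (simp add: eq_divide_eq add_eq_0_iff) (metis eq_neg_iff_add_eq_0 of_real_eq_0_iff of_real_add of_real_1)
      then show False using False by blast
    qed
    moreover have "v \<notin> intv.intervals"
      using False by (auto simp: intv.intervals_def)
    ultimately show ?thesis by simp
  qed
qed

text \<open>\<beta> corresponds to w = infinity, where the two outer slits meet.\<close>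

lemma beta_in_intervals: "of_real \<beta> \<in> intv.intervals"
proof -
  have "C \<le> \<beta>"
    using scale_pos slit_end_pos slit_end_less_1 by (simp add: C_def \<beta>_def power2_eq_square algebra_simps)
  moreover have "\<beta> \<le> D"
  proof -
    have "(1 + slit_end)\<^sup>2 - (1 - slit_end\<^sup>2) = 2 * slit_end * (1 + slit_end)"
      by (simp add: power2_eq_square algebra_simps)
    moreover have "2 * slit_end * (1 + slit_end) > 0" using slit_end_pos by simp
    ultimately have "1 - slit_end\<^sup>2 \<le> (1 + slit_end)\<^sup>2" by linarith
    then show ?thesis
      using scale_pos by (simp add: D_def \<beta>_def)
  qed
  ultimately show ?thesis by (auto simp: intv.intervals_def)
qed

lemma to_intervals_inverse:
  fixes w :: complex
  assumes "w \<noteq> - 1"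
  defines "v \<equiv> of_real \<beta> * (w - 1) / (w + 1)"
  shows "v \<noteq> of_real \<beta>" "(of_real \<beta> + v) / (of_real \<beta> - v) = w"
proof -
  have w1: "w + 1 \<noteq> 0" using assms(1) by (simp add: eq_neg_iff_add_eq_0)
  have b: "complex_of_real \<beta> \<noteq> 0" using beta_pos by simp
  have e: "of_real \<beta> - v = 2 * of_real \<beta> / (w + 1)" "of_real \<beta> + v = 2 * of_real \<beta> * w / (w + 1)"
    using w1 by (simp_all add: v_def field_simps)
  then have "of_real \<beta> - v \<noteq> 0" using w1 b by simp
  then show "v \<noteq> of_real \<beta>" by auto
  show "(of_real \<beta> + v) / (of_real \<beta> - v) = w"
    unfolding e using w1 b by simp
qed

lemma to_intervals_not_interval: "z \<notin> E \<Longrightarrow> to_intervals z \<notin> intv.intervals"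
  using to_intervals_inverse[OF F_to_annulus(2)[of z]] F_to_annulus(1)[of z] slit_interval_iff[of "to_intervals z"] by (simp add: to_intervals_def)

lemma to_intervals_image: "to_intervals ` (- E) = - intv.intervals"
proof (intro equalityI subsetI)
  fix v assume v: "v \<in> - intv.intervals"
  then have vb: "v \<noteq> of_real \<beta>" using beta_in_intervals by auto
  define w where "w = (of_real \<beta> + v) / (of_real \<beta> - v)"
  have "w \<notin> slits" using slit_interval_iff[OF vb] v by (simp add: w_def)
  then obtain u where u: "u \<in> annulus" "F u = w" using slit_map_onto by blast
  have b: "of_real \<beta> - v \<noteq> 0" using vb by simp
  have bnz: "complex_of_real \<beta> \<noteq> 0" using beta_pos by simp
  have w: "w + 1 = 2 * of_real \<beta> / (of_real \<beta> - v)" "w - 1 = 2 * v / (of_real \<beta> - v)"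
    using b by (simp_all add: w_def field_simps)
  then have "w + 1 \<noteq> 0" using b bnz by simp
  then have "u \<noteq> - 1" using u slit_map_minus_1 by auto
  define z where "z = of_real \<alpha> * (u - 1) / (u + 1)"
  have z: "to_annulus z = u" "z \<noteq> of_real \<alpha>" using to_annulus_inverse[OF \<open>u \<noteq> - 1\<close>] by (auto simp: z_def)
  then have "z \<notin> E" using u by (simp add: not_in_E_iff)
  moreover have "to_intervals z = v"
    unfolding to_intervals_def z u w using b bnz by simp
  ultimately show "v \<in> to_intervals ` (- E)" by blast
qed (use to_intervals_not_interval in auto)

text \<open>Under z -> -z both T z and F (T z) are inverted, and w -> \<beta> (w - 1)/(w + 1) turns
  inversion into a change of sign.\<close>

lemma to_intervals_minus: "z \<notin> E \<Longrightarrow> to_intervals (- z) = - to_intervals z"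
proof -
  assume z: "z \<notin> E"
  have za: "z \<noteq> of_real \<alpha>" "to_annulus z \<in> annulus" using z not_in_E_iff by auto
  have "to_annulus (- z) = 1 / to_annulus z"
    by (simp add: to_annulus_def add.commute)
  then have "F (to_annulus (- z)) = 1 / F (to_annulus z)"
    using slit_map_inverse[OF annulus_nz[OF za(2)]] by simp
  moreover have "of_real \<beta> * (1 / w - 1) / (1 / w + 1) = - (of_real \<beta> * (w - 1) / (w + 1))" if "w \<noteq> 0" "w \<noteq> - 1" for w :: complex
  proof -
    have "1 / w - 1 = (1 - w) / w" "1 / w + 1 = (w + 1) / w" using that by (simp_all add: field_simps)
    then have "of_real \<beta> * (1 / w - 1) / (1 / w + 1) = of_real \<beta> * (1 - w) / (w + 1)"
      using that by simp
    also have "\<dots> = - (of_real \<beta> * (w - 1) / (w + 1))"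
      by (metis minus_diff_eq mult_minus_right minus_divide_left)
    finally show ?thesis .
  qed
  ultimately show ?thesis
    using F_to_annulus(2,3)[OF z] by (simp add: to_intervals_def)
qed

lemma inj_to_intervals: "inj_on to_intervals (- E)"
proof (rule inj_onI)
  fix x y assume xy: "x \<in> - E" "y \<in> - E" "to_intervals x = to_intervals y"
  have "F (to_annulus z) = (of_real \<beta> + to_intervals z) / (of_real \<beta> - to_intervals z)" if "z \<notin> E" for z
    unfolding to_intervals_def by (rule to_intervals_inverse(2)[OF F_to_annulus(2)[OF that], symmetric])
  then have "F (to_annulus x) = F (to_annulus y)"
    using xy by (metis ComplD)
  moreover have "to_annulus x \<in> annulus" "to_annulus y \<in> annulus" "x \<in> - {of_real \<alpha>}" "y \<in> - {of_real \<alpha>}"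
    using xy(1,2) not_in_E_iff by auto
  ultimately show "x = y"
    using inj_onD[OF inj_slit_map] inj_onD[OF inj_to_annulus] by meson
qed

lemma compact_E: "compact E"
  unfolding E_def by (intro compact_Un compact_cball)

lemma to_intervals_holomorphic: "to_intervals holomorphic_on - E"
proof -
  have to_annulus: "to_annulus holomorphic_on - E"
    unfolding to_annulus_def by (intro holomorphic_intros) (auto simp: not_in_E_iff)
  have F: "F holomorphic_on annulus"
    using slit_map_field_differentiable annulus_nz slit_den_annulus
    by (auto simp: holomorphic_on_def intro: field_differentiable_at_within)
  have "to_annulus ` (- E) \<subseteq> annulus"
    by (auto simp: not_in_E_iff)
  then have "(F \<circ> to_annulus) holomorphic_on - E"
    by (rule holomorphic_on_compose[OF to_annulus holomorphic_on_subset[OF F]])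
  then have "(\<lambda>z. F (to_annulus z)) holomorphic_on - E"
    by (simp add: o_def)
  moreover have "F (to_annulus z) + 1 \<noteq> 0" if "z \<in> - E" for z
    using F_to_annulus(2)[of z] that by (simp add: add_eq_0_iff2)
  ultimately show ?thesis
    unfolding to_intervals_def by (intro holomorphic_intros)
qed

lemmas eventually_not_E = eventually_notin_compact[OF compact_E]

lemma beta_deriv: "deriv F (- 1) * of_real \<alpha> = of_real \<beta>"
  unfolding deriv_slit_map_minus_1 \<beta>_def scale_def by (simp add: field_simps)

text \<open>T tends to -1 with T + 1 = 2 \<alpha> / (\<alpha> - z), and F(T) + 1 is asymptotic to
  F'(-1) (T + 1). The limit is therefore \<beta> / (F'(-1) \<alpha>) = 1; this is the purpose of the
  factor f'(-1).\<close>

lemma to_intervals_asymptotics: "((\<lambda>z. to_intervals z / z) \<longlongrightarrow> 1) at_infinity"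
proof -
  have a: "complex_of_real \<alpha> \<noteq> 0" using alpha_pos by simp
  have dnz: "deriv F (- 1) \<noteq> 0"
    using beta_deriv beta_pos by auto
  have az: "((\<lambda>z. of_real \<alpha> / z) \<longlongrightarrow> 0) (at_infinity :: complex filter)"
    by (intro tendsto_divide_0[OF tendsto_const] filterlim_ident)
  have "((\<lambda>z. (1 + of_real \<alpha> / z) / (of_real \<alpha> / z - 1)) \<longlongrightarrow> (1 + 0) / (0 - 1)) (at_infinity :: complex filter)"
    by (intro tendsto_intros az) auto
  moreover have "eventually (\<lambda>z. (1 + of_real \<alpha> / z) / (of_real \<alpha> / z - 1) = to_annulus z) at_infinity"
    using eventually_not_equal_at_infinity[of 0]
  proof eventually_elim
    case (elim z)
    then have "1 + of_real \<alpha> / z = (z + of_real \<alpha>) / z" "of_real \<alpha> / z - 1 = (of_real \<alpha> - z) / z"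
      by (simp_all add: field_simps)
    then show ?case using elim by (simp add: to_annulus_def)
  qed
  ultimately have "(to_annulus \<longlongrightarrow> - 1) at_infinity"
    by (auto intro: Lim_transform_eventually)
  \<comment> \<open>The difference quotient of F needs the punctured filter, and T does not take the
    value -1 at finite points.\<close>
  then have trl: "filterlim to_annulus (at (- 1)) at_infinity"
    using eventually_not_E by (auto simp: filterlim_at not_in_E_iff to_annulus_nontrivial elim: eventually_mono)
  have B1: "B (- 1) \<noteq> 0" by (rule slit_den_annulus[OF minus_1_ann])
  have DF: "(F has_field_derivative deriv F (- 1)) (at (- 1))"
    unfolding DERIV_deriv_iff_field_differentiable by (rule slit_map_field_differentiable[OF _ B1]) simp
  have "((\<lambda>w. (F w - F (- 1)) / (w - (- 1))) \<longlongrightarrow> deriv F (- 1)) (at (- 1))"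
    using DF unfolding has_field_derivative_iff .
  then have l1: "((\<lambda>z. (F (to_annulus z) + 1) / (to_annulus z + 1)) \<longlongrightarrow> deriv F (- 1)) at_infinity"
    using filterlim_compose[OF _ trl] by (simp add: slit_map_minus_1)
  have "(F \<longlongrightarrow> - 1) (at (- 1))"
    using DERIV_isCont[OF DF] slit_map_minus_1 by (simp add: isCont_def)
  then have l2: "((\<lambda>z. F (to_annulus z)) \<longlongrightarrow> - 1) at_infinity"
    using filterlim_compose[OF _ trl] by blast
  have "((\<lambda>z. of_real \<beta> * (F (to_annulus z) - 1) / ((F (to_annulus z) + 1) / (to_annulus z + 1)) * ((of_real \<alpha> / z - 1) / (2 * of_real \<alpha>)))
      \<longlongrightarrow> of_real \<beta> * (- 1 - 1) / deriv F (- 1) * ((0 - 1) / (2 * of_real \<alpha>))) at_infinity"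
    by (intro tendsto_intros l1 l2 az) (use dnz a in auto)
  also have "of_real \<beta> * (- 1 - 1) / deriv F (- 1) * ((0 - 1) / (2 * of_real \<alpha>)) = 1"
    unfolding beta_deriv[symmetric] using dnz a by (simp add: field_simps)
  finally have "((\<lambda>z. of_real \<beta> * (F (to_annulus z) - 1) / ((F (to_annulus z) + 1) / (to_annulus z + 1)) * ((of_real \<alpha> / z - 1) / (2 * of_real \<alpha>)))
      \<longlongrightarrow> 1) at_infinity" .
  moreover have "eventually (\<lambda>z. of_real \<beta> * (F (to_annulus z) - 1) / ((F (to_annulus z) + 1) / (to_annulus z + 1)) * ((of_real \<alpha> / z - 1) / (2 * of_real \<alpha>)) = to_intervals z / z) at_infinity"
    using eventually_not_E eventually_not_equal_at_infinity[of 0]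
  proof eventually_elim
    case (elim z)
    have az: "of_real \<alpha> - z \<noteq> 0" using elim not_in_E_iff by auto
    have t: "to_annulus z + 1 = 2 * of_real \<alpha> / (of_real \<alpha> - z)" "of_real \<alpha> / z - 1 = (of_real \<alpha> - z) / z"
      using az elim by (simp_all add: to_annulus_def field_simps)
    have "x / (y / (2 * c / d)) * (d / z / (2 * c)) = x / y / z" if "c \<noteq> 0" "d \<noteq> 0" for x y c d :: complex
      using that by simp
    then show ?case
      unfolding to_intervals_def t using az a by simp
  qed
  ultimately show ?thesis
    by (rule Lim_transform_eventually)
qed

lemma filterlim_to_intervals: "filterlim to_intervals at_infinity at_infinity"
  by (rule filterlim_at_infinity_of_quotient[OF to_intervals_asymptotics]) simp

sublocale disc: exterior_map E "intv.lem_map \<circ> to_intervals"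
proof
  show "compact E" by (rule compact_E)
  show "(intv.lem_map \<circ> to_intervals) holomorphic_on - E"
    by (intro holomorphic_on_compose to_intervals_holomorphic) (simp add: to_intervals_image intv.holo)
  show "inj_on (intv.lem_map \<circ> to_intervals) (- E)"
    by (intro comp_inj_on inj_to_intervals) (simp add: to_intervals_image intv.inj)
  have "((\<lambda>z. intv.lem_map (to_intervals z) / to_intervals z) \<longlongrightarrow> 1) at_infinity"
    by (rule filterlim_compose[OF intv.lim filterlim_to_intervals])
  then have "((\<lambda>z. (intv.lem_map (to_intervals z) / to_intervals z) * (to_intervals z / z)) \<longlongrightarrow> 1 * 1) at_infinity"
    by (intro tendsto_mult to_intervals_asymptotics)
  moreover have "eventually (\<lambda>z. (intv.lem_map (to_intervals z) / to_intervals z) * (to_intervals z / z) = (intv.lem_map \<circ> to_intervals) z / z) at_infinity"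
  proof -
    have "eventually (\<lambda>z. 1 \<le> norm (to_intervals z)) at_infinity"
      using filterlim_to_intervals unfolding filterlim_at_infinity[OF order_refl] by (metis zero_less_one)
    then show ?thesis
      by eventually_elim auto
  qed
  ultimately show "((\<lambda>z. (intv.lem_map \<circ> to_intervals) z / z) \<longlongrightarrow> 1) at_infinity"
    by (auto intro: Lim_transform_eventually)
qed

definition level :: real where "level = sqrt (2 * slit_end * (1 + slit_end\<^sup>2)) * scale"

lemma level_pos: "level > 0"
  using slit_end_pos scale_pos by (simp add: level_def add_pos_nonneg)

definition center :: real where "center = scale * (1 + slit_end\<^sup>2)"

lemma center_pos: "center > 0"
  using scale_pos by (simp add: center_def add_pos_nonneg)

text \<open>(C + D)/2 is \<open>center\<close>, and (D^2 - C^2)/4 = 2 L (1 + L^2) (2 K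
  \<alpha>/pi)^2 is the square of \<open>level\<close>.\<close>

lemma lemniscate_eq:
  "{w. norm (w\<^sup>2 - (of_real ((C + D) / 2))\<^sup>2) > intv.halfwidth / 2} = {w. norm (w\<^sup>2 - (of_real center)\<^sup>2) powr (1 / 2) > level}"
proof -
  have c: "(C + D) / 2 = center"
    by (simp add: C_def D_def center_def power2_eq_square algebra_simps)
  have "0 \<le> 2 * slit_end * (1 + slit_end\<^sup>2)" using slit_end_pos by simp
  then have "level\<^sup>2 = 2 * slit_end * (1 + slit_end\<^sup>2) * scale\<^sup>2"
    by (simp add: level_def power_mult_distrib)
  also have "\<dots> = intv.halfwidth / 2"
    unfolding intv.halfwidth_def unfolding C_def D_def by (simp add: power2_eq_square algebra_simps)
  finally have l: "intv.halfwidth / 2 = level\<^sup>2" ..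
  have "level\<^sup>2 < x \<longleftrightarrow> level < x powr (1 / 2)" if "x \<ge> 0" for x
    using level_pos that real_less_rsqrt[of level x] power_strict_mono[of level "sqrt x" 2] by (auto simp: powr_half_sqrt)
  then show ?thesis
    unfolding c l by simp
qed

lemma walsh_E: "walsh_union 2 E"
  unfolding E_def
proof (rule walsh_union_two_convex)
  have ns: "cball c r \<noteq> {z}" for c z :: complex
  proof
    assume eq: "cball c r = {z}"
    have "c \<in> cball c r" "c + of_real r \<in> cball c r" using r by (auto simp: dist_norm)
    then have "c = c + of_real r" unfolding eq by simp
    then show False using r by simp
  qed
  then show "cball (of_real z0) r \<noteq> {z}" "cball (- of_real z0) r \<noteq> {z}" for z :: complex by auto
  show "cball (of_real z0) r \<inter> cball (- complex_of_real z0) r = {}"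
  proof (rule disjoint_cballI)
    have "dist (of_real z0) (- complex_of_real z0) = norm (complex_of_real (2 * z0))"
      by (simp add: dist_norm)
    then show "dist (of_real z0) (- complex_of_real z0) > r + r"
      using r by (simp only: norm_of_real)
  qed
qed (use r in auto)

lemma walsh_intervals: "walsh_union 2 intv.intervals"
  unfolding intv.intervals_def image_Un
proof (rule walsh_union_two_convex)
  have cpt: "compact (complex_of_real ` {x..y})" "convex (complex_of_real ` {x..y})" for x y
    by (auto intro!: compact_continuous_image continuous_intros convex_linear_image bounded_linear.linear bounded_linear_of_real)
  then show "compact (complex_of_real ` {- D..- C})" "compact (complex_of_real ` {C..D})"
      "convex (complex_of_real ` {- D..- C})" "convex (complex_of_real ` {C..D})"
    by blast+
  have ns: "complex_of_real ` {x..y} \<noteq> {z}" if "x < y" for x y z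
  proof
    assume eq: "complex_of_real ` {x..y} = {z}"
    have "complex_of_real x \<in> complex_of_real ` {x..y}" "complex_of_real y \<in> complex_of_real ` {x..y}"
      using that by auto
    then have "complex_of_real x = complex_of_real y" unfolding eq by simp
    then show False using that by simp
  qed
  then show "complex_of_real ` {- D..- C} \<noteq> {z}" "complex_of_real ` {C..D} \<noteq> {z}" for z
    using C_less_D by auto
qed (use C_pos C_less_D in auto)

lemma is_lemniscatic_domain_level:
  "is_lemniscatic_domain 2 (insert None (Some ` {w. norm (w\<^sup>2 - (of_real center)\<^sup>2) powr (1 / 2) > level}))"
  using is_lemniscatic_domain_two[of "of_real center" level] center_pos level_pos by simp

lemma phi_image: "intv.lem_map ` (- intv.intervals) = {w. norm (w\<^sup>2 - (of_real center)\<^sup>2) powr (1 / 2) > level}"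
  unfolding intv.lem_map_image lemniscate_eq ..

lemma disc_image: "(intv.lem_map \<circ> to_intervals) ` (- E) = {w. norm (w\<^sup>2 - (of_real center)\<^sup>2) powr (1 / 2) > level}"
  unfolding image_comp[symmetric] to_intervals_image phi_image ..

lemma intervals_lemniscatic_map:
  "is_lemniscatic_map intv.intervals (two_interval_map C D)
     (insert None (Some ` {w. norm (w\<^sup>2 - (of_real center)\<^sup>2) powr (1 / 2) > level}))"
  using intv.is_lemniscatic_mapI[of "two_interval_map C D" 2] intv.two_interval_map_Some
    intv.intervals_minus intv.lem_map_minus walsh_intervals is_lemniscatic_domain_level
  unfolding phi_image by (simp add: two_interval_map_def)

lemma discs_lemniscatic_map:
  assumes "\<Phi> None = None" "\<And>z. z \<notin> E \<Longrightarrow> \<Phi> (Some z) = Some (intv.lem_map (to_intervals z))"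
  shows "is_lemniscatic_map E \<Phi> (insert None (Some ` {w. norm (w\<^sup>2 - (of_real center)\<^sup>2) powr (1 / 2) > level}))"
  using disc.is_lemniscatic_mapI[of \<Phi> 2] assms minus_not_in_E to_intervals_minus intv.lem_map_minus walsh_E is_lemniscatic_domain_level
  unfolding disc_image by simp

lemma log_capacity_discs: "log_capacity E = level"
  by (rule disc.log_capacity_eq[OF level_pos disc_image])

text \<open>The argument undoes the affine substitution in \<open>jacobi_sn_eq\<close>; what remains
  is exp (Ln (z / rho)) = z / rho, true for any branch.\<close>

lemma jacobi_sn_slit_map:
  assumes "z \<in> annulus"
  shows "of_real slit_end * jacobi_sn (slit_end\<^sup>2) (of_real (2 * quarter / pi) * \<i> * Ln (z / r\<^sub>c) + of_real quarter) = F z"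
proof -
  have "z / r\<^sub>c \<noteq> 0" using annulus_nz[OF assms] by simp
  have q: "complex_of_real quarter \<noteq> 0" using quarter_pos by simp
  have "- \<i> * of_real pi * (of_real (2 * quarter / pi) * \<i> * Ln (z / r\<^sub>c) + of_real quarter - of_real quarter) / (2 * of_real quarter)
      = Ln (z / r\<^sub>c)"
    using q by (simp add: field_simps)
  then have "exp (- \<i> * of_real pi * (of_real (2 * quarter / pi) * \<i> * Ln (z / r\<^sub>c) + of_real quarter - of_real quarter) / (2 * of_real quarter))
      = z / r\<^sub>c"
    using exp_Ln[OF \<open>z / r\<^sub>c \<noteq> 0\<close>] by (simp only:)
  then show ?thesis
    unfolding jacobi_sn_eq using slit_end_pos by (simp only:) simp
qed

abbreviation "T \<equiv> sphere_moebius 1 (of_real \<alpha>) (- 1) (of_real \<alpha>)"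

lemma T_None: "T None = Some (- 1)"
  by (simp add: sphere_moebius_def)

lemma T_Some: "z \<noteq> of_real \<alpha> \<Longrightarrow> T (Some z) = Some (to_annulus z)"
  by (simp add: sphere_moebius_def to_annulus_def)

lemma T_pole: "T (Some (of_real \<alpha>)) = None"
  by (simp add: sphere_moebius_def)

text \<open>Injectivity makes \<open>inv T\<close> the true inverse on values of T, not an arbitrary
  choice of preimage.\<close>

lemma inj_T: "inj T"
proof (rule injI)
  fix p q assume eq: "T p = T q"
  have "p = None \<or> p = Some (of_real \<alpha>) \<or> (\<exists>z. z \<noteq> of_real \<alpha> \<and> p = Some z)" for p
    by (cases p) auto
  from this[of p] this[of q] show "p = q"
    using eq inj_onD[OF inj_to_annulus] to_annulus_nontrivial by (auto simp: T_None T_Some T_pole dest: sym)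
qed

lemma inv_T: "inv T (Some (- 1)) = None" "w \<noteq> - 1 \<Longrightarrow> inv T (Some w) = Some (of_real \<alpha> * (w - 1) / (w + 1))"
proof -
  show "inv T (Some (- 1)) = None"
    by (rule inv_f_eq[OF inj_T T_None])
  assume w: "w \<noteq> - 1"
  show "inv T (Some w) = Some (of_real \<alpha> * (w - 1) / (w + 1))"
    by (rule inv_f_eq[OF inj_T]) (use to_annulus_inverse[OF w] in \<open>simp add: T_Some\<close>)
qed

end

theorem theorem4p2:
  fixes r z0 \<alpha> \<rho> L k K C D :: real
    and E :: "complex set"
    and f :: "complex \<Rightarrow> complex"
    and T \<Phi>1 \<Phi> :: "sphere \<Rightarrow> sphere"
  assumes "0 < r" and "r < z0"
    and "E = cball (of_real z0) r \<union> cball (- of_real z0) r"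
    and "\<alpha> = sqrt (z0\<^sup>2 - r\<^sup>2)"
    and "T = sphere_moebius 1 (of_real \<alpha>) (- 1) (of_real \<alpha>)"
    and "\<rho> = (sqrt (z0 + r) - sqrt (z0 - r)) / (sqrt (z0 + r) + sqrt (z0 - r))"
    and "L = 2 * \<rho> * (\<Prod>n. ((1 + \<rho> ^ (8 * Suc n)) / (1 + \<rho> ^ (8 * Suc n - 4)))\<^sup>2)"
    and "k = L\<^sup>2"
    and "K = integral {0..1} (\<lambda>t. 1 / sqrt ((1 - t\<^sup>2) * (1 - k\<^sup>2 * t\<^sup>2)))"
    and "\<And>z. \<rho> < norm z \<Longrightarrow> norm z < inverse \<rho> \<Longrightarrow>
           f z = of_real L *
             jacobi_sn k (of_real (2 * K / pi) * \<i> * Ln (z / of_real \<rho>) + of_real K)"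
    and "C = 2 * K * \<alpha> / pi * (1 - L)\<^sup>2"
    and "D = 2 * K * \<alpha> / pi * (1 + L)\<^sup>2"
    and "\<Phi>1 = two_interval_map C D"
    and "\<Phi> = \<Phi>1 \<circ> map_option (\<lambda>z. deriv f (- 1) * z) \<circ> inv T \<circ> map_option f \<circ> T"
  shows "0 < \<alpha> \<and> 0 < \<rho> \<and> \<rho> < 1 \<and>
    (\<exists>\<L>1. is_lemniscatic_map (of_real ` ({- D..- C} \<union> {C..D})) \<Phi>1 \<L>1) \<and>
    is_lemniscatic_map E \<Phi>
      (insert None (Some ` {w. norm (w\<^sup>2 - (of_real (2 * K * \<alpha> / pi * (1 + L\<^sup>2)))\<^sup>2) powr (1 / 2)
                               > sqrt (2 * L * (1 + L\<^sup>2)) * (2 * K * \<alpha> / pi)})) \<and>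
    log_capacity E = sqrt (2 * L * (1 + L\<^sup>2)) * (2 * K * \<alpha> / pi)"
proof -
  interpret X: two_discs r z0
    using assms(1,2) by unfold_locales
  have \<alpha>: "\<alpha> = X.\<alpha>" and \<rho>: "\<rho> = X.\<rho>"
    using assms(4,6) by (simp_all add: X.\<alpha>_def X.\<rho>_def)
  have L: "L = X.slit_end"
    unfolding assms(7) \<rho> X.slit_map_rho_product ..
  have K: "K = X.quarter"
    unfolding assms(9) assms(8) L X.quarter_def elliptic_F_def ..
  have scale: "2 * K * \<alpha> / pi = X.scale"
    by (simp add: X.scale_def K \<alpha>)
  have C: "C = X.C" and D: "D = X.D"
    using assms(11,12) by (simp_all only: X.C_def X.D_def scale L)
  have E: "E = X.E"
    using assms(3) by (simp add: X.E_def)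
  have f: "f z = X.F z" if "z \<in> X.annulus" for z
    using assms(10)[of z] that X.jacobi_sn_slit_map[OF that]
    by (simp add: \<rho> L K assms(8) X.annulus_def inverse_eq_divide)
  \<comment> \<open>\<open>f\<close> is prescribed on the annulus only; as this is open and contains
    -1, f'(-1) is determined.\<close>
  have "open X.annulus"
    unfolding X.annulus_def by (intro open_Collect_conj open_Collect_less continuous_intros)
  then have "eventually (\<lambda>z. f z = X.F z) (nhds (- 1))"
    using eventually_nhds_in_open[OF _ X.minus_1_ann] f by (auto elim: eventually_mono)
  then have df: "deriv f (- 1) = deriv X.F (- 1)"
    by (rule deriv_cong_ev) simp
  have T: "T = X.T"
    using assms(5) \<alpha> by simp
  \<comment> \<open>T sends infinity to -1, F fixes -1, and the inverse of T leads back to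
    infinity.\<close>
  have "\<Phi> None = None"
    using f[OF X.minus_1_ann] X.slit_map_minus_1
    by (simp add: assms(13,14) T X.T_None X.inv_T two_interval_map_def)
  moreover have "\<Phi> (Some z) = Some (X.intv.lem_map (X.to_intervals z))" if z: "z \<notin> X.E" for z
  proof -
    have za: "z \<noteq> of_real X.\<alpha>" "X.to_annulus z \<in> X.annulus"
      using z X.not_in_E_iff by auto
    have "deriv X.F (- 1) * (of_real X.\<alpha> * (X.F (X.to_annulus z) - 1) / (X.F (X.to_annulus z) + 1)) = X.to_intervals z"
      unfolding X.to_intervals_def X.beta_deriv[symmetric] by (simp add: mult.assoc)
    then show ?thesis
      using X.T_Some[OF za(1)] X.inv_T(2)[OF X.F_to_annulus(2)[OF z]] f[OF za(2)]
        X.intv.two_interval_map_Some[OF X.to_intervals_not_interval[OF z]]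
      by (simp add: assms(13,14) T df C D)
  qed
  ultimately have "is_lemniscatic_map X.E \<Phi>
      (insert None (Some ` {w. norm (w\<^sup>2 - (of_real X.center)\<^sup>2) powr (1 / 2) > X.level}))"
    by (rule X.discs_lemniscatic_map)
  moreover have "\<exists>\<L>1. is_lemniscatic_map (of_real ` ({- D..- C} \<union> {C..D})) \<Phi>1 \<L>1"
    using X.intervals_lemniscatic_map unfolding X.intv.intervals_def C D assms(13) by blast
  ultimately show ?thesis
    using X.alpha_pos X.rho X.log_capacity_discs
    unfolding scale unfolding L E \<alpha> \<rho> X.center_def X.level_def by blast
qed

end
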